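(* Let $W$ be a (left) weak $V$-module and let $z$ be a nonzero complex number. Then the pair $(\mathcal{D}_{Q(z)}(W), Y_{Q(z)})$, where $Y_{Q(z)}(u\otimes v,x)=Y^{L}_{Q(z)}(u,x)Y^{R}_{Q(z)}(v,x)$ for $u,v\in V$, carries the structure of a weak $V\otimes V$-module.
   Context: $V=(V,Y,\mathbf 1,\omega)$ is a fixed vertex operator algebra over $\mathbb C$, with $Y(\omega,x)=\sum_n L(n)x^{-n-2}$. A (left) weak $V$-module is a vector space $W$ with a linear map $Y:V\to(\mathrm{End}\,W)[[x,x^{-1}]]$, $Y(v,x)=\sum_n v_nx^{-n-1}$, satisfying all axioms of a $V$-module except those involving grading: $Y(v,x)w\in W((x))$, $Y(\mathbf 1,x)=1$, and the Jacobi identity. $V\otimes V$ is the tensor product vertex operator algebra. For a linear map $G$ from $V$ to formal series $(\cdot)[[x,x^{-1}]]$ put $G^{o}(v,x)=G(e^{xL(1)}(-x^{-2})^{L(0)}v,x^{-1})$; then $(G^o)^o=G$. For a rational function $f(x)$, $\iota_{x;0}f(x)$ and $\iota_{x;\infty}f(x)$ are its Laurent expansions at $x=0$ and $x=\infty$ respectively (injective maps). A $Q(z)$-linear functional on $W$ is $\alpha\in W^*$ such that for all $v\in V,w\in W$ the series $\langle\alpha,Y(v,x)w\rangle\in\mathbb C((x))$ converges absolutely in $0<|x|<|z|$ to a rational function in $\mathbb C[x,x^{-1},(x+z)^{-1}]$ such that, when $v$ is fixed and $w$ is free, the orders of the possible poles at $x=-z$ and $x=\infty$ are uniformly bounded.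 $\mathcal{D}_{Q(z)}(W)\subset W^*$ is the space of all $Q(z)$-linear functionals. For $v\in V$, $\alpha\in\mathcal D_{Q(z)}(W)$ define $Y^L_{Q(z)}(v,x)\alpha, Y^R_{Q(z)}(v,x)\alpha\in W^*[[x,x^{-1}]]$ by $$\langle (Y^{L}_{Q(z)})^{o}(v,x)\alpha,w\rangle=\iota_{x;\infty}\left(\iota_{y;0}^{-1}\langle\alpha,Y(v,y)w\rangle\right)|_{y=x-z},$$ $$\langle Y^{R}_{Q(z)}(v,x)\alpha,w\rangle=\iota_{x;0}\left(\iota_{y;0}^{-1}\langle\alpha,Y(v,y)w\rangle\right)|_{y=x-z}$$ for $w\in W$ (the substitution $y=x-z$ is made in the rational function, which is then expanded). The coefficients of $Y^L_{Q(z)}(u,x)$ and $Y^R_{Q(z)}(v,x)$ map $\mathcal D_{Q(z)}(W)$ to itself and $Y^L_{Q(z)}(u,x_1)$, $Y^R_{Q(z)}(v,x_2)$ commute, so that $Y_{Q(z)}=Y^L_{Q(z)}\otimes Y^R_{Q(z)}:V\otimes V\to(\mathrm{End}\,\mathcal D_{Q(z)}(W))[[x,x^{-1}]]$ is well defined. *)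

theory Defs
  imports
    "HOL-Complex_Analysis.Complex_Analysis"
    "HOL-Library.Poly_Mapping"
    "HOL-Library.Function_Algebras"
begin

section \<open>Complex vector spaces\<close>

class complex_vector = ab_group_add +
  fixes scaleC :: "complex \<Rightarrow> 'a \<Rightarrow> 'a"  (infixr "*\<^sub>C" 75)
  assumes scaleC_add_right: "c *\<^sub>C (x + y) = c *\<^sub>C x + c *\<^sub>C y"
    and scaleC_add_left: "(c + d) *\<^sub>C x = c *\<^sub>C x + d *\<^sub>C x"
    and scaleC_scaleC: "c *\<^sub>C d *\<^sub>C x = (c * d) *\<^sub>C x"
    and scaleC_one: "1 *\<^sub>C x = x"

global_interpretation complex_vector:
  vector_space "scaleC :: complex \<Rightarrow> 'a \<Rightarrow> 'a::complex_vector"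
  by unfold_locales (simp_all add: scaleC_add_right scaleC_add_left scaleC_scaleC scaleC_one)

abbreviation clinear :: "('a::complex_vector \<Rightarrow> 'b::complex_vector) \<Rightarrow> bool"
  where "clinear \<equiv> Vector_Spaces.linear scaleC scaleC"

instantiation complex :: complex_vector
begin
definition scaleC_complex :: "complex \<Rightarrow> complex \<Rightarrow> complex"
  where "scaleC_complex c x = c * x"
instance
  by standard (simp_all add: scaleC_complex_def algebra_simps)
end

instantiation "fun" :: (type, complex_vector) complex_vector
begin
definition scaleC_fun :: "complex \<Rightarrow> ('a \<Rightarrow> 'b) \<Rightarrow> 'a \<Rightarrow> 'b"
  where "scaleC_fun c f = (\<lambda>x. c *\<^sub>C f x)"
instance
  by standard
    (simp_all add: scaleC_fun_def fun_eq_iff scaleC_add_right scaleC_add_left scaleC_scaleC scaleC_one)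
end

instantiation poly_mapping :: (type, complex_vector) complex_vector
begin
lift_definition scaleC_poly_mapping :: "complex \<Rightarrow> ('a \<Rightarrow>\<^sub>0 'b) \<Rightarrow> 'a \<Rightarrow>\<^sub>0 'b"
  is "\<lambda>c f k. c *\<^sub>C f k"
  by (erule rev_finite_subset) auto
instance
  by standard (transfer;
    simp add: fun_eq_iff scaleC_add_right scaleC_add_left scaleC_scaleC scaleC_one)+
end


section \<open>Tensor products of complex vector spaces\<close>

text \<open>The tensor product is the free vector space on \<open>'a \<times> 'b\<close> modulo the bilinearity relations.\<close>

definition bilinear_relators ::
    "(('a::complex_vector \<times> 'b::complex_vector) \<Rightarrow>\<^sub>0 complex) set" where
  "bilinear_relators =
     {Poly_Mapping.single (a + a', b) 1 - Poly_Mapping.single (a, b) 1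
        - Poly_Mapping.single (a', b) 1 | a a' b. True} \<union>
     {Poly_Mapping.single (a, b + b') 1 - Poly_Mapping.single (a, b) 1
        - Poly_Mapping.single (a, b') 1 | a b b'. True} \<union>
     {Poly_Mapping.single (c *\<^sub>C a, b) 1 - c *\<^sub>C Poly_Mapping.single (a, b) 1 | c a b. True} \<union>
     {Poly_Mapping.single (a, c *\<^sub>C b) 1 - c *\<^sub>C Poly_Mapping.single (a, b) 1 | c a b. True}"

definition tensor_rel ::
    "(('a::complex_vector \<times> 'b::complex_vector) \<Rightarrow>\<^sub>0 complex) \<Rightarrow> (('a \<times> 'b) \<Rightarrow>\<^sub>0 complex) \<Rightarrow> bool"
  where "tensor_rel p q \<longleftrightarrow> p - q \<in> complex_vector.span bilinear_relators"

lemma tensor_rel_equivp: "equivp tensor_rel"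
proof (rule equivpI)
  show "reflp tensor_rel"
    by (simp add: reflp_def tensor_rel_def complex_vector.span_zero)
  show "symp tensor_rel"
    unfolding symp_def tensor_rel_def using complex_vector.span_neg by fastforce
  show "transp tensor_rel"
    unfolding transp_def tensor_rel_def using complex_vector.span_add by fastforce
qed

quotient_type (overloaded) ('a, 'b) tensor =
  "('a::complex_vector \<times> 'b::complex_vector) \<Rightarrow>\<^sub>0 complex" / tensor_rel
  by (rule tensor_rel_equivp)

instantiation tensor :: (complex_vector, complex_vector) complex_vector
begin

lift_definition zero_tensor :: "('a, 'b) tensor" is 0 .

lift_definition plus_tensor :: "('a, 'b) tensor \<Rightarrow> ('a, 'b) tensor \<Rightarrow> ('a, 'b) tensor" is "(+)"
  unfolding tensor_rel_def by (simp only: add_diff_add complex_vector.span_add)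

lift_definition uminus_tensor :: "('a, 'b) tensor \<Rightarrow> ('a, 'b) tensor" is uminus
  unfolding tensor_rel_def by (simp only: minus_diff_minus complex_vector.span_neg)

lift_definition minus_tensor :: "('a, 'b) tensor \<Rightarrow> ('a, 'b) tensor \<Rightarrow> ('a, 'b) tensor" is "(-)"
proof -
  fix p p' q q' :: "('a \<times> 'b) \<Rightarrow>\<^sub>0 complex"
  assume "tensor_rel p p'" "tensor_rel q q'"
  moreover have "p - q - (p' - q') = (p - p') - (q - q')" by simp
  ultimately show "tensor_rel (p - q) (p' - q')"
    unfolding tensor_rel_def by (simp only: complex_vector.span_diff)
qed

lift_definition scaleC_tensor :: "complex \<Rightarrow> ('a, 'b) tensor \<Rightarrow> ('a, 'b) tensor" is scaleC
  unfolding tensor_rel_def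
  by (simp only: complex_vector.scale_right_diff_distrib [symmetric] complex_vector.span_scale)

instance
proof
  fix a b c :: "('a, 'b) tensor" and r s :: complex
  have refl: "tensor_rel p p" for p :: "('a \<times> 'b) \<Rightarrow>\<^sub>0 complex"
    by (simp add: tensor_rel_def complex_vector.span_zero)
  show "a + b + c = a + (b + c)" by transfer (simp add: add.assoc refl)
  show "a + b = b + a" by transfer (simp add: add.commute refl)
  show "0 + a = a" by transfer (simp add: refl)
  show "- a + a = 0" by transfer (simp add: refl)
  show "a - b = a + - b" by transfer (simp add: refl)
  show "r *\<^sub>C (a + b) = r *\<^sub>C a + r *\<^sub>C b" by transfer (simp add: scaleC_add_right refl)
  show "(r + s) *\<^sub>C a = r *\<^sub>C a + s *\<^sub>C a" by transfer (simp add: scaleC_add_left refl)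
  show "r *\<^sub>C s *\<^sub>C a = (r * s) *\<^sub>C a" by transfer (simp add: scaleC_scaleC refl)
  show "1 *\<^sub>C a = a" by transfer (simp add: scaleC_one refl)
qed

end

lift_definition tensor :: "'a::complex_vector \<Rightarrow> 'b::complex_vector \<Rightarrow> ('a, 'b) tensor"
  (infixl "\<otimes>\<^sub>C" 70)
  is "\<lambda>a b. Poly_Mapping.single (a, b) 1" .

text \<open>The linear map induced by \<open>f\<close>; meaningful (independent of the chosen representative) for
  bilinear \<open>f\<close>, see the lemmas below.\<close>

definition free_lift ::
    "('a \<Rightarrow> 'b \<Rightarrow> 'c::complex_vector) \<Rightarrow> (('a \<times> 'b) \<Rightarrow>\<^sub>0 complex) \<Rightarrow> 'c" where
  "free_lift f p = (\<Sum>(a, b)\<in>Poly_Mapping.keys p. Poly_Mapping.lookup p (a, b) *\<^sub>C f a b)"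

definition tensor_lift ::
    "('a::complex_vector \<Rightarrow> 'b::complex_vector \<Rightarrow> 'c::complex_vector) \<Rightarrow> ('a, 'b) tensor \<Rightarrow> 'c" where
  "tensor_lift f t = free_lift f (rep_tensor t)"

lemma free_lift_superset:
  assumes "finite A" "Poly_Mapping.keys p \<subseteq> A"
  shows "free_lift f p = (\<Sum>(a, b)\<in>A. Poly_Mapping.lookup p (a, b) *\<^sub>C f a b)"
  unfolding free_lift_def using assms
  by (intro sum.mono_neutral_left) (auto simp: in_keys_iff)

lemma free_lift_add: "free_lift f (p + q) = free_lift f p + free_lift f q"
proof -
  let ?A = "Poly_Mapping.keys p \<union> Poly_Mapping.keys q"
  have "finite ?A" "Poly_Mapping.keys (p + q) \<subseteq> ?A"
    using Poly_Mapping.keys_add[of p q] by auto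
  then show ?thesis
    by (simp add: free_lift_superset[of ?A] lookup_add scaleC_add_left sum.distrib case_prod_beta)
qed

lemma free_lift_scale: "free_lift f (c *\<^sub>C p) = c *\<^sub>C free_lift f p"
proof -
  have l: "Poly_Mapping.lookup (c *\<^sub>C p) k = c * Poly_Mapping.lookup p k" for k
    by transfer (simp add: scaleC_complex_def)
  have "Poly_Mapping.keys (c *\<^sub>C p) \<subseteq> Poly_Mapping.keys p"
    by (auto simp: in_keys_iff l)
  then show ?thesis
    by (simp add: free_lift_superset[of "Poly_Mapping.keys p"] l case_prod_beta
        complex_vector.scale_sum_right scaleC_scaleC)
qed

lemma free_lift_diff: "free_lift f (p - q) = free_lift f p - free_lift f q"
  using free_lift_add[of f "p - q" q] by simp

lemma free_lift_single: "free_lift f (Poly_Mapping.single (a, b) c) = c *\<^sub>C f a b"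
  by (simp add: free_lift_superset[of "{(a, b)}"] lookup_single)

lemma free_lift_rel:
  assumes "\<And>b. clinear (\<lambda>a. f a b)" "\<And>a. clinear (f a)" "tensor_rel p q"
  shows "free_lift f p = free_lift f q"
proof -
  have lin: "f (a + a') b = f a b + f a' b" "f (c *\<^sub>C a) b = c *\<^sub>C f a b"
    "f a (b + b') = f a b + f a b'" "f a (c *\<^sub>C b) = c *\<^sub>C f a b" for a a' b b' c
    using assms(1)[of b] assms(2)[of a]
    by (auto simp: Vector_Spaces.linear_iff)
  have "free_lift f r = 0" if "r \<in> complex_vector.span bilinear_relators" for r
    using that
  proof (induction rule: complex_vector.span_induct_alt)
    case base
    show ?case by (simp add: free_lift_def)
  next
    case (step c x y)
    then have "free_lift f x = 0"
      by (auto simp: bilinear_relators_def free_lift_diff free_lift_single free_lift_scale lin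
          scaleC_one)
    with step show ?case by (simp add: free_lift_add free_lift_scale)
  qed
  from this[of "p - q"] assms(3) show ?thesis
    by (simp add: tensor_rel_def free_lift_diff)
qed

lemma tensor_lift_tensor:
  assumes "\<And>b. clinear (\<lambda>a. f a b)" "\<And>a. clinear (f a)"
  shows "tensor_lift f (a \<otimes>\<^sub>C b) = f a b"
proof -
  have "tensor_rel (rep_tensor (a \<otimes>\<^sub>C b)) (Poly_Mapping.single (a, b) 1)"
    unfolding tensor.abs_eq
    by (rule Quotient3_rep_abs[OF Quotient3_tensor]) (rule equivp_reflp[OF tensor_rel_equivp])
  from free_lift_rel[OF assms this] show ?thesis
    by (simp add: tensor_lift_def free_lift_single scaleC_one)
qed

lemma clinear_tensor_lift:
  assumes "\<And>b. clinear (\<lambda>a. f a b)" "\<And>a. clinear (f a)"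
  shows "clinear (tensor_lift f)"
proof -
  have *: "tensor_lift f (abs_tensor p) = free_lift f p" for p
    unfolding tensor_lift_def
    by (rule free_lift_rel[OF assms], rule Quotient3_rep_abs[OF Quotient3_tensor],
        rule equivp_reflp[OF tensor_rel_equivp])
  have "tensor_lift f (s + t) = tensor_lift f s + tensor_lift f t" for s t
    by (induct s; induct t) (simp add: plus_tensor.abs_eq * free_lift_add)
  moreover have "tensor_lift f (c *\<^sub>C t) = c *\<^sub>C tensor_lift f t" for c t
    by (induct t) (simp add: scaleC_tensor.abs_eq * free_lift_scale)
  ultimately show ?thesis
    by (simp add: Vector_Spaces.linear_iff complex_vector.vector_space_axioms)
qed


section \<open>Vertex operator algebras and weak modules\<close>

text \<open>
  \<open>vop V u n\<close> is the mode \<open>u\<^sub>n\<close> in \<open>Y(u,x) = \<Sum>n. u\<^sub>n x\<^sup>-\<^sup>n\<^sup>-\<^sup>1\<close>; all vertex operator maps below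
  use this indexing. \<open>grade V n\<close> is the subspace of weight \<open>n\<close>.
\<close>

record 'v voa =
  vop :: "'v \<Rightarrow> int \<Rightarrow> 'v \<Rightarrow> 'v"
  vac :: 'v
  conf :: 'v
  grade :: "int \<Rightarrow> 'v set"

definition virasoro :: "'v voa \<Rightarrow> int \<Rightarrow> 'v \<Rightarrow> 'v"
  where "virasoro V n = vop V (conf V) (n + 1)"

text \<open>
  The space \<open>W\<close> is a subspace of a complex vector space, and \<open>Y u n\<close> matters on \<open>W\<close> only.
  The assumption \<open>jacobi\<close> is the coefficient of \<open>x\<^sub>0\<^sup>-\<^sup>l\<^sup>-\<^sup>1 x\<^sub>1\<^sup>-\<^sup>m\<^sup>-\<^sup>1 x\<^sub>2\<^sup>-\<^sup>n\<^sup>-\<^sup>1\<close> of the Jacobi identity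
  \<open>x\<^sub>0\<^sup>-\<^sup>1 \<delta>((x\<^sub>1 - x\<^sub>2)/x\<^sub>0) Y(u,x\<^sub>1) Y(v,x\<^sub>2) - x\<^sub>0\<^sup>-\<^sup>1 \<delta>((x\<^sub>2 - x\<^sub>1)/(-x\<^sub>0)) Y(v,x\<^sub>2) Y(u,x\<^sub>1)
    = x\<^sub>2\<^sup>-\<^sup>1 \<delta>((x\<^sub>1 - x\<^sub>0)/x\<^sub>2) Y(Y(u,x\<^sub>0)v,x\<^sub>2)\<close>
  applied to \<open>w\<close>; on the right \<open>(-1)\<^sup>i (i - m - 1 gchoose i) = (m gchoose i)\<close> has been used.
  By truncation all three sums have finite support.
\<close>

locale weak_module =
  fixes V :: "'v::complex_vector voa"
    and W :: "'w::complex_vector set"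
    and Y :: "'v \<Rightarrow> int \<Rightarrow> 'w \<Rightarrow> 'w"
  assumes subspace: "complex_vector.subspace W"
    and closed: "w \<in> W \<Longrightarrow> Y u n w \<in> W"
    and add_left: "w \<in> W \<Longrightarrow> Y (u + v) n w = Y u n w + Y v n w"
    and scale_left: "w \<in> W \<Longrightarrow> Y (c *\<^sub>C u) n w = c *\<^sub>C Y u n w"
    and add_right: "w \<in> W \<Longrightarrow> w' \<in> W \<Longrightarrow> Y u n (w + w') = Y u n w + Y u n w'"
    and scale_right: "w \<in> W \<Longrightarrow> Y u n (c *\<^sub>C w) = c *\<^sub>C Y u n w"
    and truncation: "w \<in> W \<Longrightarrow> \<exists>N. \<forall>n\<ge>N. Y u n w = 0"
    and vacuum: "w \<in> W \<Longrightarrow> Y (vac V) n w = (if n = -1 then w else 0)"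
    and jacobi: "w \<in> W \<Longrightarrow>
      Sum_any (\<lambda>i::nat. ((-1) ^ i * (of_int l gchoose i)) *\<^sub>C Y u (m + l - int i) (Y v (n + int i) w))
      - Sum_any (\<lambda>i::nat. ((-1) powi l * (-1) ^ i * (of_int l gchoose i)) *\<^sub>C
                  Y v (n + l - int i) (Y u (m + int i) w))
      = Sum_any (\<lambda>i::nat. (of_int m gchoose i) *\<^sub>C Y (vop V u (l + int i) v) (m + n - int i) w)"

text \<open>The truncation, vacuum and Jacobi axioms of a vertex operator algebra say that it is a weak
  module over itself.\<close>

locale vertex_operator_algebra = weak_module V UNIV "vop V"
  for V :: "'v::complex_vector voa" +
  assumes grade_subspace: "complex_vector.subspace (grade V n)"
    and grade_direct_sum:
      "\<exists>!f. finite {n. f n \<noteq> 0} \<and> (\<forall>n. f n \<in> grade V n) \<and> v = Sum_any f"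
    and grade_finite_dim: "\<exists>B. finite B \<and> grade V n = complex_vector.span B"
    and grade_bounded_below: "\<exists>N. \<forall>n<N. grade V n = {0}"
    and creation: "vop V v (-1) (vac V) = v" "n \<ge> 0 \<Longrightarrow> vop V v n (vac V) = 0"
    and virasoro_relations:
      "\<exists>c. \<forall>m n v. virasoro V m (virasoro V n v) - virasoro V n (virasoro V m v) =
         of_int (m - n) *\<^sub>C virasoro V (m + n) v
         + (if m + n = 0 then (of_int (m ^ 3 - m) / 12 * c) *\<^sub>C v else 0)"
    and L0_grade: "v \<in> grade V n \<Longrightarrow> virasoro V 0 v = of_int n *\<^sub>C v"
    and L_minus1_derivative: "vop V (virasoro V (-1) v) n w = - of_int n *\<^sub>C vop V v (n - 1) w"

text \<open>\<open>(u \<otimes> v)\<^sub>n = \<Sum>\<^sub>i u\<^sub>i \<otimes> v\<^sub>n\<^sub>-\<^sub>1\<^sub>-\<^sub>i\<close> is the coefficient form of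
  \<open>Y(u \<otimes> v,x) = Y(u,x) \<otimes> Y(v,x)\<close>.\<close>

definition tensor_voa ::
    "'a::complex_vector voa \<Rightarrow> 'b::complex_vector voa \<Rightarrow> ('a, 'b) tensor voa" where
  "tensor_voa V1 V2 =
     \<lparr>vop = (\<lambda>s n t. tensor_lift (\<lambda>u v. tensor_lift (\<lambda>u' v'.
               Sum_any (\<lambda>i. vop V1 u i u' \<otimes>\<^sub>C vop V2 v (n - 1 - i) v')) t) s),
      vac = vac V1 \<otimes>\<^sub>C vac V2,
      conf = conf V1 \<otimes>\<^sub>C vac V2 + vac V1 \<otimes>\<^sub>C conf V2,
      grade = (\<lambda>n. complex_vector.span
                 {u \<otimes>\<^sub>C v | u v i. u \<in> grade V1 i \<and> v \<in> grade V2 (n - i)})\<rparr>"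


section \<open>Opposite vertex operators\<close>

definition homogeneous_part :: "'v::complex_vector voa \<Rightarrow> 'v \<Rightarrow> int \<Rightarrow> 'v" where
  "homogeneous_part V v =
     (THE f. finite {n. f n \<noteq> 0} \<and> (\<forall>n. f n \<in> grade V n) \<and> v = Sum_any f)"

text \<open>The coefficient of \<open>x\<^sup>j\<close> in the Laurent polynomial \<open>e\<^bsup>xL(1)\<^esup>(-x\<^sup>-\<^sup>2)\<^bsup>L(0)\<^esup>v\<close>.\<close>

definition opposite_arg :: "'v::complex_vector voa \<Rightarrow> 'v \<Rightarrow> int \<Rightarrow> 'v" where
  "opposite_arg V v j =
     Sum_any (\<lambda>(k::nat, h). if int k - 2 * h = j
       then ((-1) powi h / fact k) *\<^sub>C (virasoro V 1 ^^ k) (homogeneous_part V v h) else 0)"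

text \<open>
  \<open>G v n\<close> is the coefficient of \<open>x\<^sup>-\<^sup>n\<^sup>-\<^sup>1\<close> in \<open>G(v,x)\<close>. Writing \<open>v\<^sup>(\<^sup>j\<^sup>)\<close> for \<open>opposite_arg V v j\<close>,
  \<open>G\<^sup>o(v,x) = \<Sum>j. x\<^sup>j G(v\<^sup>(\<^sup>j\<^sup>),x\<^sup>-\<^sup>1) = \<Sum>j m. G v\<^sup>(\<^sup>j\<^sup>) m x\<^bsup>j+m+1\<^esup>\<close>.
\<close>

definition opposite ::
    "'v::complex_vector voa \<Rightarrow> ('v \<Rightarrow> int \<Rightarrow> 'b::comm_monoid_add) \<Rightarrow> 'v \<Rightarrow> int \<Rightarrow> 'b" where
  "opposite V G v n = Sum_any (\<lambda>j. G (opposite_arg V v j) (- j - n - 2))"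


section \<open>Rational functions and their expansions\<close>

text \<open>
  Rational functions are represented by functions on the complex plane whose values at the
  (finitely many) zeros of the chosen denominator are arbitrary. Laurent expansions and pole
  orders do not depend on these values.
\<close>

definition rational_functions :: "(complex \<Rightarrow> complex) set" where
  "rational_functions = {f. \<exists>p q. q \<noteq> 0 \<and> (\<forall>x. poly q x \<noteq> 0 \<longrightarrow> f x = poly p x / poly q x)}"

text \<open>The ring \<open>\<complex>[x,x\<^sup>-\<^sup>1,(x+z)\<^sup>-\<^sup>1]\<close>.\<close>

definition Qz_ring :: "complex \<Rightarrow> (complex \<Rightarrow> complex) set" where
  "Qz_ring z = {f. \<exists>p k l. \<forall>x. x \<noteq> 0 \<longrightarrow> x \<noteq> -z \<longrightarrow> f x = poly p x / (x ^ k * (x + z) ^ l)}"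

text \<open>Expansions are given by their coefficients: index \<open>m\<close> stands for \<open>x\<^sup>m\<close>.\<close>

definition iota_zero :: "(complex \<Rightarrow> complex) \<Rightarrow> int \<Rightarrow> complex" where
  "iota_zero f m = fls_nth (laurent_expansion f 0) m"

definition iota_infinity :: "(complex \<Rightarrow> complex) \<Rightarrow> int \<Rightarrow> complex" where
  "iota_infinity f m = fls_nth (laurent_expansion (\<lambda>t. f (1 / t)) 0) (- m)"

definition iota_zero_inverse :: "(int \<Rightarrow> complex) \<Rightarrow> complex \<Rightarrow> complex" where
  "iota_zero_inverse g = (SOME f. f \<in> rational_functions \<and> iota_zero f = g)"

definition pole_order :: "(complex \<Rightarrow> complex) \<Rightarrow> complex \<Rightarrow> nat" where
  "pole_order f a = nat (- fls_subdegree (laurent_expansion f a))"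

definition pole_order_infinity :: "(complex \<Rightarrow> complex) \<Rightarrow> nat" where
  "pole_order_infinity f = pole_order (\<lambda>t. f (1 / t)) 0"


section \<open>The space of \<open>Q(z)\<close>-linear functionals\<close>

text \<open>The coefficient of \<open>x\<^sup>m\<close> in \<open>\<langle>\<alpha>, Y(v,x)w\<rangle>\<close>.\<close>

definition matrix_coeff ::
    "('v \<Rightarrow> int \<Rightarrow> 'w \<Rightarrow> 'w) \<Rightarrow> ('w \<Rightarrow> complex) \<Rightarrow> 'v \<Rightarrow> 'w \<Rightarrow> int \<Rightarrow> complex" where
  "matrix_coeff Y \<alpha> v w m = \<alpha> (Y v (- m - 1) w)"

definition Qz_functionals ::
    "('v \<Rightarrow> int \<Rightarrow> 'w \<Rightarrow> 'w) \<Rightarrow> complex \<Rightarrow> ('w::complex_vector \<Rightarrow> complex) set" where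
  "Qz_functionals Y z = {\<alpha>. clinear \<alpha> \<and>
     (\<forall>v. \<exists>M N. \<forall>w. \<exists>f \<in> Qz_ring z.
        (\<forall>x. 0 < norm x \<longrightarrow> norm x < norm z \<longrightarrow>
           (\<lambda>m. norm (matrix_coeff Y \<alpha> v w m * x powi m)) summable_on UNIV \<and>
           ((\<lambda>m. matrix_coeff Y \<alpha> v w m * x powi m) has_sum f x) UNIV) \<and>
        pole_order f (-z) \<le> M \<and> pole_order_infinity f \<le> N)}"

definition YR_Q ::
    "('v \<Rightarrow> int \<Rightarrow> 'w \<Rightarrow> 'w) \<Rightarrow> complex \<Rightarrow> 'v \<Rightarrow> int \<Rightarrow> ('w \<Rightarrow> complex) \<Rightarrow> 'w \<Rightarrow> complex" where
  "YR_Q Y z v n \<alpha> w =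
     iota_zero (\<lambda>x. iota_zero_inverse (matrix_coeff Y \<alpha> v w) (x - z)) (- n - 1)"

definition YL_Q_opposite ::
    "('v \<Rightarrow> int \<Rightarrow> 'w \<Rightarrow> 'w) \<Rightarrow> complex \<Rightarrow> 'v \<Rightarrow> int \<Rightarrow> ('w \<Rightarrow> complex) \<Rightarrow> 'w \<Rightarrow> complex" where
  "YL_Q_opposite Y z v n \<alpha> w =
     iota_infinity (\<lambda>x. iota_zero_inverse (matrix_coeff Y \<alpha> v w) (x - z)) (- n - 1)"

text \<open>As \<open>(G\<^sup>o)\<^sup>o = G\<close>, prescribing the opposite of \<open>Y\<^sup>L\<close> amounts to the following.\<close>

definition YL_Q ::
    "'v::complex_vector voa \<Rightarrow> ('v \<Rightarrow> int \<Rightarrow> 'w \<Rightarrow> 'w) \<Rightarrow> complex \<Rightarrow>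
       'v \<Rightarrow> int \<Rightarrow> ('w \<Rightarrow> complex) \<Rightarrow> 'w \<Rightarrow> complex" where
  "YL_Q V Y z v n \<alpha> = opposite V (\<lambda>u m. YL_Q_opposite Y z u m \<alpha>) v n"

text \<open>The linear extension of \<open>Y(u \<otimes> v,x) = Y\<^sup>L(u,x) Y\<^sup>R(v,x)\<close>. On \<open>Qz_functionals Y z\<close> the sum
  has finite support because \<open>Y\<^sup>L\<close> and \<open>Y\<^sup>R\<close> are lower truncated and commute.\<close>

definition Y_Q ::
    "'v::complex_vector voa \<Rightarrow> ('v \<Rightarrow> int \<Rightarrow> 'w \<Rightarrow> 'w) \<Rightarrow> complex \<Rightarrow>
       ('v, 'v) tensor \<Rightarrow> int \<Rightarrow> ('w \<Rightarrow> complex) \<Rightarrow> 'w \<Rightarrow> complex" where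
  "Y_Q V Y z s n \<alpha> =
     tensor_lift (\<lambda>u v. Sum_any (\<lambda>i. YL_Q V Y z u i (YR_Q Y z v (n - 1 - i) \<alpha>))) s"

end

theory Submission
  imports Defs
begin

text \<open>
  A functional \<open>\<alpha>\<close> is \<open>Q(z)\<close>-linear iff the numbers \<open>\<alpha>(v\<otimes>y\<^sup>p(y+z)\<^sup>q w)\<close>, where \<open>v\<otimes>f\<close> acts as
  \<open>Res\<^sub>y f(y) Y(v,y)\<close> with \<open>f\<close> expanded at \<open>y = 0\<close>, vanish for large \<open>q\<close> and small \<open>p + q\<close>. By the residue
  theorem they are the difference of an array vanishing near infinity (for small \<open>p + q\<close>) and one
  vanishing near \<open>-z\<close> (for large \<open>q\<close>), which give \<open>Y\<^sup>L\<close> (up to taking opposites) and \<open>Y\<^sup>R\<close>. This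
  decomposition is unique. Decomposing in both variables at once, the Jacobi identity on \<open>W\<close>, tested
  against \<open>y\<^sub>1\<^sup>p(y\<^sub>1+z)\<^sup>q y\<^sub>2\<^bsup>p'\<^esup>(y\<^sub>2+z)\<^bsup>q'\<^esup>(y\<^sub>1-y\<^sub>2)\<^sup>l\<close>, splits into four identities: the Jacobi
  identities for \<open>Y\<^sup>L\<close> (in opposite form) and \<open>Y\<^sup>R\<close>, and twice their commutativity.
  The conjugation formula for \<open>e\<^bsup>xL(1)\<^esup>\<close> removes the opposite, and commuting actions of two vertex
  operator algebras yield a module for the tensor product because locality and associativity pass to
  products, and these imply the Jacobi identity.
\<close>

text \<open>A factor \<open>(y + z)^q\<close> with large \<open>q\<close> cancels a pole of bounded
  order at \<open>-z\<close>, and small \<open>p + q\<close> removes the residue at infinity; then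
  the residue at 0 vanishes as well. Conversely, a high power of \<open>y + z\<close> turns the
  matrix coefficient into a Laurent polynomial. As the pole bounds are uniform in \<open>w\<close>,
  residues can be handled as functionals. Contour arguments are replaced by algebra:
  \<open>y^p (y+z)^(q+1) = y^(p+1) (y+z)^q + z y^p (y+z)^q\<close> holds for every kind of residue,
  and an array obeying this rule is determined by a boundary part, so identities are checked there
  and propagated. The obstacle is finiteness: expanded in powers of \<open>y\<close>,
  \<open>(y1 - y2)^l\<close> gives finite sums before the second variable is decomposed but not
  after. Hence the expansion is changed to powers of \<open>y + z\<close> in between. At infinity
  \<open>y1\<close> dominates \<open>y2\<close>; at \<open>-z\<close> the roles of
  \<open>y1 + z\<close> and \<open>y2 + z\<close> are exchanged. Functionals reverse products; the
  exchange at \<open>-z\<close> undoes this, while at infinity the reversal stays and must be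
  removed by taking opposites.\<close>

lemma finite_support_nat_iff: "finite {i::nat. f i \<noteq> (0::'b::zero)} \<longleftrightarrow> (\<exists>K. \<forall>i\<ge>K. f i = 0)"
proof
  assume "finite {i. f i \<noteq> 0}"
  then obtain K where "\<forall>i\<in>{i. f i \<noteq> 0}. i < K" using finite_nat_set_iff_bounded by blast
  then show "\<exists>K. \<forall>i\<ge>K. f i = 0" by (metis mem_Collect_eq not_less)
next
  assume "\<exists>K. \<forall>i\<ge>K. f i = 0"
  then obtain K where K: "\<forall>i\<ge>K. f i = 0" by blast
  have "{i. f i \<noteq> 0} \<subseteq> {..<K}" using K by (auto simp: not_le[symmetric])
  then show "finite {i. f i \<noteq> 0}" by (rule finite_subset) simp
qed

lemma finite_support_natI: "(\<And>i. i \<ge> K \<Longrightarrow> f i = 0) \<Longrightarrow> finite {i::nat. f i \<noteq> (0::'b::zero)}"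
  by (auto simp: finite_support_nat_iff)

lemma finite_support_scale [intro]:
  "finite {i. f i \<noteq> 0} \<Longrightarrow> finite {i. c i *\<^sub>C f i \<noteq> (0::'b::complex_vector)}"
  by (rule finite_subset) auto

lemma finite_support_add [intro]:
  "finite {i. f i \<noteq> 0} \<Longrightarrow> finite {i. g i \<noteq> 0} \<Longrightarrow> finite {i. f i + g i \<noteq> (0::'b::comm_monoid_add)}"
  by (rule finite_subset[of _ "{i. f i \<noteq> 0} \<union> {i. g i \<noteq> 0}"]) auto

lemma Sum_any_scale: "c *\<^sub>C Sum_any f = Sum_any (\<lambda>i. c *\<^sub>C (f i :: 'b::complex_vector))"
  by (cases "c = 0") (auto simp: Sum_any.expand_set complex_vector.scale_sum_right)

lemma Sum_any_uminus: "Sum_any (\<lambda>i. - f i) = - Sum_any (f :: _ \<Rightarrow> 'b::ab_group_add)"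
  by (simp add: Sum_any.expand_set sum_negf)

lemma Sum_any_additive:
  fixes f :: "'i \<Rightarrow> 'a::comm_monoid_add" and h :: "'a \<Rightarrow> 'b::comm_monoid_add"
  assumes "finite {i. f i \<noteq> 0}" "\<And>i. f i \<in> W" "0 \<in> W" "\<And>x y. x \<in> W \<Longrightarrow> y \<in> W \<Longrightarrow> x + y \<in> W"
    "\<And>x y. x \<in> W \<Longrightarrow> y \<in> W \<Longrightarrow> h (x + y) = h x + h y" "h 0 = 0"
  shows "h (Sum_any f) = Sum_any (\<lambda>i. h (f i))"
proof -
  have *: "sum f A \<in> W \<and> h (sum f A) = (\<Sum>i\<in>A. h (f i))" if "finite A" for A
    using that by (induction A rule: finite_induct) (auto simp: assms)
  have "{i. h (f i) \<noteq> 0} \<subseteq> {i. f i \<noteq> 0}" using assms(6) by auto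
  then have "Sum_any (\<lambda>i. h (f i)) = (\<Sum>i\<in>{i. f i \<noteq> 0}. h (f i))"
    using assms(1) by (intro Sum_any.expand_superset)
  then show ?thesis using *[OF assms(1)] by (simp add: Sum_any.expand_set)
qed

lemma Sum_any_in:
  assumes "\<And>i. f i \<in> W" "0 \<in> W" "\<And>x y. x \<in> W \<Longrightarrow> y \<in> W \<Longrightarrow> x + y \<in> W"
  shows "Sum_any f \<in> W"
proof -
  have *: "sum f A \<in> W" if "finite A" for A
    using that by (induction A rule: finite_induct) (auto simp: assms)
  show ?thesis using * assms(2) by (cases "finite {i. f i \<noteq> 0}") (auto simp: Sum_any.expand_set)
qed

lemma finite_support_nat_Suc: "finite {i. f i \<noteq> 0} \<Longrightarrow> finite {i. f (Suc i) \<noteq> 0}"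
  by (auto simp: finite_support_nat_iff intro: le_SucI)

lemma Sum_any_nat_Suc:
  assumes "finite {i::nat. f i \<noteq> (0::'b::comm_monoid_add)}"
  shows "Sum_any f = f 0 + Sum_any (\<lambda>i. f (Suc i))"
proof -
  obtain K where K: "\<And>i. i \<ge> K \<Longrightarrow> f i = 0" using assms by (auto simp: finite_support_nat_iff)
  have "Sum_any f = sum f {..<Suc K}"
    by (rule Sum_any.expand_superset) (use K in \<open>auto, meson leI less_SucI\<close>)
  moreover have "Sum_any (\<lambda>i. f (Suc i)) = (\<Sum>i<K. f (Suc i))"
    by (rule Sum_any.expand_superset) (use K in \<open>auto, meson le_SucI leI\<close>)
  ultimately show ?thesis by (simp only: sum.lessThan_Suc_shift)
qed

lemma Sum_any_nat_bound:
  assumes "\<And>i. i \<ge> K \<Longrightarrow> f i = (0::'b::comm_monoid_add)"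
  shows "Sum_any f = (\<Sum>i<K::nat. f i)"
  by (rule Sum_any.expand_superset) (use assms in \<open>auto simp: not_less[symmetric]\<close>)

lemma Sum_any_apply:
  assumes "finite {i. f i \<noteq> (0 :: 'a \<Rightarrow> 'b::comm_monoid_add)}"
  shows "Sum_any f x = Sum_any (\<lambda>i. f i x)"
  by (rule Sum_any_additive[where W = UNIV and h = "\<lambda>f. f x"]) (use assms in auto)

lemma Sum_any_single:
  assumes "\<And>i. i \<noteq> a \<Longrightarrow> f i = 0"
  shows "Sum_any f = f a"
  by (subst Sum_any.expand_superset[of "{a}"]) (use assms in auto)

section \<open>Binomial sums\<close>

text \<open>This is the power series \<open>(1 + t)^a\<close> with \<open>f i\<close> substituted
  for \<open>t^i\<close>; \<open>a\<close> is any complex number, so negative exponents are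
  included.\<close>

definition binom_sum :: "complex \<Rightarrow> (nat \<Rightarrow> 'b::complex_vector) \<Rightarrow> 'b" where
  "binom_sum a f = Sum_any (\<lambda>i. (a gchoose i) *\<^sub>C f i)"

lemma binom_sum_0 [simp]: "binom_sum 0 f = f 0"
  unfolding binom_sum_def
  by (subst Sum_any_single[of 0]) (auto simp: gbinomial_0_left scaleC_one)

lemma binom_sum_zero [simp]: "binom_sum a (\<lambda>i. 0) = 0"
  by (simp add: binom_sum_def)

lemma binom_sum_cong: "(\<And>i. f i = g i) \<Longrightarrow> binom_sum a f = binom_sum a g"
  by (metis ext)

lemma binom_sum_add:
  assumes "finite {i. f i \<noteq> 0}" "finite {i. g i \<noteq> 0}"
  shows "binom_sum a (\<lambda>i. f i + g i) = binom_sum a f + binom_sum a g"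
  unfolding binom_sum_def scaleC_add_right
  by (rule Sum_any.distrib) (use assms in auto)

lemma binom_sum_scale: "binom_sum a (\<lambda>i. c *\<^sub>C f i) = c *\<^sub>C binom_sum a f"
  unfolding binom_sum_def Sum_any_scale by (simp add: scaleC_scaleC mult.commute)

lemma binom_sum_uminus: "binom_sum a (\<lambda>i. - f i) = - binom_sum a f"
  by (simp add: binom_sum_def Sum_any_uminus)

lemma binom_sum_diff:
  assumes "finite {i. f i \<noteq> 0}" "finite {i. g i \<noteq> 0}"
  shows "binom_sum a (\<lambda>i. f i - g i) = binom_sum a f - binom_sum a g"
  using binom_sum_add[of f "\<lambda>i. - g i"] assms by (simp add: binom_sum_uminus)

text \<open>Pascal's rule, that is \<open>(1 + t)^(a+1) = (1 + t)^a + t (1 + t)^a\<close>. It holds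
  for all \<open>a\<close>, which later lets recursions in an exponent run both upwards and
  downwards.\<close>

lemma binom_sum_Suc:
  assumes "finite {i. f i \<noteq> 0}"
  shows "binom_sum (a + 1) f = binom_sum a f + binom_sum a (\<lambda>i. f (Suc i))"
proof -
  have f: "finite {i. (b gchoose i) *\<^sub>C f i \<noteq> 0}" for b using assms by auto
  have f': "finite {i. (b i) *\<^sub>C f (Suc i) \<noteq> 0}" for b
    using finite_support_nat_Suc[OF assms] by auto
  have "binom_sum (a + 1) f = f 0 + Sum_any (\<lambda>i. (a gchoose i) *\<^sub>C f (Suc i) + (a gchoose Suc i) *\<^sub>C f (Suc i))"
    unfolding binom_sum_def by (subst Sum_any_nat_Suc[OF f])
      (simp add: gbinomial_Suc_Suc scaleC_add_left scaleC_one)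
  also have "\<dots> = f 0 + Sum_any (\<lambda>i. (a gchoose Suc i) *\<^sub>C f (Suc i)) + binom_sum a (\<lambda>i. f (Suc i))"
    by (subst Sum_any.distrib[OF f' f']) (simp add: binom_sum_def)
  also have "f 0 + Sum_any (\<lambda>i. (a gchoose Suc i) *\<^sub>C f (Suc i)) = binom_sum a f"
    unfolding binom_sum_def by (subst Sum_any_nat_Suc[OF f]) (simp add: scaleC_one)
  finally show ?thesis .
qed

lemma binom_sum_additive:
  assumes "finite {i. f i \<noteq> 0}" "\<And>i. f i \<in> W" "0 \<in> W" "\<And>x y. x \<in> W \<Longrightarrow> y \<in> W \<Longrightarrow> x + y \<in> W"
    "\<And>x c. x \<in> W \<Longrightarrow> c *\<^sub>C x \<in> W"
    "\<And>x y. x \<in> W \<Longrightarrow> y \<in> W \<Longrightarrow> h (x + y) = h x + h y" "\<And>x c. x \<in> W \<Longrightarrow> h (c *\<^sub>C x) = c *\<^sub>C h x"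
  shows "h (binom_sum a f) = binom_sum a (\<lambda>i. h (f i))"
proof -
  have "h 0 = 0" using assms(7)[of 0 0] assms(3) by simp
  then show ?thesis unfolding binom_sum_def
    by (subst Sum_any_additive[where W = W and h = h]) (use assms in auto)
qed

lemma binom_sum_in:
  assumes "\<And>i. f i \<in> W" "0 \<in> W" "\<And>x y. x \<in> W \<Longrightarrow> y \<in> W \<Longrightarrow> x + y \<in> W"
    "\<And>x c. x \<in> W \<Longrightarrow> c *\<^sub>C x \<in> W"
  shows "binom_sum a f \<in> W"
  unfolding binom_sum_def by (rule Sum_any_in) (use assms in auto)

lemma binom_sum_apply:
  assumes "finite {i. f i \<noteq> 0}"
  shows "binom_sum a f x = binom_sum a (\<lambda>i. f i x)"
  unfolding binom_sum_def
  by (subst Sum_any_apply[OF finite_support_scale[OF assms]]) (simp add: scaleC_fun_def)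

text \<open>\<open>(x\<^sub>1 - x\<^sub>2)\<^sup>l x\<^sub>1\<^sup>m x\<^sub>2\<^sup>n\<close> expanded in nonnegative powers of \<open>x\<^sub>2\<close> and \<open>(x\<^sub>2 + x\<^sub>0)\<^sup>m x\<^sub>2\<^sup>n x\<^sub>0\<^sup>l\<close> expanded
  in nonnegative powers of \<open>x\<^sub>0\<close>, with \<open>f\<close> resp. \<open>g\<close> substituted for the monomials.\<close>

definition diff_pow :: "int \<Rightarrow> (int \<Rightarrow> int \<Rightarrow> 'b::complex_vector) \<Rightarrow> int \<Rightarrow> int \<Rightarrow> 'b" where
  "diff_pow l f m n = binom_sum (of_int l) (\<lambda>i. (-1) ^ i *\<^sub>C f (m + l - int i) (n + int i))"

definition shift_pow :: "int \<Rightarrow> (int \<Rightarrow> int \<Rightarrow> 'b::complex_vector) \<Rightarrow> int \<Rightarrow> int \<Rightarrow> 'b" where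
  "shift_pow l g m n = binom_sum (of_int m) (\<lambda>i. g (l + int i) (m + n - int i))"

text \<open>The sums in \<open>diff_pow\<close> run along antidiagonals. As \<open>Sum_any\<close>
  returns 0 on infinite supports, linearity and recursion of \<open>diff_pow\<close> depend on these
  supports being finite.\<close>

definition antidiag_finite :: "(int \<Rightarrow> int \<Rightarrow> 'b::zero) \<Rightarrow> bool" where
  "antidiag_finite f \<longleftrightarrow> (\<forall>t n. finite {i. f (t - int i) (n + int i) \<noteq> 0})"

lemma antidiag_finiteD: "antidiag_finite f \<Longrightarrow> finite {i. f (t - int i) (n + int i) \<noteq> 0}"
  by (simp add: antidiag_finite_def)

lemma antidiag_finiteD_scale:
  "antidiag_finite f \<Longrightarrow> finite {i. c i *\<^sub>C f (t - int i) (n + int i) \<noteq> (0::'b::complex_vector)}"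
  by (rule finite_support_scale) (rule antidiag_finiteD)

lemma antidiag_finite_right:
  assumes "\<And>n m. n \<ge> N \<Longrightarrow> f m n = 0" shows "antidiag_finite f"
  unfolding antidiag_finite_def
proof (intro allI)
  fix t n show "finite {i. f (t - int i) (n + int i) \<noteq> 0}"
    by (rule finite_support_natI[of "nat (N - n)"]) (auto intro!: assms)
qed

lemma antidiag_finite_left:
  assumes "\<And>n m. m \<le> N \<Longrightarrow> f m n = 0" shows "antidiag_finite f"
  unfolding antidiag_finite_def
proof (intro allI)
  fix t n show "finite {i. f (t - int i) (n + int i) \<noteq> 0}"
    by (rule finite_support_natI[of "nat (t - N)"]) (auto intro!: assms)
qed

lemma antidiag_finite_scale: "antidiag_finite f \<Longrightarrow> antidiag_finite (\<lambda>m n. c *\<^sub>C f m n :: 'b::complex_vector)"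
  unfolding antidiag_finite_def by (auto intro: finite_support_scale)

lemma diff_pow_0 [simp]: "diff_pow 0 f m n = f m n"
  by (simp add: diff_pow_def scaleC_one)

text \<open>Multiplication by one more factor \<open>x1 - x2\<close>.\<close>

lemma diff_pow_Suc:
  assumes "antidiag_finite f"
  shows "diff_pow (l + 1) f m n = diff_pow l f (m + 1) n - diff_pow l f m (n + 1)"
proof -
  have "diff_pow (l + 1) f m n = binom_sum (of_int l) (\<lambda>i. (-1) ^ i *\<^sub>C f (m + (l + 1) - int i) (n + int i))
     + binom_sum (of_int l) (\<lambda>i. (-1) ^ Suc i *\<^sub>C f (m + (l + 1) - int (Suc i)) (n + int (Suc i)))"
    unfolding diff_pow_def of_int_add of_int_1
    by (subst binom_sum_Suc[OF antidiag_finiteD_scale]) (use assms in auto)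
  also have "(\<lambda>i. (-1) ^ Suc i *\<^sub>C f (m + (l + 1) - int (Suc i)) (n + int (Suc i)))
     = (\<lambda>i. - ((-1) ^ i *\<^sub>C f (m + l - int i) (n + 1 + int i)))"
    by (rule ext) (simp add: algebra_simps)
  finally show ?thesis unfolding diff_pow_def by (simp add: binom_sum_uminus algebra_simps)
qed

lemma diff_pow_add:
  assumes "antidiag_finite f" "antidiag_finite g"
  shows "diff_pow l (\<lambda>m n. f m n + g m n) m n = diff_pow l f m n + diff_pow l g m n"
  unfolding diff_pow_def by (subst binom_sum_add[symmetric])
    (use assms in \<open>auto simp: scaleC_add_right intro!: antidiag_finiteD\<close>)

lemma diff_pow_scale: "diff_pow l (\<lambda>m n. c *\<^sub>C f m n) m n = c *\<^sub>C diff_pow l f m n"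
  unfolding diff_pow_def by (subst binom_sum_scale[symmetric]) (simp add: scaleC_scaleC mult.commute)

lemma diff_pow_diff:
  assumes "antidiag_finite f" "antidiag_finite g"
  shows "diff_pow l (\<lambda>m n. f m n - g m n) m n = diff_pow l f m n - diff_pow l g m n"
  unfolding diff_pow_def by (subst binom_sum_diff[symmetric])
    (use assms in \<open>auto simp: complex_vector.scale_right_diff_distrib intro!: antidiag_finiteD\<close>)

lemma shift_pow_0 [simp]: "shift_pow l g 0 n = g l n"
  by (simp add: shift_pow_def)

text \<open>Here \<open>x0\<close> is written as \<open>(x2 + x0) - x2\<close>. The recursion has
  the same form as \<open>diff_pow_Suc\<close>, because \<open>x0\<close> stands for
  \<open>x1 - x2\<close>; this is why both sides of a Jacobi identity can be compared by induction
  on \<open>l\<close>.\<close>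

lemma shift_pow_Suc:
  assumes "\<And>c d. c \<ge> N \<Longrightarrow> g c d = 0"
  shows "shift_pow (l + 1) g m n = shift_pow l g (m + 1) n - shift_pow l g m (n + 1)"
proof -
  have f: "finite {i. g (l + int i) (m + 1 + n - int i) \<noteq> 0}"
    by (rule finite_support_natI[of "nat (N - l)"]) (auto intro!: assms)
  have "shift_pow l g (m + 1) n = binom_sum (of_int m) (\<lambda>i. g (l + int i) (m + 1 + n - int i)) +
     binom_sum (of_int m) (\<lambda>i. g (l + int (Suc i)) (m + 1 + n - int (Suc i)))"
    unfolding shift_pow_def of_int_add of_int_1 by (rule binom_sum_Suc[OF f])
  then show ?thesis unfolding shift_pow_def by (simp add: algebra_simps)
qed

lemma jacobi_first:
  "Sum_any (\<lambda>i::nat. ((-1) ^ i * (of_int l gchoose i)) *\<^sub>C f (m + l - int i) (n + int i)) = diff_pow l f m n"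
  unfolding diff_pow_def binom_sum_def by (simp add: scaleC_scaleC mult.commute)

lemma jacobi_second:
  "Sum_any (\<lambda>i::nat. ((-1) powi l * (-1) ^ i * (of_int l gchoose i)) *\<^sub>C f (n + l - int i) (m + int i))
   = (-1) powi l *\<^sub>C diff_pow l f n m"
  unfolding diff_pow_def binom_sum_def Sum_any_scale
  by (simp add: scaleC_scaleC mult.commute mult.left_commute)

lemma jacobi_third:
  "Sum_any (\<lambda>i::nat. (of_int m gchoose i) *\<^sub>C g (l + int i) (m + n - int i)) = shift_pow l g m n"
  unfolding shift_pow_def binom_sum_def ..

lemma (in weak_module) jacobi_diff_pow:
  assumes "w \<in> W"
  shows "diff_pow l (\<lambda>m n. Y u m (Y v n w)) m n - (-1) powi l *\<^sub>C diff_pow l (\<lambda>n m. Y v n (Y u m w)) n m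
      = shift_pow l (\<lambda>c d. Y (vop V u c v) d w) m n"
  using jacobi[OF assms, of l u m v n]
  unfolding jacobi_first[of l "\<lambda>m n. Y u m (Y v n w)"] jacobi_second[of l "\<lambda>n m. Y v n (Y u m w)"]
    jacobi_third[of m "\<lambda>c d. Y (vop V u c v) d w"] .

lemma weak_moduleI:
  assumes "complex_vector.subspace W"
    and "\<And>u n w. w \<in> W \<Longrightarrow> Y u n w \<in> W"
    and "\<And>u v n w. w \<in> W \<Longrightarrow> Y (u + v) n w = Y u n w + Y v n w"
    and "\<And>c u n w. w \<in> W \<Longrightarrow> Y (c *\<^sub>C u) n w = c *\<^sub>C Y u n w"
    and "\<And>u n w w'. w \<in> W \<Longrightarrow> w' \<in> W \<Longrightarrow> Y u n (w + w') = Y u n w + Y u n w'"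
    and "\<And>c u n w. w \<in> W \<Longrightarrow> Y u n (c *\<^sub>C w) = c *\<^sub>C Y u n w"
    and "\<And>u w. w \<in> W \<Longrightarrow> \<exists>N. \<forall>n\<ge>N. Y u n w = 0"
    and "\<And>n w. w \<in> W \<Longrightarrow> Y (vac V) n w = (if n = -1 then w else 0)"
    and jacobi: "\<And>l m n u v w. w \<in> W \<Longrightarrow>
      diff_pow l (\<lambda>m n. Y u m (Y v n w)) m n - (-1) powi l *\<^sub>C diff_pow l (\<lambda>n m. Y v n (Y u m w)) n m
      = shift_pow l (\<lambda>c d. Y (vop V u c v) d w) m n"
  shows "weak_module V W Y"
proof
  fix w u v and l m n :: int assume "w \<in> W"
  from jacobi[OF this, of l u v m n]
  show "Sum_any (\<lambda>i::nat. ((-1) ^ i * (of_int l gchoose i)) *\<^sub>C Y u (m + l - int i) (Y v (n + int i) w))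
      - Sum_any (\<lambda>i::nat. ((-1) powi l * (-1) ^ i * (of_int l gchoose i)) *\<^sub>C Y v (n + l - int i) (Y u (m + int i) w))
      = Sum_any (\<lambda>i::nat. (of_int m gchoose i) *\<^sub>C Y (vop V u (l + int i) v) (m + n - int i) w)"
    unfolding jacobi_first[of l "\<lambda>m n. Y u m (Y v n w)"] jacobi_second[of l "\<lambda>n m. Y v n (Y u m w)"]
      jacobi_third[of m "\<lambda>c d. Y (vop V u c v) d w"] .
qed (fact assms(1-8))+

section \<open>Arrays satisfying a Pascal rule\<close>

text \<open>Entry \<open>(p, q)\<close> of an array stands for the test function \<open>y\<^sup>p (y + z)\<^sup>q\<close>.\<close>

definition pascal :: "complex \<Rightarrow> (int \<Rightarrow> int \<Rightarrow> 'b::complex_vector) \<Rightarrow> bool" where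
  "pascal z F \<longleftrightarrow> (\<forall>p q. F p (q + 1) = F (p + 1) q + z *\<^sub>C F p q)"

text \<open>The behaviour of residues at infinity: \<open>y^p (y + z)^q\<close> has order
  \<open>p + q\<close> there. The companion \<open>vanishes_z\<close> is the behaviour of residues
  at \<open>-z\<close>, where the test function has a zero of order \<open>q\<close>. For arrays of
  functionals the bound is uniform in the argument.\<close>

definition vanishes_inf :: "(int \<Rightarrow> int \<Rightarrow> 'b::zero) \<Rightarrow> bool" where
  "vanishes_inf F \<longleftrightarrow> (\<exists>N. \<forall>p q. p + q \<le> N \<longrightarrow> F p q = 0)"

definition vanishes_z :: "(int \<Rightarrow> int \<Rightarrow> 'b::zero) \<Rightarrow> bool" where
  "vanishes_z F \<longleftrightarrow> (\<exists>N. \<forall>p q. q \<ge> N \<longrightarrow> F p q = 0)"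

lemma pascal_add: "pascal z F \<Longrightarrow> pascal z G \<Longrightarrow> pascal z (\<lambda>p q. F p q + G p q)"
  unfolding pascal_def by (simp add: scaleC_add_right algebra_simps)

lemma pascal_scale: "pascal z F \<Longrightarrow> pascal z (\<lambda>p q. c *\<^sub>C F p q)"
  unfolding pascal_def by (simp add: scaleC_add_right scaleC_scaleC mult.commute)

lemma pascal_uminus: "pascal z F \<Longrightarrow> pascal z (\<lambda>p q. - F p q)"
  unfolding pascal_def by simp

lemma pascal_diff: "pascal z F \<Longrightarrow> pascal z G \<Longrightarrow> pascal z (\<lambda>p q. F p q - G p q)"
  using pascal_add[of z F "\<lambda>p q. - G p q"] pascal_uminus[of z G] by simp

lemma vanishes_inf_add:
  assumes "vanishes_inf F" "vanishes_inf G"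
  shows "vanishes_inf (\<lambda>p q. F p q + G p q :: 'b::monoid_add)"
proof -
  from assms obtain N M where "\<forall>p q. p + q \<le> N \<longrightarrow> F p q = 0" "\<forall>p q. p + q \<le> M \<longrightarrow> G p q = 0"
    by (auto simp: vanishes_inf_def)
  then show ?thesis unfolding vanishes_inf_def by (intro exI[of _ "min N M"]) simp
qed

lemma vanishes_inf_uminus: "vanishes_inf F \<Longrightarrow> vanishes_inf (\<lambda>p q. - F p q :: 'b::group_add)"
  unfolding vanishes_inf_def by simp

lemma vanishes_inf_scale: "vanishes_inf F \<Longrightarrow> vanishes_inf (\<lambda>p q. c p q *\<^sub>C F p q :: 'b::complex_vector)"
  unfolding vanishes_inf_def by fastforce

lemma vanishes_inf_diff:
  "vanishes_inf F \<Longrightarrow> vanishes_inf G \<Longrightarrow> vanishes_inf (\<lambda>p q. F p q - G p q :: 'b::ab_group_add)"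
  using vanishes_inf_add[of F "\<lambda>p q. - G p q"] vanishes_inf_uminus[of G] by simp

lemma vanishes_z_add:
  assumes "vanishes_z F" "vanishes_z G"
  shows "vanishes_z (\<lambda>p q. F p q + G p q :: 'b::monoid_add)"
proof -
  from assms obtain N M where "\<forall>p q. q \<ge> N \<longrightarrow> F p q = 0" "\<forall>p q. q \<ge> M \<longrightarrow> G p q = 0"
    by (auto simp: vanishes_z_def)
  then show ?thesis unfolding vanishes_z_def by (intro exI[of _ "max N M"]) simp
qed

lemma vanishes_z_uminus: "vanishes_z F \<Longrightarrow> vanishes_z (\<lambda>p q. - F p q :: 'b::group_add)"
  unfolding vanishes_z_def by simp

lemma vanishes_z_scale: "vanishes_z F \<Longrightarrow> vanishes_z (\<lambda>p q. c p q *\<^sub>C F p q :: 'b::complex_vector)"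
  unfolding vanishes_z_def by fastforce

lemma vanishes_z_diff:
  "vanishes_z F \<Longrightarrow> vanishes_z G \<Longrightarrow> vanishes_z (\<lambda>p q. F p q - G p q :: 'b::ab_group_add)"
  using vanishes_z_add[of F "\<lambda>p q. - G p q"] vanishes_z_uminus[of G] by simp

lemma finite_choice_ge:
  assumes "\<And>i::nat. \<exists>M. \<forall>m::int. m \<ge> M \<longrightarrow> Q i m"
  shows "\<exists>M. \<forall>i<K. \<forall>m\<ge>M. Q i m"
proof -
  have "eventually (\<lambda>m. \<forall>i\<in>{..<K}. Q i m) at_top"
    by (rule eventually_ball_finite) (use assms in \<open>simp_all add: eventually_at_top_linorder\<close>)
  then show ?thesis by (auto simp: eventually_at_top_linorder)
qed

text \<open>The bounds for the single \<open>F i\<close> may differ, so only finitely many of them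
  can be combined; hence \<open>K\<close> must not depend on \<open>p\<close> and \<open>q\<close>.
  The binomial coefficients may depend on them, since only vanishing matters.\<close>

lemma vanishes_binom_sum:
  assumes K: "\<And>i p q. i \<ge> K \<Longrightarrow> F i p q = 0"
  shows "(\<And>i. vanishes_inf (F i)) \<Longrightarrow> vanishes_inf (\<lambda>p q. binom_sum (a p q) (\<lambda>i. F i p q))"
    and "(\<And>i. vanishes_z (F i)) \<Longrightarrow> vanishes_z (\<lambda>p q. binom_sum (a p q) (\<lambda>i. F i p q))"
proof -
  have eq: "binom_sum (a p q) (\<lambda>i. F i p q) = (\<Sum>i<K. (a p q gchoose i) *\<^sub>C F i p q)" for p q
    unfolding binom_sum_def by (rule Sum_any_nat_bound) (simp add: K)
  { assume F: "\<And>i. vanishes_inf (F i)"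
    have "vanishes_inf (\<lambda>p q. \<Sum>i<n. (a p q gchoose i) *\<^sub>C F i p q)" for n
      by (induction n) (simp add: vanishes_inf_def, simp add: vanishes_inf_add vanishes_inf_scale F)
    then show "vanishes_inf (\<lambda>p q. binom_sum (a p q) (\<lambda>i. F i p q))" by (simp only: eq) }
  { assume F: "\<And>i. vanishes_z (F i)"
    have "vanishes_z (\<lambda>p q. \<Sum>i<n. (a p q gchoose i) *\<^sub>C F i p q)" for n
      by (induction n) (simp add: vanishes_z_def, simp add: vanishes_z_add vanishes_z_scale F)
    then show "vanishes_z (\<lambda>p q. binom_sum (a p q) (\<lambda>i. F i p q))" by (simp only: eq) }
qed

lemma vanishes_shift:
  "vanishes_inf F \<Longrightarrow> vanishes_inf (\<lambda>p q. F (p + a) (q + b))"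
  "vanishes_z F \<Longrightarrow> vanishes_z (\<lambda>p q. F (p + a) (q + b))"
proof -
  assume "vanishes_inf F"
  then obtain N where "\<forall>p q. p + q \<le> N \<longrightarrow> F p q = 0" by (auto simp: vanishes_inf_def)
  then show "vanishes_inf (\<lambda>p q. F (p + a) (q + b))"
    unfolding vanishes_inf_def by (intro exI[of _ "N - a - b"]) simp
next
  assume "vanishes_z F"
  then obtain N where "\<forall>p q. q \<ge> N \<longrightarrow> F p q = 0" by (auto simp: vanishes_z_def)
  then show "vanishes_z (\<lambda>p q. F (p + a) (q + b))"
    unfolding vanishes_z_def by (intro exI[of _ "N - b"]) simp
qed

lemma int_ge_ex: "\<exists>k. (p::int) \<le> b + int k" by (intro exI[of _ "nat (p - b)"]) simp
lemma int_le_ex: "\<exists>k. (p::int) \<ge> b - int k" by (intro exI[of _ "nat (b - p)"]) simp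

text \<open>Solved for \<open>F (p + 1) q\<close>, the rule carries membership one step to the
  right, provided that the row above lies in \<open>S\<close>. Rows \<open>q \<ge> N\<close> are
  given; each lower row starts on its left end, where \<open>p + q \<le> M\<close>, and is filled
  from left to right.\<close>

lemma pascal_in_subspace:
  assumes P: "pascal z F" and S: "complex_vector.subspace S"
    and N: "\<And>p q. q \<ge> N \<Longrightarrow> F p q \<in> S" and M: "\<And>p q. p + q \<le> M \<Longrightarrow> F p q \<in> S"
  shows "F p q \<in> S"
proof -
  have step: "F (p + 1) q \<in> S" if "F p (q + 1) \<in> S" "F p q \<in> S" for p q
  proof -
    have "F (p + 1) q = F p (q + 1) - z *\<^sub>C F p q" using P by (simp add: pascal_def)
    then show ?thesis using that S by (simp add: complex_vector.subspace_diff complex_vector.subspace_scale)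
  qed
  have "\<forall>q\<ge>N - int k. \<forall>p. F p q \<in> S" for k
  proof (induction k)
    case 0
    show ?case using N by simp
  next
    case (Suc k)
    define q where "q = N - int (Suc k)"
    have *: "F p (q + 1) \<in> S" for p using Suc by (simp add: q_def)
    have "\<forall>p\<le>M - q + int j. F p q \<in> S" for j
    proof (induction j)
      case 0
      show ?case using M by simp
    next
      case (Suc j)
      show ?case
      proof (intro allI impI)
        fix p assume p: "p \<le> M - q + int (Suc j)"
        show "F p q \<in> S" using step[of "p - 1" q] * Suc p by simp
      qed
    qed
    then have q: "F p q \<in> S" for p using int_ge_ex[of p "M - q"] by blast
    show ?case
    proof (intro allI impI)
      fix q' p assume "q' \<ge> N - int (Suc k)"
      then have "q' = q \<or> q' \<ge> N - int k" by (auto simp: q_def)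
      then show "F p q' \<in> S" using q Suc by auto
    qed
  qed
  then show ?thesis using int_le_ex[of N q] by blast
qed

text \<open>The zero subspace in \<open>pascal_in_subspace\<close>. It makes the splitting of an
  array into a part at infinity and a part at \<open>-z\<close> unique.\<close>

lemma pascal_unique:
  assumes "pascal z F" and "vanishes_inf F" "vanishes_z F"
  shows "F p q = 0"
proof -
  obtain N M where "\<And>p q. q \<ge> N \<Longrightarrow> F p q = 0" and "\<And>p q. p + q \<le> M \<Longrightarrow> F p q = 0"
    using assms by (auto simp: vanishes_inf_def vanishes_z_def)
  then show ?thesis using pascal_in_subspace[OF assms(1) complex_vector.subspace_single_0, of N M p q] by simp
qed

text \<open>Upwards, each row is determined by the one below it. Downwards, a zero row above gives
  \<open>F (p + 1) q = - z F p q\<close>, so with \<open>z \<noteq> 0\<close> vanishing for large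
  \<open>p\<close> spreads to the left. This is the uniqueness principle for expansions at
  \<open>y = 0\<close>, where truncation supplies the vanishing for large \<open>p\<close>.\<close>

lemma pascal_unique_row:
  assumes P: "pascal z F" and z: "z \<noteq> 0" and row: "\<And>p. F p q0 = 0"
    and top: "\<And>q. q < q0 \<Longrightarrow> \<exists>M. \<forall>p\<ge>M. F p q = 0"
  shows "F p q = 0"
proof -
  have up: "F p (q0 + int k) = 0" for k p
    by (induction k arbitrary: p) (use row P in \<open>auto simp: pascal_def add.assoc[symmetric] add.commute[of 1]\<close>)
  have down: "F p (q0 - int k) = 0" for k p
  proof (induction k arbitrary: p)
    case 0
    show ?case using row by simp
  next
    case (Suc k)
    define q where "q = q0 - int (Suc k)"
    have step: "F (p + 1) q = - (z *\<^sub>C F p q)" for p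
    proof -
      have "F p (q + 1) = 0" using Suc by (simp add: q_def)
      then show ?thesis using P unfolding pascal_def by (metis add_eq_0_iff2)
    qed
    obtain M where M: "\<forall>p\<ge>M. F p q = 0" using top[of q] by (auto simp: q_def)
    have "\<forall>p\<ge>M - int j. F p q = 0" for j
    proof (induction j)
      case 0
      show ?case using M by simp
    next
      case (Suc j)
      show ?case
      proof (intro allI impI)
        fix p assume p: "p \<ge> M - int (Suc j)"
        then have "F (p + 1) q = 0" using Suc by simp
        then have "z *\<^sub>C F p q = 0" using step[of p] by simp
        then show "F p q = 0" using z by (simp add: complex_vector.scale_eq_0_iff)
      qed
    qed
    then show ?case using int_le_ex[of M p] by (auto simp: q_def)
  qed
  show ?thesis
  proof (cases "q \<ge> q0")
    case True
    then show ?thesis using up[of p "nat (q - q0)"] by simp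
  next
    case False
    then show ?thesis using down[of p "nat (q0 - q)"] by simp
  qed
qed

text \<open>The expansion of \<open>y^p (y + z)^q\<close> in nonnegative powers of
  \<open>y / z\<close>, with \<open>f n\<close> substituted for \<open>y^n\<close>.\<close>

definition transl :: "complex \<Rightarrow> (int \<Rightarrow> 'b::complex_vector) \<Rightarrow> int \<Rightarrow> int \<Rightarrow> 'b" where
  "transl z f p q = binom_sum (of_int q) (\<lambda>i. z powi (q - int i) *\<^sub>C f (p + int i))"

lemma transl_0 [simp]: "transl z f p 0 = f p"
  by (simp add: transl_def scaleC_one)

lemma transl_finite:
  "(\<And>n. n \<ge> K \<Longrightarrow> f n = (0::'b::complex_vector)) \<Longrightarrow> finite {i. c i *\<^sub>C f (p + int i) \<noteq> 0}"
  by (rule finite_support_natI[of "nat (K - p)"]) auto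

lemma pascal_transl:
  assumes K: "\<And>n. n \<ge> K \<Longrightarrow> f n = 0" and z: "z \<noteq> 0"
  shows "pascal z (transl z f)"
  unfolding pascal_def
proof (intro allI)
  fix p q
  have 1: "transl z f p (q + 1) = binom_sum (of_int q) (\<lambda>i. z powi (q + 1 - int i) *\<^sub>C f (p + int i))
    + binom_sum (of_int q) (\<lambda>i. z powi (q + 1 - int (Suc i)) *\<^sub>C f (p + int (Suc i)))"
    unfolding transl_def of_int_add of_int_1
    by (rule binom_sum_Suc) (rule transl_finite, rule K)
  have 2: "z powi (q + 1 - int i) *\<^sub>C f (p + int i) = z *\<^sub>C (z powi (q - int i) *\<^sub>C f (p + int i))" for i
    using z power_int_add[of z 1 "q - int i"] by (simp add: algebra_simps scaleC_scaleC)
  have 3: "z powi (q + 1 - int (Suc i)) *\<^sub>C f (p + int (Suc i)) = z powi (q - int i) *\<^sub>C f (p + 1 + int i)" for i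
    by (simp add: algebra_simps)
  show "transl z f p (q + 1) = transl z f (p + 1) q + z *\<^sub>C transl z f p q"
    unfolding 1 unfolding 3 unfolding 2 binom_sum_scale by (simp add: transl_def)
qed

lemma transl_vanish: "(\<And>n. n \<ge> K \<Longrightarrow> f n = 0) \<Longrightarrow> p \<ge> K \<Longrightarrow> transl z f p q = 0"
  unfolding transl_def by (simp add: binom_sum_def)

text \<open>The test function \<open>y1^p (y1+z)^q y2^p' (y2+z)^q' (y1-y2)^l\<close> at
  \<open>y1 = y2 + y0\<close>: both \<open>(y2 + y0)^p\<close> and \<open>((y2 + z) + y0)^q\<close>
  are expanded in nonnegative powers of \<open>y0\<close>, and \<open>g c d e\<close> is substituted
  for \<open>y0^c y2^d (y2 + z)^e\<close>.\<close>

definition double_shift :: "int \<Rightarrow> (int \<Rightarrow> int \<Rightarrow> int \<Rightarrow> 'b::complex_vector) \<Rightarrow> int \<Rightarrow> int \<Rightarrow> int \<Rightarrow> int \<Rightarrow> 'b" where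
  "double_shift l g p q p' q' =
     binom_sum (of_int q) (\<lambda>b. shift_pow (l + int b) (\<lambda>c d. g c d (q + q' - int b)) p p')"

lemma shift_pow_vanish: "(\<And>a. g (l + int a) (m + n - int a) = 0) \<Longrightarrow> shift_pow l g m n = 0"
  unfolding shift_pow_def by simp

lemma double_shift_vanish:
  assumes "\<And>a b. g (l + int a + int b) (p + p' - int a) (q + q' - int b) = 0"
  shows "double_shift l g p q p' q' = 0"
proof -
  have "shift_pow (l + int b) (\<lambda>c d. g c d (q + q' - int b)) p p' = 0" for b
  proof (rule shift_pow_vanish)
    fix a show "g (l + int b + int a) (p + p' - int a) (q + q' - int b) = 0"
      using assms[of a b] by (simp add: ac_simps)
  qed
  then show ?thesis by (simp add: double_shift_def)
qed

context
  fixes g :: "int \<Rightarrow> int \<Rightarrow> int \<Rightarrow> 'b::complex_vector" and N :: int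
  assumes N: "\<And>c d e. c \<ge> N \<Longrightarrow> g c d e = 0"
begin

lemma double_shift_finite:
  "finite {b. shift_pow (l + int b) (\<lambda>c d. g c d (q - int b)) p p' \<noteq> 0}"
  by (rule finite_support_natI[of "nat (N - l)"]) (auto intro!: shift_pow_vanish N)

lemma shift_pow_finite: "finite {i. g (l + int i) (m - int i) e \<noteq> 0}"
  by (rule finite_support_natI[of "nat (N - l)"]) (auto intro!: N)

lemma double_shift_Suc_p:
  "double_shift (l + 1) g p q p' q' = double_shift l g (p + 1) q p' q' - double_shift l g p q (p' + 1) q'"
  unfolding double_shift_def
  by (subst binom_sum_diff[symmetric, OF double_shift_finite double_shift_finite], rule binom_sum_cong)
    (subst shift_pow_Suc[symmetric, where N = N], auto simp: N add_ac)

lemma double_shift_Suc_q: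
  "double_shift (l + 1) g p q p' q' = double_shift l g p (q + 1) p' q' - double_shift l g p q p' (q' + 1)"
proof -
  have "double_shift l g p (q + 1) p' q' =
    binom_sum (of_int q) (\<lambda>b. shift_pow (l + int b) (\<lambda>c d. g c d (q + 1 + q' - int b)) p p')
    + binom_sum (of_int q) (\<lambda>b. shift_pow (l + int (Suc b)) (\<lambda>c d. g c d (q + 1 + q' - int (Suc b))) p p')"
    unfolding double_shift_def of_int_add of_int_1 by (rule binom_sum_Suc[OF double_shift_finite])
  then show ?thesis unfolding double_shift_def by (simp add: algebra_simps)
qed

lemma pascal_double_shift_right:
  assumes P: "\<And>c. pascal z (g c)"
  shows "pascal z (\<lambda>p' q'. double_shift l g p q p' q')"
  unfolding pascal_def
proof (intro allI)
  fix p' q'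
  have s: "shift_pow l' (\<lambda>c d. g c d (e + 1)) p p'
    = shift_pow l' (\<lambda>c d. g c d e) p (p' + 1) + z *\<^sub>C shift_pow l' (\<lambda>c d. g c d e) p p'" for l' e
  proof -
    have *: "g c d (e + 1) = g c (d + 1) e + z *\<^sub>C g c d e" for c d using P by (simp add: pascal_def)
    show ?thesis unfolding shift_pow_def
      apply (subst binom_sum_scale[symmetric])
      apply (subst binom_sum_add[symmetric])
      apply (use shift_pow_finite in auto)[2]
      apply (rule binom_sum_cong)
      apply (subst *)
      apply (simp add: algebra_simps)
      done
  qed
  show "double_shift l g p q p' (q' + 1) = double_shift l g p q (p' + 1) q' + z *\<^sub>C double_shift l g p q p' q'"
    unfolding double_shift_def
    apply (subst binom_sum_scale[symmetric])
    apply (subst binom_sum_add[symmetric])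
    using double_shift_finite s[symmetric] by (auto intro!: binom_sum_cong simp: algebra_simps)
qed

text \<open>The factor \<open>y0\<close> is both \<open>y1 - y2\<close> and
  \<open>(y1 + z) - (y2 + z)\<close>. Equating the two recursions transfers the Pascal rule from the
  second variable to the first.\<close>

lemma pascal_double_shift_left:
  assumes P: "\<And>c. pascal z (g c)"
  shows "pascal z (\<lambda>p q. double_shift l g p q p' q')"
  unfolding pascal_def
proof (intro allI)
  fix p q
  have "double_shift l g p (q + 1) p' q' = double_shift (l + 1) g p q p' q' + double_shift l g p q p' (q' + 1)"
    by (simp add: double_shift_Suc_q)
  also have "double_shift l g p q p' (q' + 1) = double_shift l g p q (p' + 1) q' + z *\<^sub>C double_shift l g p q p' q'"
    using pascal_double_shift_right[OF P] by (simp add: pascal_def)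
  finally show "double_shift l g p (q + 1) p' q' = double_shift l g (p + 1) q p' q' + z *\<^sub>C double_shift l g p q p' q'"
    by (simp add: double_shift_Suc_p)
qed

lemma double_shift_vanishes:
  shows "(\<And>c. vanishes_inf (g c)) \<Longrightarrow> vanishes_inf (\<lambda>p q. double_shift l g p q p' q')"
    and "(\<And>c. vanishes_inf (g c)) \<Longrightarrow> vanishes_inf (\<lambda>p' q'. double_shift l g p q p' q')"
    and "(\<And>c. vanishes_z (g c)) \<Longrightarrow> vanishes_z (\<lambda>p q. double_shift l g p q p' q')"
    and "(\<And>c. vanishes_z (g c)) \<Longrightarrow> vanishes_z (\<lambda>p' q'. double_shift l g p q p' q')"
proof -
  have outer: "binom_sum a (\<lambda>i. g (l + int b + int i) (d i) e) = 0" if "b \<ge> nat (N - l)" for a b d e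
    using that by (simp add: N binom_sum_def)
  have inner: "g (l + int b + int i) d e = 0" if "i \<ge> nat (N - l)" for b i d e
    using that by (intro N) simp
  note sum = vanishes_binom_sum[where K = "nat (N - l)"]
  show "vanishes_inf (\<lambda>p q. double_shift l g p q p' q')" if V: "\<And>c. vanishes_inf (g c)"
    unfolding double_shift_def shift_pow_def
    by (intro sum(1) outer inner)
      (use vanishes_shift(1)[OF V, of _ "p' - int i" "q' - int b" for i b] in \<open>simp_all add: algebra_simps\<close>)
  show "vanishes_inf (\<lambda>p' q'. double_shift l g p q p' q')" if V: "\<And>c. vanishes_inf (g c)"
    unfolding double_shift_def shift_pow_def
    by (intro sum(1) outer inner)
      (use vanishes_shift(1)[OF V, of _ "p - int i" "q - int b" for i b] in \<open>simp_all add: algebra_simps\<close>)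
  show "vanishes_z (\<lambda>p q. double_shift l g p q p' q')" if V: "\<And>c. vanishes_z (g c)"
    unfolding double_shift_def shift_pow_def
    by (intro sum(2) outer inner)
      (use vanishes_shift(2)[OF V, of _ "p' - int i" "q' - int b" for i b] in \<open>simp_all add: algebra_simps\<close>)
  show "vanishes_z (\<lambda>p' q'. double_shift l g p q p' q')" if V: "\<And>c. vanishes_z (g c)"
    unfolding double_shift_def shift_pow_def
    by (intro sum(2) outer inner)
      (use vanishes_shift(2)[OF V, of _ "p - int i" "q - int b" for i b] in \<open>simp_all add: algebra_simps\<close>)
qed

lemma double_shift_top:
  assumes V: "\<And>c. \<exists>M. \<forall>d\<ge>M. \<forall>e. g c d e = 0"
  shows "\<exists>M. \<forall>p q p' q'. p + p' \<ge> M \<longrightarrow> double_shift l g p q p' q' = 0"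
proof -
  obtain M where M: "\<And>i d e. i < nat (N - l) \<Longrightarrow> d \<ge> M \<Longrightarrow> g (l + int i) d e = 0"
    using finite_choice_ge[of "\<lambda>i d. \<forall>e. g (l + int i) d e = 0" "nat (N - l)"] V by blast
  \<comment> \<open>Only \<open>a < nat (N - l)\<close> contributes, so the extra
    \<open>\<bar>N - l\<bar>\<close> keeps the second index \<open>p + p' - a\<close> at least
    \<open>M\<close>.\<close>
  have "double_shift l g p q p' q' = 0" if "p + p' \<ge> M + \<bar>N - l\<bar>" for p q p' q'
  proof (rule double_shift_vanish)
    fix a b
    show "g (l + int a + int b) (p + p' - int a) (q + q' - int b) = 0"
    proof (cases "a + b < nat (N - l)")
      case True
      then show ?thesis using M[OF True, of "p + p' - int a"] that by (simp add: add.assoc)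
    qed (intro N, simp)
  qed
  then show ?thesis by blast
qed

lemma double_shift_additive:
  fixes h :: "'b \<Rightarrow> 'c::complex_vector"
  assumes "\<And>x y. h (x + y) = h x + h y" "\<And>x c. h (c *\<^sub>C x) = c *\<^sub>C h x"
  shows "h (double_shift l g p q p' q') = double_shift l (\<lambda>c d e. h (g c d e)) p q p' q'"
proof -
  have "h (shift_pow l' (\<lambda>c d. g c d e) p p') = shift_pow l' (\<lambda>c d. h (g c d e)) p p'" for l' e
    unfolding shift_pow_def
    by (rule binom_sum_additive[where W = UNIV and h = h, OF shift_pow_finite]) (auto simp: assms)
  then show ?thesis unfolding double_shift_def
    by (subst binom_sum_additive[where W = UNIV and h = h, OF double_shift_finite]) (auto simp: assms)
qed

end

lemma double_shift_diff:
  assumes N: "\<And>c d e. c \<ge> N \<Longrightarrow> g c d e = 0" "\<And>c d e. c \<ge> N \<Longrightarrow> h c d e = 0"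
  shows "double_shift l (\<lambda>c d e. g c d e - h c d e) p q p' q' =
    double_shift l g p q p' q' - double_shift l h p q p' q'"
proof -
  have "shift_pow l' (\<lambda>c d. g c d e - h c d e) p p' =
    shift_pow l' (\<lambda>c d. g c d e) p p' - shift_pow l' (\<lambda>c d. h c d e) p p'" for l' e
    unfolding shift_pow_def
    by (rule binom_sum_diff) (rule shift_pow_finite, erule N)+
  then show ?thesis unfolding double_shift_def
    by (subst binom_sum_diff[symmetric, OF double_shift_finite[OF N(1)] double_shift_finite[OF N(2)]]) auto
qed

text \<open>With \<open>q = q' = 0\<close> this is the right side of the Jacobi identity in the
  variable \<open>y\<close>, the starting point; with \<open>p = p' = 0\<close>, in the next lemma,
  it is the one in \<open>x = y + z\<close>, where the result is read off.\<close>

lemma double_shift_00: "double_shift l g p 0 p' 0 = shift_pow l (\<lambda>c d. g c d 0) p p'"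
  by (simp add: double_shift_def)

lemma double_shift_p0: "double_shift l g 0 q 0 q' = shift_pow l (\<lambda>c. g c 0) q q'"
  unfolding double_shift_def shift_pow_0 by (simp add: shift_pow_def)

lemma diff_pow_cong: "(\<And>m n. f m n = g m n) \<Longrightarrow> diff_pow l f p q = diff_pow l g p q"
  by (metis ext)

lemma diff_pow_pascal_aux:
  assumes "\<And>m n. f m n = f1 m n + z *\<^sub>C f2 m n" "antidiag_finite f1" "antidiag_finite f2"
  shows "diff_pow l f p q = diff_pow l f1 p q + z *\<^sub>C diff_pow l f2 p q"
  unfolding diff_pow_cong[of f "\<lambda>m n. f1 m n + z *\<^sub>C f2 m n", OF assms(1)]
  by (subst diff_pow_scale[symmetric], subst diff_pow_add[symmetric])
     (use assms in \<open>auto intro: antidiag_finite_scale\<close>)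

lemma diff_pow_shift_left: "diff_pow l (\<lambda>m n. f (m + 1) n) p q = diff_pow l f (p + 1) q"
  unfolding diff_pow_def by (simp add: algebra_simps)

lemma diff_pow_shift_right: "diff_pow l (\<lambda>m n. f m (n + 1)) p q = diff_pow l f p (q + 1)"
  unfolding diff_pow_def by (simp add: algebra_simps)

lemma antidiag_finite_shift_left:
  assumes "antidiag_finite f" shows "antidiag_finite (\<lambda>m n. f (m + 1) n)"
  unfolding antidiag_finite_def
proof (intro allI)
  fix t n show "finite {i. f (t - int i + 1) (n + int i) \<noteq> 0}"
    using antidiag_finiteD[OF assms, of "t + 1" n] by (simp add: algebra_simps)
qed

lemma antidiag_finite_shift_right:
  assumes "antidiag_finite f" shows "antidiag_finite (\<lambda>m n. f m (n + 1))"
  unfolding antidiag_finite_def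
proof (intro allI)
  fix t n show "finite {i. f (t - int i) (n + int i + 1) \<noteq> 0}"
    using antidiag_finiteD[OF assms, of t "n + 1"] by (simp add: algebra_simps)
qed

text \<open>The four variants differ in where \<open>diff_pow\<close> moves the indices of the array
  in question: in versions 1 and 2 it is the exponent of \<open>y\<close>, in 3 and 4 that of
  \<open>y + z\<close>; in odd versions it is the first slot of \<open>diff_pow\<close>, in even
  ones the second.\<close>

lemma pascal_diff_pow_1:
  assumes "\<And>n. pascal z (\<lambda>m q. F m q n)" "\<And>q. antidiag_finite (\<lambda>m n. F m q n)"
  shows "pascal z (\<lambda>p q. diff_pow l (\<lambda>m n. F m q n) p p')"
  unfolding pascal_def
  by (intro allI, subst diff_pow_shift_left[symmetric], rule diff_pow_pascal_aux)
     (use assms in \<open>auto simp: pascal_def intro: antidiag_finite_shift_left\<close>)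

lemma pascal_diff_pow_2:
  assumes "\<And>m. pascal z (\<lambda>n q. F n q m)" "\<And>q. antidiag_finite (\<lambda>m n. F n q m)"
  shows "pascal z (\<lambda>p q. diff_pow l (\<lambda>m n. F n q m) p' p)"
  unfolding pascal_def
  by (intro allI, subst diff_pow_shift_right[symmetric], rule diff_pow_pascal_aux)
     (use assms in \<open>auto simp: pascal_def intro: antidiag_finite_shift_right\<close>)

lemma pascal_diff_pow_3:
  assumes "\<And>n. pascal z (\<lambda>p m. F p m n)" "\<And>p. antidiag_finite (\<lambda>m n. F p m n)"
  shows "pascal z (\<lambda>p q. diff_pow l (\<lambda>m n. F p m n) q q')"
  unfolding pascal_def
  by (intro allI, subst diff_pow_shift_left[symmetric], rule diff_pow_pascal_aux)
     (use assms in \<open>auto simp: pascal_def\<close>)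

lemma pascal_diff_pow_4:
  assumes "\<And>m. pascal z (\<lambda>p n. F p n m)" "\<And>p. antidiag_finite (\<lambda>m n. F p n m)"
  shows "pascal z (\<lambda>p q. diff_pow l (\<lambda>m n. F p n m) q' q)"
  unfolding pascal_def
  by (intro allI, subst diff_pow_shift_right[symmetric], rule diff_pow_pascal_aux)
     (use assms in \<open>auto simp: pascal_def\<close>)

lemma diff_pow_additive:
  assumes "antidiag_finite f"
    "\<And>x y. h (x + y) = h x + h y" "\<And>x c. h (c *\<^sub>C x) = c *\<^sub>C h x"
  shows "h (diff_pow l f m n) = diff_pow l (\<lambda>m n. h (f m n)) m n"
  unfolding diff_pow_def
  by (subst binom_sum_additive[where W = UNIV and h = h])
     (use assms in \<open>auto intro!: antidiag_finiteD\<close>)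

text \<open>In the pair \<open>p, q\<close> the sum \<open>E1 + E2\<close> vanishes near infinity
  and equals \<open>-(E3 + E4)\<close>, which vanishes near \<open>-z\<close>; so both sums are zero
  by \<open>pascal_unique\<close>. The same argument in the pair \<open>p', q'\<close> then
  separates \<open>E1\<close> from \<open>E2\<close> and \<open>E3\<close> from
  \<open>E4\<close>.\<close>

lemma four_way_unique:
  fixes E1 :: "int \<Rightarrow> int \<Rightarrow> int \<Rightarrow> int \<Rightarrow> 'b::complex_vector"
  assumes sum: "\<And>p q p' q'. E1 p q p' q' + E2 p q p' q' + E3 p q p' q' + E4 p q p' q' = 0"
    and l: "\<And>p' q'. pascal z (\<lambda>p q. E1 p q p' q')" "\<And>p' q'. pascal z (\<lambda>p q. E2 p q p' q')"
      "\<And>p' q'. pascal z (\<lambda>p q. E3 p q p' q')" "\<And>p' q'. pascal z (\<lambda>p q. E4 p q p' q')"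
    and r: "\<And>p q. pascal z (\<lambda>p' q'. E1 p q p' q')" "\<And>p q. pascal z (\<lambda>p' q'. E2 p q p' q')"
      "\<And>p q. pascal z (\<lambda>p' q'. E3 p q p' q')" "\<And>p q. pascal z (\<lambda>p' q'. E4 p q p' q')"
    and vl: "\<And>p' q'. vanishes_inf (\<lambda>p q. E1 p q p' q')" "\<And>p' q'. vanishes_inf (\<lambda>p q. E2 p q p' q')"
      "\<And>p' q'. vanishes_z (\<lambda>p q. E3 p q p' q')" "\<And>p' q'. vanishes_z (\<lambda>p q. E4 p q p' q')"
    and vr: "\<And>p q. vanishes_inf (\<lambda>p' q'. E1 p q p' q')" "\<And>p q. vanishes_z (\<lambda>p' q'. E2 p q p' q')"
      "\<And>p q. vanishes_inf (\<lambda>p' q'. E3 p q p' q')" "\<And>p q. vanishes_z (\<lambda>p' q'. E4 p q p' q')"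
  shows "E1 p q p' q' = 0" "E2 p q p' q' = 0" "E3 p q p' q' = 0" "E4 p q p' q' = 0"
proof -
  have eq: "E1 p q p' q' + E2 p q p' q' = - (E3 p q p' q' + E4 p q p' q')" for p q p' q'
    unfolding eq_neg_iff_add_eq_0 using sum[of p q p' q'] by (simp add: add.assoc)
  have 12: "E1 p q p' q' + E2 p q p' q' = 0" for p q p' q'
  proof (rule pascal_unique[where z = z and F = "\<lambda>p q. E1 p q p' q' + E2 p q p' q'"])
    show "vanishes_z (\<lambda>p q. E1 p q p' q' + E2 p q p' q')"
      unfolding eq by (intro vanishes_z_uminus vanishes_z_add vl)
  qed (intro pascal_add l, intro vanishes_inf_add vl)
  have 34: "E3 p q p' q' + E4 p q p' q' = 0" for p q p' q'
    using sum[of p q p' q'] 12[of p q p' q'] by (simp add: add.assoc)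
  have 1: "E1 p q p' q' = 0" for p q p' q'
  proof (rule pascal_unique[where z = z and F = "\<lambda>p' q'. E1 p q p' q'"])
    have "E1 p q p' q' = - E2 p q p' q'" for p' q'
      using 12[of p q p' q'] by (simp add: eq_neg_iff_add_eq_0)
    then show "vanishes_z (\<lambda>p' q'. E1 p q p' q')"
      by simp (intro vanishes_z_uminus vr)
  qed (intro r vr)+
  have 3: "E3 p q p' q' = 0" for p q p' q'
  proof (rule pascal_unique[where z = z and F = "\<lambda>p' q'. E3 p q p' q'"])
    have "E3 p q p' q' = - E4 p q p' q'" for p' q'
      using 34[of p q p' q'] by (simp add: eq_neg_iff_add_eq_0)
    then show "vanishes_z (\<lambda>p' q'. E3 p q p' q')"
      by simp (intro vanishes_z_uminus vr)
  qed (intro r vr)+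
  show "E1 p q p' q' = 0" "E3 p q p' q' = 0" by (rule 1 3)+
  then show "E2 p q p' q' = 0" "E4 p q p' q' = 0" using 12[of p q p' q'] 34[of p q p' q'] by auto
qed

section \<open>The Jacobi identity for rational test functions\<close>

lemma linear_zero: "clinear f \<Longrightarrow> f 0 = 0"
  unfolding Vector_Spaces.linear_iff by (metis complex_vector.scale_zero_left)

text \<open>Both sides of a Jacobi identity satisfy \<open>rec\<close>. Hence it holds if it holds for one \<open>l\<close> (locality)
  and, for every \<open>l\<close>, for a single \<open>m\<close> or a single \<open>n\<close> (associativity).\<close>

lemma difference_recursion_zero:
  fixes J :: "int \<Rightarrow> int \<Rightarrow> int \<Rightarrow> 'b::ab_group_add"
  assumes rec: "\<And>l m n. J (l + 1) m n = J l (m + 1) n - J l m (n + 1)"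
    and row: "\<And>m n. J L m n = 0"
    and seed: "\<And>l. \<exists>M. (\<forall>n. J l M n = 0) \<or> (\<forall>m. J l m M = 0)"
  shows "J l m n = 0"
proof -
  have up: "J (L + int k) m n = 0" for k m n
  proof (induction k arbitrary: m n)
    case (Suc k)
    then show ?case using rec[of "L + int k" m n] by (simp add: algebra_simps)
  qed (simp add: row)
  have down: "J (L - int k) m n = 0" for k m n
  proof (induction k arbitrary: m n)
    case (Suc k)
    let ?l = "L - int (Suc k)"
    have step: "J ?l (m + 1) n = J ?l m (n + 1)" for m n
      using rec[of ?l m n] Suc by simp
    \<comment> \<open>With the level above already zero, \<open>rec\<close> makes \<open>J\<close>
      constant along antidiagonals, and the vanishing row or column supplied by \<open>seed\<close>
      meets every antidiagonal.\<close>
    have anti: "J ?l (m + int j) n = J ?l m (n + int j)" for j m n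
    proof (induction j arbitrary: n)
      case (Suc j)
      show ?case using step[of "m + int j" n] Suc[of "n + 1"] by (simp add: algebra_simps)
    qed simp
    obtain M where "(\<forall>n. J ?l M n = 0) \<or> (\<forall>m. J ?l m M = 0)" using seed by blast
    then show ?case
      using anti[of M "nat (m - M)" n] anti[of m "nat (M - m)" "n - int (nat (M - m))"]
        anti[of m "nat (n - M)" M] anti[of "m - int (nat (M - n))" "nat (M - n)" n]
      by (cases "m \<ge> M"; cases "n \<ge> M") auto
  qed (simp add: row)
  show ?thesis using up[of "nat (l - L)" m n] down[of "nat (L - l)" m n] by (cases "l \<ge> L") auto
qed

lemma diff_pow_vanish: "(\<And>i. f (m + l - int i) (n + int i) = 0) \<Longrightarrow> diff_pow l f m n = 0"
  unfolding diff_pow_def by simp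

lemma diff_pow_vanish_right: "(\<And>m n. n \<ge> N \<Longrightarrow> f m n = 0) \<Longrightarrow> n \<ge> N \<Longrightarrow> diff_pow l f m n = 0"
  by (rule diff_pow_vanish) simp

lemma diff_pow_top:
  assumes "\<And>m n. n \<ge> N \<Longrightarrow> f m n = 0" "\<And>n. \<exists>M. \<forall>m\<ge>M. f m n = 0"
  shows "\<exists>M. \<forall>m\<ge>M. diff_pow l f m n = 0"
proof -
  obtain M where M: "\<And>i m. i < nat (N - n) \<Longrightarrow> m \<ge> M \<Longrightarrow> f m (n + int i) = 0"
    using finite_choice_ge[of "\<lambda>i m. f m (n + int i) = 0" "nat (N - n)"] assms(2) by blast
  have "diff_pow l f m n = 0" if "m \<ge> M - l + int (nat (N - n))" for m
  proof (rule diff_pow_vanish)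
    fix i show "f (m + l - int i) (n + int i) = 0"
    proof (cases "i < nat (N - n)")
      case True
      show ?thesis by (rule M) (use True that in \<open>auto split: if_splits\<close>)
    next
      case False
      show ?thesis by (rule assms(1)) (use False in auto)
    qed
  qed
  then show ?thesis by blast
qed

section \<open>Residues of vertex operators against rational test functions\<close>

locale module_translation = weak_module V UNIV Y
  for V :: "'v::complex_vector voa" and Y :: "'v \<Rightarrow> int \<Rightarrow> 'w::complex_vector \<Rightarrow> 'w" +
  fixes z :: complex
  assumes z: "z \<noteq> 0"
    and vop_truncation: "\<And>u v. \<exists>N. \<forall>n\<ge>N. vop V u n v = 0"
begin

text \<open>\<open>U v p q\<close> is the residue of \<open>y\<^sup>p (y + z)\<^sup>q Y(v,y)\<close>, with \<open>(y + z)\<^sup>q\<close> expanded at \<open>y = 0\<close>.\<close>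

definition U :: "'v \<Rightarrow> int \<Rightarrow> int \<Rightarrow> 'w \<Rightarrow> 'w" where
  "U v p q w = transl z (\<lambda>n. Y v n w) p q"

lemma truncation': "\<exists>N. \<forall>n\<ge>N. Y v n w = 0"
  using truncation by simp

lemma Y_0_right [simp]: "Y v n 0 = 0" using scale_right[of 0 v n 0] by simp
lemma Y_0_left [simp]: "Y 0 n w = 0" using scale_left[of w 0 0 n] by simp

lemma Y_finite: "finite {i. c i *\<^sub>C Y v (p + int i) w \<noteq> 0}"
  using truncation'[of v w] transl_finite[of _ "\<lambda>n. Y v n w"] by blast

lemma U_0 [simp]: "U v p 0 w = Y v p w" by (simp add: U_def)

lemma U_zero_right [simp]: "U v p q 0 = 0" by (simp add: U_def transl_def)
lemma U_zero_left [simp]: "U 0 p q w = 0" by (simp add: U_def transl_def)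

lemma U_add_right: "U v p q (w + w') = U v p q w + U v p q w'"
  unfolding U_def transl_def by (subst binom_sum_add[symmetric, OF Y_finite Y_finite]) (simp add: add_right scaleC_add_right)

lemma U_scale_right: "U v p q (c *\<^sub>C w) = c *\<^sub>C U v p q w"
  unfolding U_def transl_def by (subst binom_sum_scale[symmetric]) (simp add: scale_right scaleC_scaleC mult.commute)

lemma U_add_left: "U (u + v) p q w = U u p q w + U v p q w"
  unfolding U_def transl_def by (subst binom_sum_add[symmetric, OF Y_finite Y_finite]) (simp add: add_left scaleC_add_right)

lemma U_scale_left: "U (c *\<^sub>C v) p q w = c *\<^sub>C U v p q w"
  unfolding U_def transl_def by (subst binom_sum_scale[symmetric]) (simp add: scale_left scaleC_scaleC mult.commute)

lemma pascal_U: "pascal z (\<lambda>p q. U v p q w)"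
  using truncation'[of v w] pascal_transl[OF _ z, of _ "\<lambda>n. Y v n w"] unfolding U_def by blast

lemma U_truncation: "\<exists>N. \<forall>p\<ge>N. \<forall>q. U v p q w = 0"
  using truncation'[of v w] transl_vanish[of _ "\<lambda>n. Y v n w"] unfolding U_def by blast

lemma pascal_U_right: "pascal z F \<Longrightarrow> pascal z (\<lambda>m n. U v p q (F m n))"
  unfolding pascal_def by (simp add: U_add_right U_scale_right)

lemma antidiag_finite_UU: "antidiag_finite (\<lambda>m n. U u m q (U v n q' w))"
proof -
  obtain N where "\<And>n q. n \<ge> N \<Longrightarrow> U v n q w = 0" using U_truncation[of v w] by blast
  then show ?thesis by (intro antidiag_finite_right[of N]) auto
qed

text \<open>The difference \<open>E\<close> of the two sides obeys the Pascal rule in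
  \<open>p, q\<close> and in \<open>p', q'\<close>, and vanishes for large \<open>p\<close> and for
  large \<open>p'\<close>. On \<open>q = q' = 0\<close> it is the Jacobi identity of the module;
  \<open>pascal_unique_row\<close> extends this to all \<open>q\<close> and then to all
  \<open>q'\<close>.\<close>

theorem translated_jacobi:
  "diff_pow l (\<lambda>m n. U u m q (U v n q' w)) p p' - (-1) powi l *\<^sub>C diff_pow l (\<lambda>n m. U v n q' (U u m q w)) p' p
   = double_shift l (\<lambda>c d e. U (vop V u c v) d e w) p q p' q'"
proof -
  obtain N where N: "\<And>n. n \<ge> N \<Longrightarrow> vop V u n v = 0" using vop_truncation by blast
  then have N': "\<And>c d e. c \<ge> N \<Longrightarrow> U (vop V u c v) d e w = 0" by simp
  define E where "E p q p' q' = diff_pow l (\<lambda>m n. U u m q (U v n q' w)) p p'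
    - (-1) powi l *\<^sub>C diff_pow l (\<lambda>n m. U v n q' (U u m q w)) p' p
    - double_shift l (\<lambda>c d e. U (vop V u c v) d e w) p q p' q'" for p q p' q'
  have left: "pascal z (\<lambda>p q. E p q p' q')" for p' q'
    unfolding E_def
    by (intro pascal_diff pascal_scale pascal_diff_pow_1 pascal_diff_pow_2 pascal_U antidiag_finite_UU
        pascal_U_right pascal_double_shift_left[where N = N] N')
  have right: "pascal z (\<lambda>p' q'. E p q p' q')" for p q
    unfolding E_def
    by (intro pascal_diff pascal_scale pascal_diff_pow_1 pascal_diff_pow_2 pascal_U antidiag_finite_UU
        pascal_U_right pascal_double_shift_right[where N = N] N')
  \<comment> \<open>For the outer operator truncation is not uniform, but only finitely many vectors
    \<open>U v n q' w\<close> are nonzero in the sum. For the inner operator, treated in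
    \<open>top'\<close>, truncation on \<open>w\<close> suffices.\<close>
  have top: "\<exists>M. \<forall>p\<ge>M. diff_pow l (\<lambda>m n. U u m q (U v n q' w)) p p' = 0" for u v q q' p'
  proof -
    obtain N where "\<And>n q. n \<ge> N \<Longrightarrow> U v n q w = 0" using U_truncation[of v w] by blast
    then have "\<And>m n. n \<ge> N \<Longrightarrow> U u m q (U v n q' w) = 0" by simp
    then show ?thesis
    proof (rule diff_pow_top)
      show "\<exists>M. \<forall>m\<ge>M. U u m q (U v n q' w) = 0" for n
        using U_truncation[of u "U v n q' w"] by blast
    qed
  qed
  have top': "\<exists>M. \<forall>p\<ge>M. diff_pow l (\<lambda>m n. U u m q (U v n q' w)) p' p = 0" for u v q q' p'
  proof -
    obtain N where N: "\<And>n q. n \<ge> N \<Longrightarrow> U v n q w = 0" using U_truncation[of v w] by blast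
    show ?thesis by (intro exI[of _ N] allI impI diff_pow_vanish_right[of N]) (auto simp: N)
  qed
  obtain Z where Z: "\<And>p q p' q'. p + p' \<ge> Z \<Longrightarrow> double_shift l (\<lambda>c d e. U (vop V u c v) d e w) p q p' q' = 0"
    using double_shift_top[of N "\<lambda>c d e. U (vop V u c v) d e w", OF N'] U_truncation by blast
  have E_left: "\<exists>M. \<forall>p\<ge>M. E p q p' q' = 0" for q p' q'
  proof -
    obtain M1 M2 where "\<forall>p\<ge>M1. diff_pow l (\<lambda>m n. U u m q (U v n q' w)) p p' = 0"
      "\<forall>p\<ge>M2. diff_pow l (\<lambda>n m. U v n q' (U u m q w)) p' p = 0"
      using top[of u q v q' p'] top'[of v q' u q p'] by blast
    then have "\<forall>p\<ge>max (max M1 M2) (Z - p'). E p q p' q' = 0" by (simp add: E_def Z)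
    then show ?thesis by blast
  qed
  have E_right: "\<exists>M. \<forall>p'\<ge>M. E p q p' q' = 0" for p q q'
  proof -
    obtain M1 M2 where "\<forall>p'\<ge>M1. diff_pow l (\<lambda>m n. U u m q (U v n q' w)) p p' = 0"
      "\<forall>p'\<ge>M2. diff_pow l (\<lambda>n m. U v n q' (U u m q w)) p' p = 0"
      using top'[of u q v q' p] top[of v q' u q p] by blast
    then have "\<forall>p'\<ge>max (max M1 M2) (Z - p). E p q p' q' = 0" by (simp add: E_def Z)
    then show ?thesis by blast
  qed
  have 0: "E p 0 p' 0 = 0" for p p'
    using jacobi_diff_pow[of w l u v p p'] by (simp add: E_def double_shift_00)
  have "E p q p' 0 = 0" for p q p'
  proof -
    have "pascal z (\<lambda>p q. E p q p' 0)" by (rule left)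
    from pascal_unique_row[OF this z 0 E_left] show ?thesis .
  qed
  from pascal_unique_row[OF right z this E_right] have "E p q p' q' = 0" for p q p' q' .
  then show ?thesis by (simp add: E_def)
qed

lemma antidiag_finite_functional_right:
  assumes "\<And>m. clinear (b m)"
  shows "antidiag_finite (\<lambda>m n. (b m (U v n q' w) :: complex))"
proof -
  obtain N where "\<And>n q. n \<ge> N \<Longrightarrow> U v n q w = 0" using U_truncation[of v w] by blast
  moreover have "b m 0 = 0" for m using assms[of m] by (auto dest: linear_zero)
  ultimately show ?thesis by (intro antidiag_finite_right[of N]) auto
qed

text \<open>For a residue at infinity in \<open>y1\<close>, the factor
  \<open>(y1 - y2)^l = ((y1 + z) - (y2 + z))^l\<close> may be expanded in nonnegative powers of
  \<open>y2\<close> or of \<open>y2 + z\<close>. The first sum is finite by truncation on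
  \<open>w\<close>, the second because \<open>b\<close> vanishes near infinity.\<close>

lemma re_expand_inf:
  fixes b :: "int \<Rightarrow> int \<Rightarrow> 'w \<Rightarrow> complex"
  assumes lin: "\<And>p q. clinear (b p q)" and P: "pascal z b" and V: "vanishes_inf b"
  shows "diff_pow l (\<lambda>m n. b m q (U v n q' w)) p p' = diff_pow l (\<lambda>m n. b p m (U v p' n w)) q q'"
proof -
  have b: "b p q (x + y) = b p q x + b p q y" "b p q (c *\<^sub>C x) = c *\<^sub>C b p q x" for p q x y c
    using lin[of p q] by (auto simp: Vector_Spaces.linear_iff)
  obtain N where N: "\<And>p q. p + q \<le> N \<Longrightarrow> b p q = 0" using V by (auto simp: vanishes_inf_def)
  have Pb: "pascal z (\<lambda>p q. b p q x)" for x using P by (simp add: pascal_def plus_fun_def scaleC_fun_def)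
  have PU: "pascal z (\<lambda>p' q'. b p q (U v p' q' w))" for p q
    using pascal_U[of v w] by (simp add: pascal_def b)
  have af: "antidiag_finite (\<lambda>m n. b p m (U v p' n w))" for p p'
    by (rule antidiag_finite_left[of "N - p"]) (simp add: N)
  define S1 where "S1 l p q p' q' = diff_pow l (\<lambda>m n. b m q (U v n q' w)) p p'" for l p q p' q'
  define S2 where "S2 l p q p' q' = diff_pow l (\<lambda>m n. b p m (U v p' n w)) q q'" for l p q p' q'
  have 1: "S1 (l + 1) p q p' q' = S1 l (p + 1) q p' q' - S1 l p q (p' + 1) q'" for l p q p' q'
    unfolding S1_def by (rule diff_pow_Suc) (rule antidiag_finite_functional_right[OF lin])
  have 2: "S2 (l + 1) p q p' q' = S2 l p (q + 1) p' q' - S2 l p q p' (q' + 1)" for l p q p' q'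
    unfolding S2_def by (rule diff_pow_Suc[OF af])
  have 3: "S2 l p (q + 1) p' q' = S2 l (p + 1) q p' q' + z *\<^sub>C S2 l p q p' q'" for l p q p' q'
    using pascal_diff_pow_3[of z "\<lambda>p m n. b p m (U v p' n w)" l, OF Pb af]
    unfolding S2_def pascal_def by blast
  have 4: "S2 l p q p' (q' + 1) = S2 l p q (p' + 1) q' + z *\<^sub>C S2 l p q p' q'" for l p q p' q'
    using pascal_diff_pow_4[of z "\<lambda>p' n m. b p m (U v p' n w)" l, OF PU af]
    unfolding S2_def pascal_def by blast
  define D where "D l p q p' q' = S1 l p q p' q' - S2 l p q p' q'" for l p q p' q'
  \<comment> \<open>For \<open>S2\<close> the recursion lives in \<open>q, q'\<close>; the Pascal
    rules move it to \<open>p, p'\<close>, and the two terms with factor \<open>z\<close>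
    cancel.\<close>
  have rec: "D (l + 1) p q p' q' = D l (p + 1) q p' q' - D l p q (p' + 1) q'" for l p q p' q'
    unfolding D_def 1 2 3 4 by simp
  have D0: "D 0 p q p' q' = 0" for p q p' q' by (simp add: D_def S1_def S2_def)
  have "D l p q p' q' = 0"
  proof (rule difference_recursion_zero[where J = "\<lambda>l p p'. D l p q p' q'" and L = 0, OF rec D0])
    fix l
    \<comment> \<open>For this \<open>p\<close> every entry of \<open>b\<close> in either sum has
      index sum \<open>N - i\<close>, so all terms vanish.\<close>
    have "D l (N - q - l) q p' q' = 0" for p'
      unfolding D_def S1_def S2_def by (subst (1 2) diff_pow_vanish) (auto simp: N)
    then show "\<exists>M. (\<forall>p'. D l M q p' q' = 0) \<or> (\<forall>p. D l p q M q' = 0)" by blast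
  qed
  then show ?thesis by (simp add: D_def S1_def S2_def)
qed

text \<open>Near \<open>y1 = -z\<close> the small quantity is \<open>y1 + z\<close>, so
  \<open>(y1 - y2)^l\<close> has to be expanded as \<open>(-1)^l ((y2 + z) - (y1 + z))^l\<close> in
  nonnegative powers of \<open>y1 + z\<close>; the slots of \<open>diff_pow\<close> are exchanged
  accordingly. The comparison follows \<open>re_expand_inf\<close>, but the column
  \<open>p' = T\<close> is the one that vanishes on both sides.\<close>

lemma re_expand_z:
  fixes b :: "int \<Rightarrow> int \<Rightarrow> 'w \<Rightarrow> complex"
  assumes lin: "\<And>p q. clinear (b p q)" and P: "pascal z b" and V: "vanishes_z b"
  shows "diff_pow l (\<lambda>m n. b m q (U v n q' w)) p p' = (-1) powi l *\<^sub>C diff_pow l (\<lambda>n m. b p m (U v p' n w)) q' q"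
proof -
  have b: "b p q (x + y) = b p q x + b p q y" "b p q (c *\<^sub>C x) = c *\<^sub>C b p q x" for p q x y c
    using lin[of p q] by (auto simp: Vector_Spaces.linear_iff)
  have b0: "b p q 0 = 0" for p q using b(2)[of p q 0 0] by simp
  obtain N where N: "\<And>p q. q \<ge> N \<Longrightarrow> b p q = 0" using V by (auto simp: vanishes_z_def)
  have Pb: "pascal z (\<lambda>p q. b p q x)" for x using P by (simp add: pascal_def plus_fun_def scaleC_fun_def)
  have PU: "pascal z (\<lambda>p' q'. b p q (U v p' q' w))" for p q
    using pascal_U[of v w] by (simp add: pascal_def b)
  have af: "antidiag_finite (\<lambda>n m. b p m (U v p' n w))" for p p'
    by (rule antidiag_finite_right[of "N"]) (simp add: N)
  obtain T where T: "\<And>p q. p \<ge> T \<Longrightarrow> U v p q w = 0" using U_truncation[of v w] by blast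
  define S1 where "S1 l p q p' q' = diff_pow l (\<lambda>m n. b m q (U v n q' w)) p p'" for l p q p' q'
  define S2 where "S2 l p q p' q' = (-1) powi l *\<^sub>C diff_pow l (\<lambda>n m. b p m (U v p' n w)) q' q" for l p q p' q'
  have 1: "S1 (l + 1) p q p' q' = S1 l (p + 1) q p' q' - S1 l p q (p' + 1) q'" for l p q p' q'
    unfolding S1_def by (rule diff_pow_Suc) (rule antidiag_finite_functional_right[OF lin])
  have 2: "S2 (l + 1) p q p' q' = S2 l p (q + 1) p' q' - S2 l p q p' (q' + 1)" for l p q p' q'
    unfolding S2_def by (subst diff_pow_Suc[OF af])
      (simp add: power_int_add_1 complex_vector.scale_right_diff_distrib)
  have 3: "S2 l p (q + 1) p' q' = S2 l (p + 1) q p' q' + z *\<^sub>C S2 l p q p' q'" for l p q p' q'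
    using pascal_scale[OF pascal_diff_pow_4[of z "\<lambda>p m n. b p m (U v p' n w)" l, OF Pb af]]
    unfolding S2_def pascal_def by blast
  have 4: "S2 l p q p' (q' + 1) = S2 l p q (p' + 1) q' + z *\<^sub>C S2 l p q p' q'" for l p q p' q'
    using pascal_scale[OF pascal_diff_pow_3[of z "\<lambda>p' n m. b p m (U v p' n w)" l, OF PU af]]
    unfolding S2_def pascal_def by blast
  define D where "D l p q p' q' = S1 l p q p' q' - S2 l p q p' q'" for l p q p' q'
  have rec: "D (l + 1) p q p' q' = D l (p + 1) q p' q' - D l p q (p' + 1) q'" for l p q p' q'
    unfolding D_def 1 2 3 4 by simp
  have D0: "D 0 p q p' q' = 0" for p q p' q' by (simp add: D_def S1_def S2_def scaleC_one)
  have "D l p q p' q' = 0"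
  proof (rule difference_recursion_zero[where J = "\<lambda>l p p'. D l p q p' q'" and L = 0, OF rec D0])
    fix l
    have "D l p q T q' = 0" for p
      unfolding D_def S1_def S2_def by (subst (1 2) diff_pow_vanish) (auto simp: T b0)
    then show "\<exists>M. (\<forall>p'. D l M q p' q' = 0) \<or> (\<forall>p. D l p q M q' = 0)" by blast
  qed
  then show ?thesis by (simp add: D_def S1_def S2_def)
qed

end

lemma scaleC_apply: "(c *\<^sub>C f) x = c *\<^sub>C f x"
  by (simp add: scaleC_fun_def)

lemma diff_pow_apply: "antidiag_finite F \<Longrightarrow> diff_pow l F m n w = diff_pow l (\<lambda>m n. F m n w) m n"
  using diff_pow_additive[of F "\<lambda>f. f w" l m n] by (simp add: scaleC_fun_def)

lemma shift_pow_apply: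
  assumes "\<And>c d. c \<ge> N \<Longrightarrow> F c d = 0"
  shows "shift_pow l F m n w = shift_pow l (\<lambda>c d. F c d w) m n"
  unfolding shift_pow_def
  by (rule binom_sum_apply, rule finite_support_natI[of "nat (N - l)"]) (auto intro!: assms)

text \<open>\<open>G\<close> is the array applied first, \<open>H\<close> the one applied to its
  entries. Vanishing of \<open>G\<close> gives the condition in \<open>p, q\<close>; for fixed
  \<open>p, q\<close> it also bounds the number of terms, so that \<open>vanishes_binom_sum\<close>
  passes the condition on \<open>H\<close> to \<open>p', q'\<close>.\<close>

lemma diff_pow_compose_vanishes:
  fixes G :: "int \<Rightarrow> int \<Rightarrow> 'a::zero" and H :: "int \<Rightarrow> int \<Rightarrow> 'a \<Rightarrow> 'b::complex_vector"
  assumes H0: "\<And>p n. H p n 0 = 0"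
  shows "vanishes_inf G \<Longrightarrow> vanishes_inf (\<lambda>p q. diff_pow l (\<lambda>m n. H p' n (G p m)) q q')"
    and "vanishes_z G \<Longrightarrow> vanishes_z (\<lambda>p q. diff_pow l (\<lambda>n m. H p' n (G p m)) q' q)"
    and "vanishes_inf G \<Longrightarrow> (\<And>p m. vanishes_inf (\<lambda>p' n. H p' n (G p m))) \<Longrightarrow>
      vanishes_inf (\<lambda>p' q'. diff_pow l (\<lambda>m n. H p' n (G p m)) q q')"
    and "vanishes_inf G \<Longrightarrow> (\<And>p m. vanishes_z (\<lambda>p' n. H p' n (G p m))) \<Longrightarrow>
      vanishes_z (\<lambda>p' q'. diff_pow l (\<lambda>m n. H p' n (G p m)) q q')"
    and "vanishes_z G \<Longrightarrow> (\<And>p m. vanishes_inf (\<lambda>p' n. H p' n (G p m))) \<Longrightarrow>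
      vanishes_inf (\<lambda>p' q'. diff_pow l (\<lambda>n m. H p' n (G p m)) q' q)"
    and "vanishes_z G \<Longrightarrow> (\<And>p m. vanishes_z (\<lambda>p' n. H p' n (G p m))) \<Longrightarrow>
      vanishes_z (\<lambda>p' q'. diff_pow l (\<lambda>n m. H p' n (G p m)) q' q)"
proof -
  { assume "vanishes_inf G"
    then obtain N where N: "\<And>p q. p + q \<le> N \<Longrightarrow> G p q = 0" by (auto simp: vanishes_inf_def)
    have "diff_pow l (\<lambda>m n. H p' n (G p m)) q q' = 0" if "p + q \<le> N - l" for p q
      by (rule diff_pow_vanish, subst N) (use that in \<open>auto simp: H0\<close>)
    then show "vanishes_inf (\<lambda>p q. diff_pow l (\<lambda>m n. H p' n (G p m)) q q')"
      unfolding vanishes_inf_def by blast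
    have K: "(-1) ^ i *\<^sub>C H p' (q' + int i) (G p (q + l - int i)) = 0" if "i \<ge> nat (p + q + l - N)" for i p' q'
      by (subst N) (use that in \<open>auto simp: H0\<close>)
    note sum = vanishes_binom_sum[where K = "nat (p + q + l - N)", OF K]
    show "vanishes_inf (\<lambda>p' q'. diff_pow l (\<lambda>m n. H p' n (G p m)) q q')" if V: "\<And>p m. vanishes_inf (\<lambda>p' n. H p' n (G p m))"
      unfolding diff_pow_def
      by (rule sum(1)) (assumption, rule vanishes_inf_scale, use vanishes_shift(1)[OF V, of 0] in simp)
    show "vanishes_z (\<lambda>p' q'. diff_pow l (\<lambda>m n. H p' n (G p m)) q q')" if V: "\<And>p m. vanishes_z (\<lambda>p' n. H p' n (G p m))"
      unfolding diff_pow_def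
      by (rule sum(2)) (assumption, rule vanishes_z_scale, use vanishes_shift(2)[OF V, of 0] in simp) }
  { assume "vanishes_z G"
    then obtain N where N: "\<And>p q. q \<ge> N \<Longrightarrow> G p q = 0" by (auto simp: vanishes_z_def)
    have "diff_pow l (\<lambda>n m. H p' n (G p m)) q' q = 0" if "q \<ge> N" for p q
      by (rule diff_pow_vanish, subst N) (use that in \<open>auto simp: H0\<close>)
    then show "vanishes_z (\<lambda>p q. diff_pow l (\<lambda>n m. H p' n (G p m)) q' q)"
      unfolding vanishes_z_def by blast
    have K: "(-1) ^ i *\<^sub>C H p' (q' + l - int i) (G p (q + int i)) = 0" if "i \<ge> nat (N - q)" for i p' q'
      by (subst N) (use that in \<open>auto simp: H0\<close>)
    note sum = vanishes_binom_sum[where K = "nat (N - q)", OF K]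
    have shift: "q' + l - int i = q' + (l - int i)" for q' i by simp
    show "vanishes_inf (\<lambda>p' q'. diff_pow l (\<lambda>n m. H p' n (G p m)) q' q)" if V: "\<And>p m. vanishes_inf (\<lambda>p' n. H p' n (G p m))"
      unfolding diff_pow_def
      by (rule sum(1)) (assumption, unfold shift, rule vanishes_inf_scale, use vanishes_shift(1)[OF V, of 0] in simp)
    show "vanishes_z (\<lambda>p' q'. diff_pow l (\<lambda>n m. H p' n (G p m)) q' q)" if V: "\<And>p m. vanishes_z (\<lambda>p' n. H p' n (G p m))"
      unfolding diff_pow_def
      by (rule sum(2)) (assumption, unfold shift, rule vanishes_z_scale, use vanishes_shift(2)[OF V, of 0] in simp) }
qed

text \<open>\<open>L v p q \<alpha>\<close> and \<open>R v p q \<alpha>\<close> are minus the residue at infinity, resp. the residue at \<open>-z\<close>, of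
  \<open>y\<^sup>p (y + z)\<^sup>q \<langle>\<alpha>, Y(v,y)w\<rangle>\<close>. The rows \<open>p = 0\<close> are the modes in the variable \<open>x = y + z\<close>.\<close>

locale functional_decomposition = module_translation V Y z
  for V :: "'v::complex_vector voa" and Y :: "'v \<Rightarrow> int \<Rightarrow> 'w::complex_vector \<Rightarrow> 'w" and z +
  fixes D :: "('w \<Rightarrow> complex) set"
    and L R :: "'v \<Rightarrow> int \<Rightarrow> int \<Rightarrow> ('w \<Rightarrow> complex) \<Rightarrow> 'w \<Rightarrow> complex"
  assumes D_iff: "\<alpha> \<in> D \<longleftrightarrow> clinear \<alpha> \<and> (\<forall>v. \<exists>N. \<forall>p q w. q \<ge> N \<longrightarrow> p + q \<le> - N \<longrightarrow> \<alpha> (U v p q w) = 0)"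
    and decomp: "\<alpha> \<in> D \<Longrightarrow> \<alpha> (U v p q w) = L v p q \<alpha> w - R v p q \<alpha> w"
    and pascal_L: "\<alpha> \<in> D \<Longrightarrow> pascal z (\<lambda>p q. L v p q \<alpha>)"
    and pascal_R: "\<alpha> \<in> D \<Longrightarrow> pascal z (\<lambda>p q. R v p q \<alpha>)"
    and vanishes_L: "\<alpha> \<in> D \<Longrightarrow> vanishes_inf (\<lambda>p q. L v p q \<alpha>)"
    and vanishes_R: "\<alpha> \<in> D \<Longrightarrow> vanishes_z (\<lambda>p q. R v p q \<alpha>)"
begin

lemma D_clinear: "\<alpha> \<in> D \<Longrightarrow> clinear \<alpha>" by (simp add: D_iff)

lemma D_linear:
  assumes "\<alpha> \<in> D"
  shows "\<alpha> (x + y) = \<alpha> x + \<alpha> y" "\<alpha> (c *\<^sub>C x) = c *\<^sub>C \<alpha> x" "\<alpha> 0 = 0" "\<alpha> (x - y) = \<alpha> x - \<alpha> y"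
proof -
  show add: "\<alpha> (x + y) = \<alpha> x + \<alpha> y" and sc: "\<alpha> (c *\<^sub>C x) = c *\<^sub>C \<alpha> x" for x y c
    using D_clinear[OF assms] by (auto simp: Vector_Spaces.linear_iff)
  show "\<alpha> 0 = 0" by (rule linear_zero[OF D_clinear[OF assms]])
  show "\<alpha> (x - y) = \<alpha> x - \<alpha> y" using add[of "x - y" y] by simp
qed

lemma subspace_D: "complex_vector.subspace D"
  unfolding complex_vector.subspace_def
proof (intro conjI ballI allI)
  show "0 \<in> D" by (simp add: D_iff Vector_Spaces.linear_iff complex_vector.vector_space_axioms)
next
  fix \<alpha> \<beta> assume a: "\<alpha> \<in> D" and b: "\<beta> \<in> D"
  show "\<alpha> + \<beta> \<in> D" unfolding D_iff
  proof (intro conjI allI)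
    show "clinear (\<alpha> + \<beta>)" unfolding Vector_Spaces.linear_iff
      by (simp add: complex_vector.vector_space_axioms D_linear[OF a] D_linear[OF b] scaleC_add_right)
    fix v
    obtain N where N: "\<And>p q w. q \<ge> N \<Longrightarrow> p + q \<le> - N \<Longrightarrow> \<alpha> (U v p q w) = 0" using a unfolding D_iff by blast
    obtain M where M: "\<And>p q w. q \<ge> M \<Longrightarrow> p + q \<le> - M \<Longrightarrow> \<beta> (U v p q w) = 0" using b unfolding D_iff by blast
    show "\<exists>N. \<forall>p q w. q \<ge> N \<longrightarrow> p + q \<le> - N \<longrightarrow> (\<alpha> + \<beta>) (U v p q w) = 0"
      by (intro exI[of _ "max N M"]) (simp add: N M)
  qed
next
  fix c \<alpha> assume a: "\<alpha> \<in> D"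
  show "c *\<^sub>C \<alpha> \<in> D" unfolding D_iff
  proof (intro conjI allI)
    show "clinear (c *\<^sub>C \<alpha>)" unfolding Vector_Spaces.linear_iff
      by (simp add: complex_vector.vector_space_axioms D_linear[OF a] scaleC_fun_def scaleC_add_right scaleC_scaleC mult.commute)
    fix v
    obtain N where N: "\<And>p q w. q \<ge> N \<Longrightarrow> p + q \<le> - N \<Longrightarrow> \<alpha> (U v p q w) = 0" using a unfolding D_iff by blast
    show "\<exists>N. \<forall>p q w. q \<ge> N \<longrightarrow> p + q \<le> - N \<longrightarrow> (c *\<^sub>C \<alpha>) (U v p q w) = 0"
      by (intro exI[of _ N]) (simp add: N scaleC_fun_def)
  qed
qed

lemmas D_add = complex_vector.subspace_add[OF subspace_D]
  and D_scale = complex_vector.subspace_scale[OF subspace_D]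
  and D_diff = complex_vector.subspace_diff[OF subspace_D]
  and D_zero = complex_vector.subspace_0[OF subspace_D]

text \<open>By \<open>translated_jacobi\<close> with \<open>l = 0\<close>, exchanging the two
  operators costs a \<open>double_shift\<close> involving only finitely many vectors
  \<open>vop V v c u\<close>. The exchanged product and each of these terms vanish under
  \<open>\<alpha>\<close> for large \<open>q'\<close> and small \<open>p' + q'\<close>.\<close>

lemma D_U:
  assumes a: "\<alpha> \<in> D"
  shows "(\<lambda>w. \<alpha> (U v p q w)) \<in> D"
  unfolding D_iff
proof (intro conjI allI)
  show "clinear (\<lambda>w. \<alpha> (U v p q w))" unfolding Vector_Spaces.linear_iff
    by (simp add: complex_vector.vector_space_axioms D_linear[OF a] U_add_right U_scale_right)
  fix u
  obtain K where K: "\<And>c. c \<ge> K \<Longrightarrow> vop V v c u = 0" using vop_truncation by blast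
  obtain N where N: "\<And>p q w. q \<ge> N \<Longrightarrow> p + q \<le> - N \<Longrightarrow> \<alpha> (U u p q w) = 0" using a unfolding D_iff by blast
  \<comment> \<open>The condition only gets weaker as \<open>m\<close> grows, so it can be stated
    for all \<open>m \<ge> M\<close>; this is the shape that \<open>finite_choice_ge\<close>
    combines into one bound.\<close>
  have "\<exists>M. \<forall>m\<ge>M. \<forall>p q w. q \<ge> m \<longrightarrow> p + q \<le> - m \<longrightarrow> \<alpha> (U (vop V v (int i) u) p q w) = 0" for i
  proof -
    obtain M where "\<And>p q w. q \<ge> M \<Longrightarrow> p + q \<le> - M \<Longrightarrow> \<alpha> (U (vop V v (int i) u) p q w) = 0"
      using a unfolding D_iff by blast
    then show ?thesis by (intro exI[of _ M]) force
  qed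
  from finite_choice_ge[of "\<lambda>i m. \<forall>p q w. q \<ge> m \<longrightarrow> p + q \<le> - m \<longrightarrow> \<alpha> (U (vop V v (int i) u) p q w) = 0", OF this, of "nat K"]
  obtain M where M': "\<forall>i<nat K. \<forall>m\<ge>M. \<forall>p q w. q \<ge> m \<longrightarrow> p + q \<le> - m \<longrightarrow> \<alpha> (U (vop V v (int i) u) p q w) = 0" ..
  have M: "\<alpha> (U (vop V v (int i) u) p q w) = 0" if "i < nat K" "q \<ge> M" "p + q \<le> - M" for i p q w
    using M'[rule_format, OF that(1) order_refl that(2,3)] .
  \<comment> \<open>Large enough to survive adding \<open>p\<close> and \<open>q\<close> and
    subtracting \<open>i + j < nat K\<close>.\<close>
  let ?N = "\<bar>N\<bar> + \<bar>M\<bar> + \<bar>p\<bar> + \<bar>q\<bar> + \<bar>K\<bar>"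
  show "\<exists>N. \<forall>p' q' w. q' \<ge> N \<longrightarrow> p' + q' \<le> - N \<longrightarrow> \<alpha> (U v p q (U u p' q' w)) = 0"
  proof (intro exI[of _ ?N] allI impI)
    fix p' q' w assume q': "q' \<ge> ?N" and pq': "p' + q' \<le> - ?N"
    have "\<alpha> (U v p q (U u p' q' w)) - \<alpha> (U u p' q' (U v p q w))
      = \<alpha> (double_shift 0 (\<lambda>c d e. U (vop V v c u) d e w) p q p' q')"
      using translated_jacobi[of 0 v q u q' w p p'] by (simp add: D_linear[OF a] scaleC_one flip: D_linear(4)[OF a])
    also have "\<dots> = double_shift 0 (\<lambda>c d e. \<alpha> (U (vop V v c u) d e w)) p q p' q'"
      by (rule double_shift_additive[where N = K]) (auto simp: K D_linear[OF a])
    also have "\<dots> = 0"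
    proof (rule double_shift_vanish)
      fix i j
      show "\<alpha> (U (vop V v (0 + int i + int j) u) (p + p' - int i) (q + q' - int j) w) = 0"
      proof (cases "i + j < nat K")
        case True
        have "\<alpha> (U (vop V v (int (i + j)) u) (p + p' - int i) (q + q' - int j) w) = 0"
          by (rule M[OF True]) (use q' pq' True in auto)
        then show ?thesis by simp
      next
        case False
        then have "vop V v (0 + int i + int j) u = 0" by (intro K) auto
        then show ?thesis by (simp add: D_linear[OF a])
      qed
    qed
    also have "\<alpha> (U u p' q' (U v p q w)) = 0" by (rule N) (use q' pq' in linarith)+
    finally show "\<alpha> (U v p q (U u p' q' w)) = 0" by simp
  qed
qed

text \<open>Where \<open>L\<close> vanishes, \<open>R\<close> is minus the functional of
  \<open>D_U\<close>; where \<open>q\<close> is large, \<open>R\<close> is zero. These two regions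
  are the boundary data of \<open>pascal_in_subspace\<close>, which covers the remaining
  entries.\<close>

lemma R_in_D:
  assumes a: "\<alpha> \<in> D" shows "R v p q \<alpha> \<in> D"
proof -
  obtain N where N: "\<And>p q. p + q \<le> N \<Longrightarrow> L v p q \<alpha> = 0"
    using vanishes_L[OF a, of v] unfolding vanishes_inf_def by blast
  obtain M where M: "\<And>p q. q \<ge> M \<Longrightarrow> R v p q \<alpha> = 0"
    using vanishes_R[OF a, of v] unfolding vanishes_z_def by blast
  show ?thesis
  proof (rule pascal_in_subspace[OF pascal_R[OF a] subspace_D])
    show "R v p q \<alpha> \<in> D" if "q \<ge> M" for p q using M[OF that] D_zero by simp
    show "R v p q \<alpha> \<in> D" if "p + q \<le> N" for p q
    proof -
      have "R v p q \<alpha> = 0 - (\<lambda>w. \<alpha> (U v p q w))"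
        using decomp[OF a, of v p q] N[OF that] by (auto simp: fun_eq_iff)
      then show ?thesis using D_diff[OF D_zero D_U[OF a]] by simp
    qed
  qed
qed

lemma L_in_D:
  assumes a: "\<alpha> \<in> D" shows "L v p q \<alpha> \<in> D"
proof -
  have "L v p q \<alpha> = (\<lambda>w. \<alpha> (U v p q w)) + R v p q \<alpha>"
    using decomp[OF a, of v p q] by (auto simp: fun_eq_iff)
  then show ?thesis using D_add[OF D_U[OF a] R_in_D[OF a]] by simp
qed

text \<open>\<open>L - F\<close> equals \<open>R - G\<close>, so it vanishes near infinity and near
  \<open>-z\<close>. Linearity of \<open>L\<close> and \<open>R\<close> in all arguments follows by
  exhibiting the expected decomposition.\<close>

lemma decomp_unique:
  assumes a: "\<alpha> \<in> D" and d: "\<And>p q w. \<alpha> (U v p q w) = F p q w - G p q w"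
    and "pascal z F" "pascal z G" "vanishes_inf F" "vanishes_z G"
  shows "L v p q \<alpha> = F p q" "R v p q \<alpha> = G p q"
proof -
  have eq: "L v p q \<alpha> - F p q = R v p q \<alpha> - G p q" for p q
    using decomp[OF a, of v p q] d[of p q] by (auto simp: fun_eq_iff algebra_simps)
  have "L v p q \<alpha> - F p q = 0" for p q
  proof (rule pascal_unique)
    show "pascal z (\<lambda>p q. L v p q \<alpha> - F p q)" by (intro pascal_diff pascal_L a assms)
    show "vanishes_inf (\<lambda>p q. L v p q \<alpha> - F p q)" by (intro vanishes_inf_diff vanishes_L a assms)
    show "vanishes_z (\<lambda>p q. L v p q \<alpha> - F p q)" unfolding eq by (intro vanishes_z_diff vanishes_R a assms)
  qed
  then show "L v p q \<alpha> = F p q" "R v p q \<alpha> = G p q" using eq[of p q] by auto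
qed

lemma LR_add:
  assumes a: "\<alpha> \<in> D" and b: "\<beta> \<in> D"
  shows "L v p q (\<alpha> + \<beta>) = L v p q \<alpha> + L v p q \<beta>" "R v p q (\<alpha> + \<beta>) = R v p q \<alpha> + R v p q \<beta>"
  by (rule decomp_unique[OF D_add[OF a b], where F = "\<lambda>p q. L v p q \<alpha> + L v p q \<beta>" and G = "\<lambda>p q. R v p q \<alpha> + R v p q \<beta>"];
      (intro pascal_add vanishes_inf_add vanishes_z_add pascal_L pascal_R vanishes_L vanishes_R a b)?;
      simp add: decomp[OF a] decomp[OF b])+

lemma LR_scale:
  assumes a: "\<alpha> \<in> D"
  shows "L v p q (c *\<^sub>C \<alpha>) = c *\<^sub>C L v p q \<alpha>" "R v p q (c *\<^sub>C \<alpha>) = c *\<^sub>C R v p q \<alpha>"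
  by (rule decomp_unique[OF D_scale[OF a], where F = "\<lambda>p q. c *\<^sub>C L v p q \<alpha>" and G = "\<lambda>p q. c *\<^sub>C R v p q \<alpha>"];
      (intro pascal_scale vanishes_inf_scale vanishes_z_scale pascal_L pascal_R vanishes_L vanishes_R a)?;
      simp add: decomp[OF a] scaleC_fun_def complex_vector.scale_right_diff_distrib)+

lemma LR_add_left:
  assumes a: "\<alpha> \<in> D"
  shows "L (u + v) p q \<alpha> = L u p q \<alpha> + L v p q \<alpha>" "R (u + v) p q \<alpha> = R u p q \<alpha> + R v p q \<alpha>"
  by (rule decomp_unique[OF a, where F = "\<lambda>p q. L u p q \<alpha> + L v p q \<alpha>" and G = "\<lambda>p q. R u p q \<alpha> + R v p q \<alpha>"];
      (intro pascal_add vanishes_inf_add vanishes_z_add pascal_L pascal_R vanishes_L vanishes_R a)?;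
      simp add: decomp[OF a] U_add_left D_linear[OF a])+

lemma LR_scale_left:
  assumes a: "\<alpha> \<in> D"
  shows "L (c *\<^sub>C v) p q \<alpha> = c *\<^sub>C L v p q \<alpha>" "R (c *\<^sub>C v) p q \<alpha> = c *\<^sub>C R v p q \<alpha>"
  by (rule decomp_unique[OF a, where F = "\<lambda>p q. c *\<^sub>C L v p q \<alpha>" and G = "\<lambda>p q. c *\<^sub>C R v p q \<alpha>"];
      (intro pascal_scale vanishes_inf_scale vanishes_z_scale pascal_L pascal_R vanishes_L vanishes_R a)?;
      simp add: decomp[OF a] U_scale_left D_linear(2)[OF a] scaleC_fun_def complex_vector.scale_right_diff_distrib)+

lemma LR_0 [simp]: "L v p q 0 = 0" "R v p q 0 = 0"
  using LR_scale[OF D_zero, of v p q 0] by simp_all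

lemma LR_0_left:
  assumes "\<alpha> \<in> D"
  shows "L 0 p q \<alpha> = 0" "R 0 p q \<alpha> = 0"
  using LR_scale_left[OF assms, of 0 0 p q] by simp_all

lemma pascal_LR_apply:
  assumes "pascal z F" "\<And>p q. F p q \<in> D"
  shows "pascal z (\<lambda>p q. L v p' q' (F p q) w)" "pascal z (\<lambda>p q. R v p' q' (F p q) w)"
  using assms by (simp_all add: pascal_def LR_add D_scale LR_scale scaleC_apply)

lemma pascal_at: "pascal z F \<Longrightarrow> pascal z (\<lambda>p q. F p q w)"
  by (simp add: pascal_def scaleC_fun_def)

lemma vanishes_inf_at: "vanishes_inf F \<Longrightarrow> vanishes_inf (\<lambda>p q. F p q w)"
  unfolding vanishes_inf_def by (metis zero_fun_def)

lemma vanishes_z_at: "vanishes_z F \<Longrightarrow> vanishes_z (\<lambda>p q. F p q w)"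
  unfolding vanishes_z_def by (metis zero_fun_def)

lemma LR_at:
  assumes "\<alpha> \<in> D"
  shows "pascal z (\<lambda>p q. L v p q \<alpha> w)" "pascal z (\<lambda>p q. R v p q \<alpha> w)"
    "vanishes_inf (\<lambda>p q. L v p q \<alpha> w)" "vanishes_z (\<lambda>p q. R v p q \<alpha> w)"
  using assms by (auto intro: pascal_at pascal_L pascal_R vanishes_inf_at vanishes_z_at vanishes_L vanishes_R)

lemma antidiag_finite_compose:
  assumes "\<And>p n. H p n 0 = 0"
  shows "vanishes_inf G \<Longrightarrow> antidiag_finite (\<lambda>m n. H p' n (G p m))"
    "vanishes_z G \<Longrightarrow> antidiag_finite (\<lambda>n m. H p' n (G p m))"
proof -
  assume "vanishes_inf G"
  then obtain N where "\<And>p q. p + q \<le> N \<Longrightarrow> G p q = 0" by (auto simp: vanishes_inf_def)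
  then show "antidiag_finite (\<lambda>m n. H p' n (G p m))"
    by (intro antidiag_finite_left[of "N - p"]) (simp add: assms)
next
  assume "vanishes_z G"
  then obtain N where "\<And>p q. q \<ge> N \<Longrightarrow> G p q = 0" by (auto simp: vanishes_z_def)
  then show "antidiag_finite (\<lambda>n m. H p' n (G p m))"
    by (intro antidiag_finite_right[of "N"]) (simp add: assms)
qed

context
  fixes \<alpha> :: "'w \<Rightarrow> complex" and w :: 'w and l :: int
  assumes a: "\<alpha> \<in> D"
begin

text \<open>The four parts of \<open>\<alpha>(U u .. (U v .. w))\<close> tested against
  \<open>(y1 - y2)^l\<close>. The outer operator \<open>u\<close> meets \<open>\<alpha>\<close>
  first. The residue in \<open>y1\<close> is taken at infinity in \<open>A1\<close>,
  \<open>A2\<close> and at \<open>-z\<close> in \<open>A3\<close>, \<open>A4\<close>; the residue in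
  \<open>y2\<close> at infinity in \<open>A1\<close>, \<open>A3\<close> and at \<open>-z\<close> in
  \<open>A2\<close>, \<open>A4\<close>.\<close>

definition "A1 u v p q p' q' = diff_pow l (\<lambda>m n. L v p' n (L u p m \<alpha>) w) q q'"
definition "A2 u v p q p' q' = diff_pow l (\<lambda>m n. R v p' n (L u p m \<alpha>) w) q q'"
definition "A3 u v p q p' q' = diff_pow l (\<lambda>n m. L v p' n (R u p m \<alpha>) w) q' q"
definition "A4 u v p q p' q' = diff_pow l (\<lambda>n m. R v p' n (R u p m \<alpha>) w) q' q"

lemmas A_antidiag =
  antidiag_finite_compose(1)[OF _ vanishes_L[OF a], where H = "\<lambda>p n b. L v p n b w" for v]
  antidiag_finite_compose(1)[OF _ vanishes_L[OF a], where H = "\<lambda>p n b. R v p n b w" for v]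
  antidiag_finite_compose(2)[OF _ vanishes_R[OF a], where H = "\<lambda>p n b. L v p n b w" for v]
  antidiag_finite_compose(2)[OF _ vanishes_R[OF a], where H = "\<lambda>p n b. R v p n b w" for v]

text \<open>The re-expansion must come between the two decompositions: \<open>U v n q' w\<close>
  vanishes for large \<open>n\<close>, but \<open>L v n q'\<close> and \<open>R v n q'\<close> need
  not. After re-expansion, finiteness rests on \<open>L u p m\<close> or \<open>R u p m\<close>
  alone, and \<open>decomp\<close> can be applied to \<open>v\<close>.\<close>

lemma A_sum:
  "diff_pow l (\<lambda>m n. \<alpha> (U u m q (U v n q' w))) p p' =
    A1 u v p q p' q' - A2 u v p q p' q' - (-1) powi l *\<^sub>C (A3 u v p q p' q' - A4 u v p q p' q')"
proof -
  have "diff_pow l (\<lambda>m n. \<alpha> (U u m q (U v n q' w))) p p' =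
    diff_pow l (\<lambda>m n. L u m q \<alpha> (U v n q' w)) p p' - diff_pow l (\<lambda>m n. R u m q \<alpha> (U v n q' w)) p p'"
    unfolding decomp[OF a]
    by (intro diff_pow_diff antidiag_finite_functional_right D_clinear L_in_D R_in_D a)
  also have "diff_pow l (\<lambda>m n. L u m q \<alpha> (U v n q' w)) p p' = diff_pow l (\<lambda>m n. L u p m \<alpha> (U v p' n w)) q q'"
    by (intro re_expand_inf[where b = "\<lambda>p q. L u p q \<alpha>"] D_clinear L_in_D a pascal_L vanishes_L)
  also have "diff_pow l (\<lambda>m n. R u m q \<alpha> (U v n q' w)) p p' = (-1) powi l *\<^sub>C diff_pow l (\<lambda>n m. R u p m \<alpha> (U v p' n w)) q' q"
    by (intro re_expand_z[where b = "\<lambda>p q. R u p q \<alpha>"] D_clinear R_in_D a pascal_R vanishes_R)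
  also have "diff_pow l (\<lambda>m n. L u p m \<alpha> (U v p' n w)) q q' = A1 u v p q p' q' - A2 u v p q p' q'"
    unfolding A1_def A2_def decomp[OF L_in_D[OF a]]
    by (intro diff_pow_diff A_antidiag) auto
  also have "diff_pow l (\<lambda>n m. R u p m \<alpha> (U v p' n w)) q' q = A3 u v p q p' q' - A4 u v p q p' q'"
    unfolding A3_def A4_def decomp[OF R_in_D[OF a]]
    by (intro diff_pow_diff A_antidiag) auto
  finally show ?thesis .
qed

lemma A_pascal:
  "pascal z (\<lambda>p q. A1 u v p q p' q')" "pascal z (\<lambda>p' q'. A1 u v p q p' q')"
  "pascal z (\<lambda>p q. A2 u v p q p' q')" "pascal z (\<lambda>p' q'. A2 u v p q p' q')"
  "pascal z (\<lambda>p q. A3 u v p q p' q')" "pascal z (\<lambda>p' q'. A3 u v p q p' q')"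
  "pascal z (\<lambda>p q. A4 u v p q p' q')" "pascal z (\<lambda>p' q'. A4 u v p q p' q')"
proof -
  show "pascal z (\<lambda>p q. A1 u v p q p' q')" unfolding A1_def
    by (rule pascal_diff_pow_3) (intro pascal_LR_apply pascal_L L_in_D a A_antidiag; simp)+
  show "pascal z (\<lambda>p q. A2 u v p q p' q')" unfolding A2_def
    by (rule pascal_diff_pow_3) (intro pascal_LR_apply pascal_L L_in_D a A_antidiag; simp)+
  show "pascal z (\<lambda>p q. A3 u v p q p' q')" unfolding A3_def
    by (rule pascal_diff_pow_4) (intro pascal_LR_apply pascal_R R_in_D a A_antidiag; simp)+
  show "pascal z (\<lambda>p q. A4 u v p q p' q')" unfolding A4_def
    by (rule pascal_diff_pow_4) (intro pascal_LR_apply pascal_R R_in_D a A_antidiag; simp)+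
  show "pascal z (\<lambda>p' q'. A1 u v p q p' q')" unfolding A1_def
    by (rule pascal_diff_pow_4) (intro LR_at L_in_D a A_antidiag; simp)+
  show "pascal z (\<lambda>p' q'. A2 u v p q p' q')" unfolding A2_def
    by (rule pascal_diff_pow_4) (intro LR_at L_in_D a A_antidiag; simp)+
  show "pascal z (\<lambda>p' q'. A3 u v p q p' q')" unfolding A3_def
    by (rule pascal_diff_pow_3) (intro LR_at R_in_D a A_antidiag; simp)+
  show "pascal z (\<lambda>p' q'. A4 u v p q p' q')" unfolding A4_def
    by (rule pascal_diff_pow_3) (intro LR_at R_in_D a A_antidiag; simp)+
qed

lemma A_vanishes:
  "vanishes_inf (\<lambda>p q. A1 u v p q p' q')" "vanishes_inf (\<lambda>p' q'. A1 u v p q p' q')"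
  "vanishes_inf (\<lambda>p q. A2 u v p q p' q')" "vanishes_z (\<lambda>p' q'. A2 u v p q p' q')"
  "vanishes_z (\<lambda>p q. A3 u v p q p' q')" "vanishes_inf (\<lambda>p' q'. A3 u v p q p' q')"
  "vanishes_z (\<lambda>p q. A4 u v p q p' q')" "vanishes_z (\<lambda>p' q'. A4 u v p q p' q')"
proof -
  note C = diff_pow_compose_vanishes
  show "vanishes_inf (\<lambda>p q. A1 u v p q p' q')" unfolding A1_def
    by (rule C(1)[where H = "\<lambda>p n b. L v p n b w"]) (simp_all add: vanishes_L a)
  show "vanishes_inf (\<lambda>p q. A2 u v p q p' q')" unfolding A2_def
    by (rule C(1)[where H = "\<lambda>p n b. R v p n b w"]) (simp_all add: vanishes_L a)
  show "vanishes_z (\<lambda>p q. A3 u v p q p' q')" unfolding A3_def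
    by (rule C(2)[where H = "\<lambda>p n b. L v p n b w"]) (simp_all add: vanishes_R a)
  show "vanishes_z (\<lambda>p q. A4 u v p q p' q')" unfolding A4_def
    by (rule C(2)[where H = "\<lambda>p n b. R v p n b w"]) (simp_all add: vanishes_R a)
  show "vanishes_inf (\<lambda>p' q'. A1 u v p q p' q')" unfolding A1_def
    by (rule C(3)[where H = "\<lambda>p n b. L v p n b w"]) (simp_all add: vanishes_L LR_at a L_in_D)
  show "vanishes_z (\<lambda>p' q'. A2 u v p q p' q')" unfolding A2_def
    by (rule C(4)[where H = "\<lambda>p n b. R v p n b w"]) (simp_all add: vanishes_L LR_at a L_in_D)
  show "vanishes_inf (\<lambda>p' q'. A3 u v p q p' q')" unfolding A3_def
    by (rule C(5)[where H = "\<lambda>p n b. L v p n b w"]) (simp_all add: vanishes_R LR_at a R_in_D)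
  show "vanishes_z (\<lambda>p' q'. A4 u v p q p' q')" unfolding A4_def
    by (rule C(6)[where H = "\<lambda>p n b. R v p n b w"]) (simp_all add: vanishes_R LR_at a R_in_D)
qed

text \<open>\<open>\<alpha>\<close> is applied to \<open>translated_jacobi\<close>, every term is
  decomposed, and the four types of vanishing are separated. In the first identity
  \<open>L u\<close> acts before \<open>L v\<close> in the leading term, hence the opposite form; in
  the third the expansion near \<open>-z\<close> has restored the usual order.\<close>

lemma decomposed_jacobi:
  shows "A1 u v p q p' q' - (-1) powi l *\<^sub>C A1 v u p' q' p q = double_shift l (\<lambda>c d e. L (vop V u c v) d e \<alpha> w) p q p' q'"
    and "A2 u v p q p' q' = A3 v u p' q' p q"
    and "A4 v u p' q' p q - (-1) powi l *\<^sub>C A4 u v p q p' q' = double_shift l (\<lambda>c d e. R (vop V u c v) d e \<alpha> w) p q p' q'"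
proof -
  define s :: complex where "s = (-1) powi l"
  have s: "s * s = 1" by (simp add: s_def power_int_minus_one_mult_self)
  obtain N where N: "\<And>c. c \<ge> N \<Longrightarrow> vop V u c v = 0" using vop_truncation by blast
  define ZL where "ZL = double_shift l (\<lambda>c d e. L (vop V u c v) d e \<alpha> w)"
  define ZR where "ZR = double_shift l (\<lambda>c d e. R (vop V u c v) d e \<alpha> w)"
  have NL: "\<And>c d e. c \<ge> N \<Longrightarrow> L (vop V u c v) d e \<alpha> w = 0" by (simp add: N LR_0_left[OF a])
  have NR: "\<And>c d e. c \<ge> N \<Longrightarrow> R (vop V u c v) d e \<alpha> w = 0" by (simp add: N LR_0_left[OF a])
  have ZLp: "pascal z (\<lambda>p q. ZL p q p' q')" "pascal z (\<lambda>p' q'. ZL p q p' q')" for p q p' q'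
    unfolding ZL_def by (intro pascal_double_shift_left[OF NL] pascal_double_shift_right[OF NL] LR_at a; assumption?)+
  have ZRp: "pascal z (\<lambda>p q. ZR p q p' q')" "pascal z (\<lambda>p' q'. ZR p q p' q')" for p q p' q'
    unfolding ZR_def by (intro pascal_double_shift_left[OF NR] pascal_double_shift_right[OF NR] LR_at a; assumption?)+
  have ZLv: "vanishes_inf (\<lambda>p q. ZL p q p' q')" "vanishes_inf (\<lambda>p' q'. ZL p q p' q')" for p q p' q'
    unfolding ZL_def by (intro double_shift_vanishes[OF NL] LR_at a; assumption?)+
  have ZRv: "vanishes_z (\<lambda>p q. ZR p q p' q')" "vanishes_z (\<lambda>p' q'. ZR p q p' q')" for p q p' q'
    unfolding ZR_def by (intro double_shift_vanishes[OF NR] LR_at a; assumption?)+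
  \<comment> \<open>Sorted by vanishing in \<open>p, q\<close> and in \<open>p', q'\<close>:
    \<open>E1\<close> infinity and infinity, \<open>E2\<close> infinity and \<open>-z\<close>,
    \<open>E3\<close> \<open>-z\<close> and infinity, \<open>E4\<close> \<open>-z\<close> and
    \<open>-z\<close>. The sign \<open>s\<close> drops out of \<open>A3 v u\<close> and
    \<open>A4 v u\<close> because \<open>s * s = 1\<close>.\<close>
  define E1 where "E1 p q p' q' = A1 u v p q p' q' - s *\<^sub>C A1 v u p' q' p q - ZL p q p' q'" for p q p' q'
  define E2 where "E2 p q p' q' = A3 v u p' q' p q - A2 u v p q p' q'" for p q p' q'
  define E3 where "E3 p q p' q' = s *\<^sub>C (A2 v u p' q' p q - A3 u v p q p' q')" for p q p' q'
  define E4 where "E4 p q p' q' = s *\<^sub>C A4 u v p q p' q' - A4 v u p' q' p q + ZR p q p' q'" for p q p' q'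
  have sum: "E1 p q p' q' + E2 p q p' q' + E3 p q p' q' + E4 p q p' q' = 0" for p q p' q'
  proof -
    have "diff_pow l (\<lambda>m n. \<alpha> (U u m q (U v n q' w))) p p' - s *\<^sub>C diff_pow l (\<lambda>n m. \<alpha> (U v n q' (U u m q w))) p' p
      = \<alpha> (diff_pow l (\<lambda>m n. U u m q (U v n q' w)) p p' - s *\<^sub>C diff_pow l (\<lambda>n m. U v n q' (U u m q w)) p' p)"
      unfolding D_linear[OF a]
      by (subst (1 2) diff_pow_additive[where h = \<alpha>, OF antidiag_finite_UU]) (simp_all add: D_linear[OF a])
    also have "\<dots> = double_shift l (\<lambda>c d e. \<alpha> (U (vop V u c v) d e w)) p q p' q'"
      unfolding s_def translated_jacobi
      by (rule double_shift_additive[where N = N]) (auto simp: N D_linear[OF a])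
    also have "\<dots> = ZL p q p' q' - ZR p q p' q'"
      unfolding decomp[OF a] ZL_def ZR_def by (rule double_shift_diff[of N]) (auto simp: NL NR)
    finally have "A1 u v p q p' q' - A2 u v p q p' q' - s * (A3 u v p q p' q' - A4 u v p q p' q')
       - s * (A1 v u p' q' p q - A2 v u p' q' p q) + (s * s) * (A3 v u p' q' p q - A4 v u p' q' p q)
      = ZL p q p' q' - ZR p q p' q'"
      unfolding A_sum s_def[symmetric] scaleC_complex_def by (simp add: algebra_simps)
    then show ?thesis unfolding E1_def E2_def E3_def E4_def s scaleC_complex_def by (simp add: algebra_simps)
  qed
  note P = A_pascal ZLp ZRp and V = A_vanishes ZLv ZRv
  have E: "E1 p q p' q' = 0" "E2 p q p' q' = 0" "E4 p q p' q' = 0" for p q p' q'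
  proof -
    have l: "pascal z (\<lambda>p q. E1 p q p' q')" "pascal z (\<lambda>p q. E2 p q p' q')"
      "pascal z (\<lambda>p q. E3 p q p' q')" "pascal z (\<lambda>p q. E4 p q p' q')" for p' q'
      unfolding E1_def E2_def E3_def E4_def by (intro pascal_diff pascal_add pascal_scale P)+
    have r: "pascal z (\<lambda>p' q'. E1 p q p' q')" "pascal z (\<lambda>p' q'. E2 p q p' q')"
      "pascal z (\<lambda>p' q'. E3 p q p' q')" "pascal z (\<lambda>p' q'. E4 p q p' q')" for p q
      unfolding E1_def E2_def E3_def E4_def by (intro pascal_diff pascal_add pascal_scale P)+
    have vl: "vanishes_inf (\<lambda>p q. E1 p q p' q')" "vanishes_inf (\<lambda>p q. E2 p q p' q')"
      "vanishes_z (\<lambda>p q. E3 p q p' q')" "vanishes_z (\<lambda>p q. E4 p q p' q')" for p' q'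
      unfolding E1_def E2_def E3_def E4_def
      by (intro vanishes_inf_diff vanishes_inf_scale vanishes_z_add vanishes_z_diff vanishes_z_scale V)+
    have vr: "vanishes_inf (\<lambda>p' q'. E1 p q p' q')" "vanishes_z (\<lambda>p' q'. E2 p q p' q')"
      "vanishes_inf (\<lambda>p' q'. E3 p q p' q')" "vanishes_z (\<lambda>p' q'. E4 p q p' q')" for p q
      unfolding E1_def E2_def E3_def E4_def
      by (intro vanishes_inf_diff vanishes_inf_scale vanishes_z_add vanishes_z_diff vanishes_z_scale V)+
    show "E1 p q p' q' = 0" "E2 p q p' q' = 0" "E4 p q p' q' = 0"
      using four_way_unique[OF sum l r vl vr] by blast+
  qed
  show "A1 u v p q p' q' - (-1) powi l *\<^sub>C A1 v u p' q' p q = double_shift l (\<lambda>c d e. L (vop V u c v) d e \<alpha> w) p q p' q'"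
    using E(1)[of p q p' q'] by (simp add: E1_def ZL_def s_def)
  show "A2 u v p q p' q' = A3 v u p' q' p q"
    using E(2)[of p q p' q'] by (simp add: E2_def)
  show "A4 v u p' q' p q - (-1) powi l *\<^sub>C A4 u v p q p' q' = double_shift l (\<lambda>c d e. R (vop V u c v) d e \<alpha> w) p q p' q'"
    using E(3)[of p q p' q'] by (simp add: E4_def ZR_def s_def algebra_simps)
qed

end

text \<open>The mixed identity with \<open>l = 0\<close>, where \<open>diff_pow\<close> is trivial
  on both sides.\<close>

theorem LR_commute:
  assumes a: "\<alpha> \<in> D"
  shows "L u p q (R v p' q' \<alpha>) = R v p' q' (L u p q \<alpha>)"
  using decomposed_jacobi(2)[OF a, where l = 0 and u = u and v = v and p = p and q = q and p' = p' and q' = q']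
  by (auto simp: A2_def[OF a] A3_def[OF a] fun_eq_iff)

theorem R_jacobi:
  assumes a: "\<alpha> \<in> D"
  shows "diff_pow l (\<lambda>m n. R u 0 m (R v 0 n \<alpha>)) m n - (-1) powi l *\<^sub>C diff_pow l (\<lambda>n m. R v 0 n (R u 0 m \<alpha>)) n m
    = shift_pow l (\<lambda>c d. R (vop V u c v) 0 d \<alpha>) m n"
proof
  fix w
  obtain N where N: "\<And>c. c \<ge> N \<Longrightarrow> vop V u c v = 0" using vop_truncation by blast
  have af: "antidiag_finite (\<lambda>m n. R u 0 m (R v 0 n \<alpha>))" for u v
    by (rule antidiag_finite_compose(2)[OF _ vanishes_R[OF a], where H = "\<lambda>p n b. R u p n b"]) simp
  have "shift_pow l (\<lambda>c d. R (vop V u c v) 0 d \<alpha>) m n w = shift_pow l (\<lambda>c d. R (vop V u c v) 0 d \<alpha> w) m n"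
    by (rule shift_pow_apply[of N]) (simp add: N LR_0_left[OF a])
  then show "(diff_pow l (\<lambda>m n. R u 0 m (R v 0 n \<alpha>)) m n - (-1) powi l *\<^sub>C diff_pow l (\<lambda>n m. R v 0 n (R u 0 m \<alpha>)) n m) w
    = shift_pow l (\<lambda>c d. R (vop V u c v) 0 d \<alpha>) m n w"
    using decomposed_jacobi(3)[OF a, where l = l and w = w and u = u and v = v and p = 0 and q = m and p' = 0 and q' = n]
    by (simp add: A4_def[OF a] double_shift_p0 diff_pow_apply[OF af] scaleC_fun_def)
qed

theorem L_jacobi:
  assumes a: "\<alpha> \<in> D"
  shows "diff_pow l (\<lambda>m n. L v 0 n (L u 0 m \<alpha>)) m n - (-1) powi l *\<^sub>C diff_pow l (\<lambda>n m. L u 0 m (L v 0 n \<alpha>)) n m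
    = shift_pow l (\<lambda>c d. L (vop V u c v) 0 d \<alpha>) m n"
proof
  fix w
  obtain N where N: "\<And>c. c \<ge> N \<Longrightarrow> vop V u c v = 0" using vop_truncation by blast
  have af: "antidiag_finite (\<lambda>m n. L v 0 n (L u 0 m \<alpha>))" for u v
    by (rule antidiag_finite_compose(1)[OF _ vanishes_L[OF a], where H = "\<lambda>p n b. L v p n b"]) simp
  have "shift_pow l (\<lambda>c d. L (vop V u c v) 0 d \<alpha>) m n w = shift_pow l (\<lambda>c d. L (vop V u c v) 0 d \<alpha> w) m n"
    by (rule shift_pow_apply[of N]) (simp add: N LR_0_left[OF a])
  then show "(diff_pow l (\<lambda>m n. L v 0 n (L u 0 m \<alpha>)) m n - (-1) powi l *\<^sub>C diff_pow l (\<lambda>n m. L u 0 m (L v 0 n \<alpha>)) n m) w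
    = shift_pow l (\<lambda>c d. L (vop V u c v) 0 d \<alpha>) m n w"
    using decomposed_jacobi(1)[OF a, where l = l and w = w and u = u and v = v and p = 0 and q = m and p' = 0 and q' = n]
    by (simp add: A1_def[OF a] double_shift_p0 diff_pow_apply[OF af] scaleC_fun_def)
qed

end

section \<open>Laurent expansions of rational functions\<close>

lemma finite_eventually_at:
  assumes "finite S" shows "eventually (\<lambda>x::complex. x \<notin> S) (at a)"
proof -
  have "open (- (S - {a}))" by (intro open_Compl finite_imp_closed) (use assms in auto)
  then have "eventually (\<lambda>x. x \<in> - (S - {a}) - {a}) (at a)" by (intro eventually_at_in_open) auto
  then show ?thesis by (rule eventually_mono) auto
qed

lemma cofinite_eq_eventually:
  assumes "finite {x::complex. f x \<noteq> g x}" shows "eventually (\<lambda>x. f x = g x) (at a)"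
  using finite_eventually_at[OF assms] by simp

lemma cofinite_eq_comp:
  assumes "finite {x. f x \<noteq> g x}" "inj h"
  shows "finite {t. f (h t) \<noteq> g (h t)}"
  using finite_vimageI[OF assms] by (simp add: vimage_def)

lemma has_laurent_expansion_poly: "poly p has_laurent_expansion fps_to_fls (fps_of_poly p)"
  by (rule has_laurent_expansion_fps) (simp add: has_fps_expansion_def)

text \<open>Exceptional points are absorbed by multiplying numerator and denominator with a linear
  factor for each of them, so membership is insensitive to finitely many values.\<close>

lemma rational_functions_iff:
  "f \<in> rational_functions \<longleftrightarrow> (\<exists>p q. q \<noteq> 0 \<and> finite {x. f x \<noteq> poly p x / poly q x})"
proof
  assume "f \<in> rational_functions"
  then obtain p q where q: "q \<noteq> 0" and *: "\<And>x. poly q x \<noteq> 0 \<Longrightarrow> f x = poly p x / poly q x"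
    by (auto simp: rational_functions_def)
  have "finite {x. f x \<noteq> poly p x / poly q x}"
    by (rule finite_subset[OF _ poly_roots_finite[OF q]]) (use * in auto)
  then show "\<exists>p q. q \<noteq> 0 \<and> finite {x. f x \<noteq> poly p x / poly q x}" using q by blast
next
  assume "\<exists>p q. q \<noteq> 0 \<and> finite {x. f x \<noteq> poly p x / poly q x}"
  then obtain p q where q: "q \<noteq> 0" and fin: "finite {x. f x \<noteq> poly p x / poly q x}" by blast
  define r where "r = (\<Prod>a\<in>{x. f x \<noteq> poly p x / poly q x}. [:-a, 1:])"
  have r: "poly r x = 0 \<longleftrightarrow> f x \<noteq> poly p x / poly q x" for x
    unfolding r_def poly_prod using fin by (simp add: prod_zero_iff)
  have "r \<noteq> 0" unfolding r_def using fin by (simp add: prod_zero_iff)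
  then have "q * r \<noteq> 0" using q by simp
  moreover have "f x = poly (p * r) x / poly (q * r) x" if "poly (q * r) x \<noteq> 0" for x
    using that r[of x] by auto
  ultimately show "f \<in> rational_functions" unfolding rational_functions_def by blast
qed

lemma iota_zero_eq: "f has_laurent_expansion F \<Longrightarrow> iota_zero f m = fls_nth F m"
  unfolding iota_zero_def by (simp add: laurent_expansion_0_eqI)

lemma iota_infinity_eq: "(\<lambda>t. f (1 / t)) has_laurent_expansion F \<Longrightarrow> iota_infinity f m = fls_nth F (- m)"
  unfolding iota_infinity_def by (simp add: laurent_expansion_0_eqI)

text \<open>Equal expansions at 0 give, after clearing denominators, equal power series of
  polynomials, hence a polynomial identity; the functions can then differ only at roots of
  denominators and at exceptional points.\<close>

lemma iota_zero_inject:
  assumes "f \<in> rational_functions" "g \<in> rational_functions" "iota_zero f = iota_zero g"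
  shows "finite {x. f x \<noteq> g x}"
proof -
  obtain p q where pq: "q \<noteq> 0" "finite {x. f x \<noteq> poly p x / poly q x}"
    using assms(1) by (auto simp: rational_functions_iff)
  obtain r s where rs: "s \<noteq> 0" "finite {x. g x \<noteq> poly r x / poly s x}"
    using assms(2) by (auto simp: rational_functions_iff)
  have exp: "f has_laurent_expansion fps_to_fls (fps_of_poly p) / fps_to_fls (fps_of_poly q)"
    if "finite {x. f x \<noteq> poly p x / poly q x}" for f p q
    by (subst has_laurent_expansion_cong[OF cofinite_eq_eventually[OF that] refl])
       (intro laurent_expansion_intros has_laurent_expansion_poly)
  have "fps_to_fls (fps_of_poly p) / fps_to_fls (fps_of_poly q) = fps_to_fls (fps_of_poly r) / fps_to_fls (fps_of_poly s)"
  proof (rule fls_eqI)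
    fix n show "fls_nth (fps_to_fls (fps_of_poly p) / fps_to_fls (fps_of_poly q)) n
       = fls_nth (fps_to_fls (fps_of_poly r) / fps_to_fls (fps_of_poly s)) n"
      using fun_cong[OF assms(3), of n] iota_zero_eq[OF exp[OF pq(2)]] iota_zero_eq[OF exp[OF rs(2)]] by simp
  qed
  moreover have nz: "fps_to_fls (fps_of_poly q) \<noteq> 0" "fps_to_fls (fps_of_poly s) \<noteq> 0"
    using pq rs fps_of_poly_eq_iff[of _ 0] by (auto simp del: fps_of_poly_eq_iff)
  ultimately have "fps_to_fls (fps_of_poly p) * fps_to_fls (fps_of_poly s) = fps_to_fls (fps_of_poly r) * fps_to_fls (fps_of_poly q)"
    by (simp add: frac_eq_eq)
  then have "fps_of_poly (p * s) = fps_of_poly (r * q)"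
    by (simp add: fps_of_poly_mult flip: fls_times_fps_to_fls)
  then have ps: "p * s = r * q" by (simp add: fps_of_poly_eq_iff)
  have "{x. f x \<noteq> g x} \<subseteq> {x. f x \<noteq> poly p x / poly q x} \<union> {x. g x \<noteq> poly r x / poly s x} \<union> {x. poly (q * s) x = 0}"
  proof -
    have "poly p x / poly q x = poly r x / poly s x" if "poly (q * s) x \<noteq> 0" for x
      using that arg_cong[OF ps, of "\<lambda>t. poly t x"] by (auto simp: frac_eq_eq)
    then show ?thesis by auto
  qed
  moreover have "finite {x. poly (q * s) x = 0}" using pq rs by (intro poly_roots_finite) auto
  ultimately show ?thesis using pq rs by (meson finite_Un finite_subset)
qed

lemma iota_zero_inverse_cofinite:
  assumes "f \<in> rational_functions" "iota_zero f = g"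
  shows "finite {x. iota_zero_inverse g x \<noteq> f x}"
proof -
  have "iota_zero_inverse g \<in> rational_functions \<and> iota_zero (iota_zero_inverse g) = g"
    unfolding iota_zero_inverse_def by (rule someI[of _ f]) (use assms in auto)
  then show ?thesis using assms by (intro iota_zero_inject) auto
qed

lemma pole_order_le_iff:
  "pole_order f a \<le> M \<longleftrightarrow> (\<forall>n < - int M. fls_nth (laurent_expansion f a) n = 0)"
proof
  assume "pole_order f a \<le> M"
  then show "\<forall>n < - int M. fls_nth (laurent_expansion f a) n = 0"
    by (auto simp: pole_order_def intro!: fls_eq0_below_subdegree)
next
  assume *: "\<forall>n < - int M. fls_nth (laurent_expansion f a) n = 0"
  show "pole_order f a \<le> M"
  proof (cases "laurent_expansion f a = 0")
    case False
    have "- int M \<le> fls_subdegree (laurent_expansion f a)"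
      by (rule fls_subdegree_geI[OF False]) (use * in auto)
    then show ?thesis by (simp add: pole_order_def)
  qed (simp add: pole_order_def)
qed

lemma fls_nth_const_mult: "fls_nth (fls_const c * F) n = c * fls_nth (F :: complex fls) n"
  by simp

text \<open>Wherever \<open>y\<close> and \<open>y + z\<close> are expanded, their series differ by
  the constant \<open>z\<close>. So one lemma yields the Pascal rule for the coefficients at 0, at
  \<open>-z\<close> and at infinity.\<close>

lemma pascal_fls:
  fixes Yv Xv :: "complex fls"
  assumes "Xv = Yv + fls_const z" "Xv \<noteq> 0" "Yv \<noteq> 0"
  shows "pascal z (\<lambda>p q. fls_nth (Yv powi p * Xv powi q * F) n)"
  unfolding pascal_def
proof (intro allI)
  fix p q
  have "Yv powi p * Xv powi (q + 1) * F = Yv powi (p + 1) * Xv powi q * F + fls_const z * (Yv powi p * Xv powi q * F)"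
    using assms(2,3) by (simp add: power_int_add_1) (simp add: assms(1) algebra_simps)
  then show "fls_nth (Yv powi p * Xv powi (q + 1) * F) n
     = fls_nth (Yv powi (p + 1) * Xv powi q * F) n + z *\<^sub>C fls_nth (Yv powi p * Xv powi q * F) n"
    by (simp only: fls_nth_const_mult fls_plus_nth scaleC_complex_def)
qed

text \<open>A general element of the ring generated by \<open>y\<close>, \<open>1/y\<close> and
  \<open>1/(y + z)\<close>. With \<open>h = id\<close> it is a function value, with
  \<open>h = fls_const\<close> its Laurent series, so a function and its expansions at different
  points share one formula.\<close>

definition combination :: "(nat \<Rightarrow> complex) \<Rightarrow> nat \<Rightarrow> int \<Rightarrow> int \<Rightarrow> 'a::field \<Rightarrow> 'a \<Rightarrow> (complex \<Rightarrow> 'a) \<Rightarrow> 'a" where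
  "combination c d k l Yv Xv h = (\<Sum>j\<le>d. h (c j) * (Yv powi (int j - k) * Xv powi (- l)))"

context
  fixes z :: complex assumes z: "z \<noteq> 0"
begin

text \<open>The expansions of the pair \<open>(y, y + z)\<close> at \<open>y = 0\<close>, at \<open>y = -z\<close> (in the variable \<open>y + z\<close>),
  and at infinity (in the variable \<open>1 / (y + z)\<close>).\<close>

abbreviation "Y0 \<equiv> (fls_X :: complex fls)"
abbreviation "X0 \<equiv> fls_X + fls_const z"
abbreviation "Yz \<equiv> fls_X - fls_const z"
abbreviation "Xz \<equiv> (fls_X :: complex fls)"
abbreviation "Yi \<equiv> fls_X_inv - fls_const z"
abbreviation "Xi \<equiv> (fls_X_inv :: complex fls)"

lemma subdegree_X0: "fls_subdegree X0 = 0"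
  by (rule fls_subdegree_eqI) (use z in auto)
lemma subdegree_Yz: "fls_subdegree Yz = 0"
  by (rule fls_subdegree_eqI) (use z in auto)
lemma subdegree_Yi: "fls_subdegree Yi = -1"
  by (rule fls_subdegree_eqI) auto

lemma nz: "X0 \<noteq> 0" "Y0 \<noteq> 0" "Xz \<noteq> 0" "Yz \<noteq> 0" "Xi \<noteq> 0" "Yi \<noteq> 0"
proof -
  have "fls_nth X0 1 \<noteq> 0" "fls_nth Yz 1 \<noteq> 0" "fls_nth Yi (-1) \<noteq> 0" by simp_all
  then show "X0 \<noteq> 0" "Yz \<noteq> 0" "Yi \<noteq> 0" by fastforce+
qed auto

lemma Xi_powi: "Xi powi q = fls_X_intpow (- q)"
proof -
  have "Xi powi q = inverse fls_X powi q" by (simp add: fls_inverse_X)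
  also have "\<dots> = fls_X powi (- q)" by (simp only: power_int_inverse power_int_minus)
  finally show ?thesis by (simp only: fls_X_power_int)
qed

text \<open>The residue theorem for the basis functions, proved algebraically: the difference of the
  two sides obeys the Pascal rule, is zero for \<open>p \<ge> 0\<close> and zero on the row
  \<open>q = 0\<close>, so \<open>pascal_unique_row\<close> applies. In the variable
  \<open>1/x\<close> at infinity, \<open>x^(-1)\<close> has index 1.\<close>

lemma residue_sum:
  "fls_nth (Y0 powi p * X0 powi q) (-1) = fls_nth (Yi powi p * Xi powi q) 1 - fls_nth (Yz powi p * Xz powi q) (-1)"
proof -
  define T0 where "T0 p q = fls_nth (Y0 powi p * X0 powi q * 1) (-1)" for p q
  define Tz where "Tz p q = fls_nth (Yz powi p * Xz powi q * 1) (-1)" for p q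
  define Ti where "Ti p q = fls_nth (Yi powi p * Xi powi q * 1) 1" for p q
  have P: "pascal z T0" "pascal z Tz" "pascal z Ti"
    unfolding T0_def Tz_def Ti_def by (intro pascal_fls nz; simp)+
  have PE: "pascal z (\<lambda>p q. T0 p q - (Ti p q - Tz p q))" by (intro pascal_diff P)
  \<comment> \<open>For \<open>p \<ge> 0\<close> the function is a Laurent polynomial in
    \<open>x = y + z\<close>, whose expansions at \<open>x = 0\<close> and at infinity
    coincide.\<close>
  have eq: "Ti (int k) q = Tz (int k) q" for k q
  proof (induction k arbitrary: q)
    case 0
    show ?case by (simp add: Ti_def Tz_def Xi_powi)
  next
    case (Suc k)
    have "F (int k + 1) q = F (int k) (q + 1) - z *\<^sub>C F (int k) q" if "pascal z F" for F :: "int \<Rightarrow> int \<Rightarrow> complex" and q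
      using that by (simp add: pascal_def)
    moreover have "int (Suc k) = int k + 1" by simp
    ultimately show ?case using P(2,3) Suc by metis
  qed
  have Tz0: "Tz p 0 = 0" for p
    unfolding Tz_def by (rule fls_eq0_below_subdegree) (simp add: subdegree_Yz nz)
  have T0_pos: "T0 p q = 0" if "p \<ge> 0" for p q
    unfolding T0_def by (rule fls_eq0_below_subdegree) (use that in \<open>simp add: subdegree_X0 nz\<close>)
  have T0_row: "T0 p 0 = (if p = -1 then 1 else 0)" for p
    by (simp add: T0_def)
  \<comment> \<open>In the variable \<open>t = 1/x\<close> one has
    \<open>1/y = t / (1 - z t)\<close>, which begins with \<open>t\<close>.\<close>
  have Ti1: "Ti (-1) 0 = 1"
  proof -
    have "Yi * inverse Yi = 1" using nz by simp
    then have "fls_nth (Yi * inverse Yi) 0 = 1" by simp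
    moreover have "fls_subdegree (inverse Yi) = 1" using nz subdegree_Yi by (simp add: fls_inverse_subdegree)
    ultimately show ?thesis using fls_times_base[of Yi "inverse Yi"] by (simp add: Ti_def subdegree_Yi power_int_minus)
  qed
  have "T0 p q - (Ti p q - Tz p q) = 0"
  proof (rule pascal_unique_row[OF PE z, of 0])
    fix p :: int
    consider "p \<ge> 0" | "p = -1" | "p \<le> -2" by linarith
    then show "T0 p 0 - (Ti p 0 - Tz p 0) = 0"
    proof cases
      case 1
      then show ?thesis using eq[of "nat p" 0] T0_pos by simp
    next
      case 2
      then show ?thesis by (simp add: Tz0 Ti1 T0_row)
    next
      case 3
      have "Ti p 0 = 0" unfolding Ti_def by (rule fls_eq0_below_subdegree) (use 3 in \<open>simp add: subdegree_Yi nz\<close>)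
      moreover have "T0 p 0 = 0" using 3 by (simp add: T0_def)
      ultimately show ?thesis by (simp add: Tz0)
    qed
  next
    fix q
    have "T0 p q - (Ti p q - Tz p q) = 0" if "p \<ge> 0" for p using eq[of "nat p" q] T0_pos that by simp
    then show "\<exists>M. \<forall>p\<ge>M. T0 p q - (Ti p q - Tz p q) = 0" by blast
  qed
  then show ?thesis by (simp add: T0_def Ti_def Tz_def)
qed

lemma combination_laurent:
  assumes "y has_laurent_expansion Yv" "x has_laurent_expansion Xv"
  shows "(\<lambda>t. combination c d k l (y t) (x t) id) has_laurent_expansion combination c d k l Yv Xv fls_const"
  unfolding combination_def id_def by (intro laurent_expansion_intros assms)

lemma combination_nth:
  assumes "Yv \<noteq> 0" "Xv \<noteq> 0"
  shows "fls_nth (Yv powi p * Xv powi q * combination c d k l Yv Xv fls_const) n =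
    (\<Sum>j\<le>d. c j * fls_nth (Yv powi (p + int j - k) * Xv powi (q - l)) n)"
proof -
  have *: "Yv powi p * Xv powi q * (fls_const a * (Yv powi (int j - k) * Xv powi (- l))) =
     fls_const a * (Yv powi (p + int j - k) * Xv powi (q - l))" for a j
  proof -
    have "Yv powi (p + int j - k) = Yv powi p * Yv powi (int j - k)"
      using power_int_add[of Yv p "int j - k"] assms by (simp add: algebra_simps)
    moreover have "Xv powi (q - l) = Xv powi q * Xv powi (- l)"
      using power_int_add[of Xv q "- l"] assms by simp
    ultimately show ?thesis by (simp add: ac_simps)
  qed
  show ?thesis unfolding combination_def sum_distrib_left fls_nth_sum * fls_nth_const_mult ..
qed

lemma combination_residue_sum:
  "fls_nth (Y0 powi p * X0 powi q * combination c d k l Y0 X0 fls_const) (-1)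
   = fls_nth (Yi powi p * Xi powi q * combination c d k l Yi Xi fls_const) 1
   - fls_nth (Yz powi p * Xz powi q * combination c d k l Yz Xz fls_const) (-1)"
  by (simp only: combination_nth[OF nz(2,1)] combination_nth[OF nz(6,5)] combination_nth[OF nz(4,3)]
      residue_sum sum_subtractf right_diff_distrib)

lemma Qz_ring_combination:
  assumes "f \<in> Qz_ring z"
  obtains c d k l where "finite {y. f y \<noteq> combination c d (int k) (int l) y (y + z) id}"
    "f \<in> rational_functions"
proof -
  obtain p k l where f: "\<And>x. x \<noteq> 0 \<Longrightarrow> x \<noteq> - z \<Longrightarrow> f x = poly p x / (x ^ k * (x + z) ^ l)"
    using assms by (auto simp: Qz_ring_def)
  have "f y = combination (coeff p) (degree p) (int k) (int l) y (y + z) id" if "y \<noteq> 0" "y \<noteq> - z" for y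
  proof -
    have "y + z \<noteq> 0" using that by (simp add: add_eq_0_iff2)
    then have "combination (coeff p) (degree p) (int k) (int l) y (y + z) id =
      (\<Sum>j\<le>degree p. coeff p j * y ^ j / (y ^ k * (y + z) ^ l))"
      unfolding combination_def using that
      by (intro sum.cong) (auto simp: power_int_diff power_int_minus field_simps)
    then show ?thesis by (simp add: f that poly_altdef sum_divide_distrib)
  qed
  then have "{y. f y \<noteq> combination (coeff p) (degree p) (int k) (int l) y (y + z) id} \<subseteq> {0, -z}" by auto
  then have 1: "finite {y. f y \<noteq> combination (coeff p) (degree p) (int k) (int l) y (y + z) id}"
    by (rule finite_subset) simp
  \<comment> \<open>The values of \<open>f\<close> at 0 and \<open>-z\<close> are arbitrary, so the
    denominator must vanish at both points even when \<open>k\<close> or \<open>l\<close> is 0;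
    hence the successors.\<close>
  define q where "q = [:0,1:] ^ Suc k * [:z, 1:] ^ Suc l"
  have q: "poly q x = x ^ Suc k * (x + z) ^ Suc l" for x
    by (simp add: q_def poly_power add.commute del: power_Suc)
  have "q \<noteq> 0" unfolding q_def mult_eq_0_iff power_eq_0_iff by simp
  moreover have "f x = poly (p * [:0,1:] * [:z, 1:]) x / poly q x" if "poly q x \<noteq> 0" for x
  proof -
    have x: "x \<noteq> 0" "x + z \<noteq> 0" using that unfolding q by auto
    then have "x \<noteq> - z" by auto
    moreover have "poly (p * [:0,1:] * [:z, 1:]) x = poly p x * x * (x + z)" by (simp add: algebra_simps)
    ultimately show ?thesis using x by (simp add: q f)
  qed
  ultimately have "f \<in> rational_functions" unfolding rational_functions_def by blast
  with 1 show ?thesis using that by blast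
qed

end

section \<open>Functionals with rational matrix coefficients\<close>

lemma has_sum_int_shift:
  fixes g :: "int \<Rightarrow> 'a::{comm_monoid_add,topological_space}"
  assumes "\<And>m. m < N \<Longrightarrow> g m = 0"
  shows "(g has_sum S) UNIV \<longleftrightarrow> ((\<lambda>n::nat. g (int n + N)) has_sum S) UNIV"
proof -
  have "inj_on (\<lambda>n::nat. int n + N) UNIV" by (rule inj_onI) simp
  moreover have "range (\<lambda>n::nat. int n + N) = {N..}"
  proof safe
    fix m assume "m \<ge> N"
    then have "m = int (nat (m - N)) + N" by simp
    then show "m \<in> range (\<lambda>n::nat. int n + N)" by blast
  qed simp
  ultimately have "((\<lambda>n::nat. g (int n + N)) has_sum S) UNIV \<longleftrightarrow> (g has_sum S) {N..}"
    using has_sum_reindex[of "\<lambda>n::nat. int n + N" UNIV g S] by (simp add: o_def)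
  also have "\<dots> \<longleftrightarrow> (g has_sum S) UNIV"
    by (rule has_sum_cong_neutral) (use assms in auto)
  finally show ?thesis by simp
qed

text \<open>Convergence at the single radius \<open>r / 2\<close> already gives a positive radius of
  convergence. This turns the analytic condition in the definition of the functionals into a formal
  expansion.\<close>

lemma laurent_of_has_sum:
  assumes r: "r > 0"
    and s: "\<And>x. 0 < norm x \<Longrightarrow> norm x < r \<Longrightarrow> ((\<lambda>m. fls_nth F m * x powi m) has_sum f x) UNIV"
  shows "f has_laurent_expansion F"
proof -
  define N where "N = fls_subdegree F"
  have sums: "(\<lambda>n. fls_nth F (int n + N) * x powi (int n + N)) sums f x" if "0 < norm x" "norm x < r" for x
  proof (rule has_sum_imp_sums)
    show "((\<lambda>n::nat. fls_nth F (int n + N) * x powi (int n + N)) has_sum f x) UNIV"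
      using s[OF that] by (subst (asm) has_sum_int_shift[where N = N]) (auto simp: N_def)
  qed
  have ev: "eval_fls F x = f x" if "0 < norm x" "norm x < r" for x
    by (rule eval_fls_eq[OF _ _ sums[OF that]]) (use that in \<open>auto simp: N_def\<close>)
  have "fls_conv_radius F \<ge> ereal (norm (complex_of_real (r / 2)))"
    unfolding fls_conv_radius_altdef fps_conv_radius_def
  proof (rule conv_radius_geI)
    let ?x = "complex_of_real (r / 2)"
    have "0 < norm ?x" "norm ?x < r" using r by auto
    from sums[OF this] have "summable (\<lambda>n. fls_nth F (int n + N) * ?x powi (int n + N))" by (simp add: sums_iff)
    then have "summable (\<lambda>n. fls_nth F (int n + N) * ?x powi (int n + N) * ?x powi (- N))" by (rule summable_mult2)
    moreover have "?x powi (int n + N) * ?x powi (- N) = ?x ^ n" for n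
      using r power_int_add[of ?x "int n + N" "- N"] by simp
    ultimately show "summable (\<lambda>n. fps_nth (fls_base_factor_to_fps F) n * ?x ^ n)"
      by (simp add: N_def mult.assoc)
  qed
  moreover have "ereal (norm (complex_of_real (r / 2))) > 0" using r by (simp add: zero_ereal_def)
  ultimately have "fls_conv_radius F > 0" by (rule order.strict_trans2[rotated])
  moreover have "eventually (\<lambda>x. x \<in> ball 0 r - {0}) (at (0::complex))"
    using r by (intro eventually_at_in_open) auto
  then have "eventually (\<lambda>x. eval_fls F x = f x) (at 0)"
    by (rule eventually_mono) (auto intro!: ev)
  ultimately show ?thesis by (simp add: has_laurent_expansion_def)
qed

text \<open>Holomorphy on the punctured disc forces the series to converge on all of it, absolutely,
  since its principal part is finite.\<close>

lemma has_sum_of_laurent: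
  assumes "f has_laurent_expansion F" "f holomorphic_on ball 0 r - {0}" "0 < norm x" "norm x < r"
  shows "(\<lambda>m. norm (fls_nth F m * x powi m)) summable_on UNIV"
    "((\<lambda>m. fls_nth F m * x powi m) has_sum f x) UNIV"
proof -
  define N where "N = fls_subdegree F"
  have hol: "f holomorphic_on eball 0 (ereal r) - {0}" using assms(2) by simp
  have rad: "ereal r \<le> fls_conv_radius F" by (rule fls_conv_radius_ge[OF assms(1) hol])
  then have x: "ereal (norm x) < fls_conv_radius F" using assms(4) by (metis ereal_less_eq(3) less_le_not_le order.strict_trans2 less_ereal.simps(1))
  have ev: "eval_fls F x = f x"
    by (rule eval_fls_eqI[OF assms(1) hol]) (use assms in auto)
  have sums: "(\<lambda>n. fls_nth F (int n + N) * x powi (int n + N)) sums f x"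
    unfolding ev[symmetric] N_def by (rule sums_eval_fls) (use x assms in auto)
  have "summable (\<lambda>n. norm (fls_nth F (int n + N) * x ^ n) * norm (x powi N))"
    unfolding N_def by (rule summable_mult2[OF norm_summable_fls'[OF x]])
  moreover have "norm (fls_nth F (int n + N) * x ^ n) * norm (x powi N) = norm (fls_nth F (int n + N) * x powi (int n + N))" for n
    using assms(3) by (simp add: power_int_add norm_mult)
  ultimately have summ: "summable (\<lambda>n. norm (fls_nth F (int n + N) * x powi (int n + N)))" by simp
  have "((\<lambda>n. fls_nth F (int n + N) * x powi (int n + N)) has_sum f x) UNIV"
    by (rule norm_summable_imp_has_sum[OF summ sums])
  then show "((\<lambda>m. fls_nth F m * x powi m) has_sum f x) UNIV"
    by (subst has_sum_int_shift[where N = N]) (auto simp: N_def)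
  have "(\<lambda>n. norm (fls_nth F (int n + N) * x powi (int n + N))) summable_on UNIV"
    by (rule norm_summable_imp_summable_on) (use summ in simp)
  then obtain S where "((\<lambda>n. norm (fls_nth F (int n + N) * x powi (int n + N))) has_sum S) UNIV"
    by (auto simp: summable_on_def)
  then have "((\<lambda>m. norm (fls_nth F m * x powi m)) has_sum S) UNIV"
    by (subst has_sum_int_shift[where N = N]) (auto simp: N_def)
  then show "(\<lambda>m. norm (fls_nth F m * x powi m)) summable_on UNIV"
    by (auto simp: summable_on_def)
qed

context module_translation
begin

definition rat :: "('w \<Rightarrow> complex) \<Rightarrow> 'v \<Rightarrow> 'w \<Rightarrow> complex \<Rightarrow> complex" where
  "rat \<alpha> v w = iota_zero_inverse (matrix_coeff Y \<alpha> v w)"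

definition Lq :: "'v \<Rightarrow> int \<Rightarrow> int \<Rightarrow> ('w \<Rightarrow> complex) \<Rightarrow> 'w \<Rightarrow> complex" where
  "Lq v p q \<alpha> w = iota_infinity (\<lambda>x. (x - z) powi p * x powi q * rat \<alpha> v w (x - z)) (-1)"

definition Rq :: "'v \<Rightarrow> int \<Rightarrow> int \<Rightarrow> ('w \<Rightarrow> complex) \<Rightarrow> 'w \<Rightarrow> complex" where
  "Rq v p q \<alpha> w = iota_zero (\<lambda>x. (x - z) powi p * x powi q * rat \<alpha> v w (x - z)) (-1)"

definition matrix_fls :: "('w \<Rightarrow> complex) \<Rightarrow> 'v \<Rightarrow> 'w \<Rightarrow> complex fls" where
  "matrix_fls \<alpha> v w = Abs_fls (matrix_coeff Y \<alpha> v w)"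

lemma matrix_fls_nth:
  assumes "\<alpha> 0 = 0"
  shows "fls_nth (matrix_fls \<alpha> v w) m = matrix_coeff Y \<alpha> v w m"
proof -
  obtain N where N: "\<And>n. n \<ge> N \<Longrightarrow> Y v n w = 0" using truncation'[of v w] by blast
  have "\<forall>m < - N. matrix_coeff Y \<alpha> v w m = 0"
    by (auto simp: matrix_coeff_def N assms)
  then show ?thesis unfolding matrix_fls_def by (rule nth_Abs_fls_lower_bound)
qed

text \<open>Both sides obey the Pascal rule, agree on \<open>q = 0\<close> by definition and vanish
  for large \<open>p\<close>: the left by truncation, the right because the order of the series at 0
  is positive enough.\<close>

lemma functional_U:
  assumes lin: "clinear \<alpha>"
  shows "\<alpha> (U v p q w) = fls_nth (fls_X powi p * (fls_X + fls_const z) powi q * matrix_fls \<alpha> v w) (-1)"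
proof -
  have a: "\<alpha> (x + y) = \<alpha> x + \<alpha> y" "\<alpha> (c *\<^sub>C x) = c *\<^sub>C \<alpha> x" for x y c
    using lin by (auto simp: Vector_Spaces.linear_iff)
  have a0: "\<alpha> 0 = 0" by (rule linear_zero[OF lin])
  obtain N where N: "\<And>n q. n \<ge> N \<Longrightarrow> U v n q w = 0" using U_truncation[of v w] by blast
  define B where "B p q = fls_nth (fls_X powi p * (fls_X + fls_const z) powi q * matrix_fls \<alpha> v w) (-1)" for p q
  have PB: "pascal z B" unfolding B_def by (rule pascal_fls) (use nz[OF z] in auto)
  have P: "pascal z (\<lambda>p q. \<alpha> (U v p q w) - B p q)"
  proof (rule pascal_diff[OF _ PB])
    show "pascal z (\<lambda>p q. \<alpha> (U v p q w))" using pascal_U[of v w] by (simp add: pascal_def a)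
  qed
  have row: "\<alpha> (U v p 0 w) - B p 0 = 0" for p
    by (simp add: B_def fls_X_intpow_times_conv_shift matrix_fls_nth[where \<alpha> = \<alpha>, OF a0] matrix_coeff_def)
  have top: "\<exists>M. \<forall>p\<ge>M. \<alpha> (U v p q w) - B p q = 0" for q
  proof -
    have "\<alpha> (U v p q w) - B p q = 0" if "p \<ge> max N (- fls_subdegree (matrix_fls \<alpha> v w))" for p
    proof -
      have "B p q = 0"
      proof (cases "matrix_fls \<alpha> v w = 0")
        case False
        then show ?thesis unfolding B_def using that
          by (intro fls_eq0_below_subdegree) (simp add: subdegree_X0[OF z] nz[OF z])
      qed (simp add: B_def)
      then show ?thesis using that by (simp add: N a0)
    qed
    then show ?thesis by blast
  qed
  from pascal_unique_row[OF P z row top] have "\<alpha> (U v p q w) - B p q = 0" .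
  then show ?thesis by (simp add: B_def)
qed

text \<open>As \<open>rat \<alpha> v w\<close> is given by a choice operator, it agrees with the function \<open>f\<close> of the defining
  condition only up to finitely many points.\<close>

lemma Qz_witness:
  assumes lin: "clinear \<alpha>" and f: "f \<in> Qz_ring z"
    and s: "\<And>x. 0 < norm x \<Longrightarrow> norm x < norm z \<Longrightarrow> ((\<lambda>m. matrix_coeff Y \<alpha> v w m * x powi m) has_sum f x) UNIV"
  shows "\<exists>c d k l. finite {y. rat \<alpha> v w y \<noteq> combination c d (int k) (int l) y (y + z) id}
     \<and> finite {y. f y \<noteq> combination c d (int k) (int l) y (y + z) id}
     \<and> matrix_fls \<alpha> v w = combination c d (int k) (int l) fls_X (fls_X + fls_const z) fls_const"
proof -
  have a0: "\<alpha> 0 = 0" by (rule linear_zero[OF lin])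
  obtain c d k l where fin: "finite {y. f y \<noteq> combination c d (int k) (int l) y (y + z) id}"
    and rat: "f \<in> rational_functions" by (rule Qz_ring_combination[OF z f])
  have fl: "f has_laurent_expansion matrix_fls \<alpha> v w"
    by (rule laurent_of_has_sum[of "norm z"]) (use z s in \<open>auto simp: matrix_fls_nth[where \<alpha> = \<alpha>, OF a0]\<close>)
  have "iota_zero f = matrix_coeff Y \<alpha> v w"
    using iota_zero_eq[OF fl] by (auto simp: matrix_fls_nth[where \<alpha> = \<alpha>, OF a0])
  from iota_zero_inverse_cofinite[OF rat this]
  have fin': "finite {y. rat \<alpha> v w y \<noteq> f y}" by (simp add: rat_def)
  have "finite {y. rat \<alpha> v w y \<noteq> combination c d (int k) (int l) y (y + z) id}"
    by (rule finite_subset[OF _ finite_UnI[OF fin fin']]) auto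
  moreover have "f has_laurent_expansion combination c d (int k) (int l) fls_X (fls_X + fls_const z) fls_const"
    by (subst has_laurent_expansion_cong[OF cofinite_eq_eventually[OF fin] refl])
       (intro combination_laurent[OF z] laurent_expansion_intros)
  then have "matrix_fls \<alpha> v w = combination c d (int k) (int l) fls_X (fls_X + fls_const z) fls_const"
    using fl has_laurent_expansion_unique by blast
  ultimately show ?thesis using fin by blast
qed

text \<open>Two parameters occur at infinity: \<open>Y\<^sup>L\<close> is read off in powers of
  \<open>1/(y + z)\<close>, whereas \<open>pole_order_infinity\<close> is measured in
  \<open>1/y\<close>.\<close>

lemma combination_expansions:
  assumes fin: "finite {y. f y \<noteq> combination c d k l y (y + z) id}"
  shows "(\<lambda>x. f (x - z)) has_laurent_expansion combination c d k l (fls_X - fls_const z) fls_X fls_const"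
    "(\<lambda>t. f (1 / t - z)) has_laurent_expansion combination c d k l (fls_X_inv - fls_const z) fls_X_inv fls_const"
    "(\<lambda>t. f (1 / t)) has_laurent_expansion combination c d k l fls_X_inv (fls_X_inv + fls_const z) fls_const"
proof -
  have i: "inj (\<lambda>x::complex. x - z)" "inj (\<lambda>t::complex. 1 / t - z)" "inj (\<lambda>t::complex. 1 / t)"
    by (auto simp: inj_def)
  have inv: "(\<lambda>t::complex. 1 / t) has_laurent_expansion fls_X_inv"
    using has_laurent_expansion_fls_X_inv by (simp add: inverse_eq_divide[abs_def])
  have 1: "(\<lambda>t. f (h t)) has_laurent_expansion combination c d k l F G fls_const"
    if "inj h" "h has_laurent_expansion F" "(\<lambda>t. h t + z) has_laurent_expansion G" for h F G
    by (subst has_laurent_expansion_cong[OF cofinite_eq_eventually[OF cofinite_eq_comp[OF fin that(1)]] refl])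
       (intro combination_laurent[OF z] that)
  show "(\<lambda>x. f (x - z)) has_laurent_expansion combination c d k l (fls_X - fls_const z) fls_X fls_const"
    by (rule 1[OF i(1)]) (auto intro!: laurent_expansion_intros)
  show "(\<lambda>t. f (1 / t - z)) has_laurent_expansion combination c d k l (fls_X_inv - fls_const z) fls_X_inv fls_const"
    by (rule 1[OF i(2)]) (auto intro!: has_laurent_expansion_diff inv)
  show "(\<lambda>t. f (1 / t)) has_laurent_expansion combination c d k l fls_X_inv (fls_X_inv + fls_const z) fls_const"
    by (rule 1[OF i(3)]) (auto intro!: has_laurent_expansion_add inv)
qed

lemma Rq_eq:
  assumes "(\<lambda>x. rat \<alpha> v w (x - z)) has_laurent_expansion F"
  shows "Rq v p q \<alpha> w = fls_nth ((fls_X - fls_const z) powi p * fls_X powi q * F) (-1)"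
  unfolding Rq_def by (rule iota_zero_eq) (intro laurent_expansion_intros assms)

lemma Lq_eq:
  assumes "(\<lambda>t. rat \<alpha> v w (1 / t - z)) has_laurent_expansion F"
  shows "Lq v p q \<alpha> w = fls_nth ((fls_X_inv - fls_const z) powi p * fls_X_inv powi q * F) 1"
proof -
  have inv: "(\<lambda>t::complex. 1 / t) has_laurent_expansion fls_X_inv"
    using has_laurent_expansion_fls_X_inv by (simp add: inverse_eq_divide[abs_def])
  have "iota_infinity (\<lambda>x. (x - z) powi p * x powi q * rat \<alpha> v w (x - z)) (-1)
    = fls_nth ((fls_X_inv - fls_const z) powi p * fls_X_inv powi q * F) (- (- 1))"
    by (rule iota_infinity_eq)
       (intro has_laurent_expansion_mult has_laurent_expansion_power_int has_laurent_expansion_diff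
          has_laurent_expansion_const inv assms)
  then show ?thesis by (simp add: Lq_def)
qed

text \<open>The two parameters are related by the substitution \<open>t / (1 - z t)\<close>, which
  has a simple zero at 0 and therefore preserves the order.\<close>

lemma fls_compose_subdegree_bound:
  assumes f: "(\<lambda>t. f (1 / t)) has_laurent_expansion F" and g: "(\<lambda>t. f (1 / t - z)) has_laurent_expansion G"
  shows "fls_subdegree G = fls_subdegree F"
proof -
  define H where "H = fps_X / (1 - fps_const z * fps_X)"
  have H: "H = fps_X * inverse (1 - fps_const z * fps_X)"
    unfolding H_def by (rule fps_divide_unit) simp
  have "(\<lambda>t. t * inverse (1 - z * t)) has_fps_expansion H"
    unfolding H by (intro fps_expansion_intros) auto
  then have h: "(\<lambda>t. t * inverse (1 - z * t)) has_laurent_expansion fps_to_fls H" by (rule has_laurent_expansion_fps)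
  have H1: "subdegree H = 1" unfolding H
    by (subst subdegree_mult) (auto simp: subdegree_eq_0_iff)
  have "H \<noteq> 0" "fps_nth H 0 = 0" using H1 by (auto simp: H)
  from has_laurent_expansion_compose[OF f h this(2,1)]
  have "(\<lambda>t. f (1 / (t * inverse (1 - z * t)))) has_laurent_expansion fls_compose_fps F H" by (simp add: o_def)
  moreover have "eventually (\<lambda>t. f (1 / (t * inverse (1 - z * t))) = f (1 / t - z)) (at 0)"
  proof -
    have "finite {0, 1 / z}" by simp
    from finite_eventually_at[OF this, of 0] show ?thesis
    proof (rule eventually_mono)
      fix t assume "t \<notin> {0, 1 / z}"
      then have "t \<noteq> 0" "1 - z * t \<noteq> 0" using z by (auto simp: field_simps)
      then have "1 / (t * inverse (1 - z * t)) = 1 / t - z" by (simp add: field_simps)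
      then show "f (1 / (t * inverse (1 - z * t))) = f (1 / t - z)" by simp
    qed
  qed
  ultimately have "(\<lambda>t. f (1 / t - z)) has_laurent_expansion fls_compose_fps F H"
    by (subst (asm) has_laurent_expansion_cong) auto
  with g have "G = fls_compose_fps F H" by (rule has_laurent_expansion_unique)
  moreover have "fls_subdegree (fls_compose_fps F H) = fls_subdegree F * subdegree H"
    by (rule subdegree_fls_compose_fps) (use \<open>fps_nth H 0 = 0\<close> in auto)
  ultimately show ?thesis using H1 by simp
qed

end

lemma fls_subdegree_powi_mult:
  fixes A B C :: "complex fls"
  assumes "A \<noteq> 0" "B \<noteq> 0" "C \<noteq> 0"
  shows "fls_subdegree (A powi p * B powi q * C) = p * fls_subdegree A + q * fls_subdegree B + fls_subdegree C"
proof -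
  have *: "fls_subdegree (F * G * C) = fls_subdegree F + fls_subdegree G + fls_subdegree C"
    if "F \<noteq> 0" "G \<noteq> 0" for F G :: "complex fls" using that assms(3) by simp
  show ?thesis by (subst *) (use assms in auto)
qed

context module_translation
begin

text \<open>The function in the defining condition and \<open>rat\<close> agree with one
  \<open>combination\<close> up to finitely many points, hence have the same expansions; this
  transfers the pole bounds, with \<open>M\<close> and \<open>N\<close> uniform in \<open>w\<close>.
  The last clause is the residue theorem.\<close>

lemma Qz_functionals_expansions:
  assumes \<alpha>: "\<alpha> \<in> Qz_functionals Y z"
  obtains M N \<Phi> \<Psi> where
    "\<And>w. (\<lambda>x. rat \<alpha> v w (x - z)) has_laurent_expansion \<Phi> w"
    "\<And>w. (\<lambda>t. rat \<alpha> v w (1 / t - z)) has_laurent_expansion \<Psi> w"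
    "\<And>w n. n < - int M \<Longrightarrow> fls_nth (\<Phi> w) n = 0"
    "\<And>w. \<Psi> w \<noteq> 0 \<Longrightarrow> fls_subdegree (\<Psi> w) \<ge> - int N"
    "\<And>w p q. \<alpha> (U v p q w) = fls_nth ((fls_X_inv - fls_const z) powi p * fls_X_inv powi q * \<Psi> w) 1
       - fls_nth ((fls_X - fls_const z) powi p * fls_X powi q * \<Phi> w) (-1)"
proof -
  have lin: "clinear \<alpha>" using \<alpha> by (simp add: Qz_functionals_def)
  obtain M N where *: "\<forall>w. \<exists>f \<in> Qz_ring z.
        (\<forall>x. 0 < norm x \<longrightarrow> norm x < norm z \<longrightarrow>
           (\<lambda>m. norm (matrix_coeff Y \<alpha> v w m * x powi m)) summable_on UNIV \<and>
           ((\<lambda>m. matrix_coeff Y \<alpha> v w m * x powi m) has_sum f x) UNIV) \<and>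
        pole_order f (-z) \<le> M \<and> pole_order_infinity f \<le> N"
    using \<alpha> unfolding Qz_functionals_def by blast
  have "\<exists>\<Phi> \<Psi>. (\<lambda>x. rat \<alpha> v w (x - z)) has_laurent_expansion \<Phi> \<and>
    (\<lambda>t. rat \<alpha> v w (1 / t - z)) has_laurent_expansion \<Psi> \<and>
    (\<forall>n < - int M. fls_nth \<Phi> n = 0) \<and> (\<Psi> \<noteq> 0 \<longrightarrow> fls_subdegree \<Psi> \<ge> - int N) \<and>
    (\<forall>p q. \<alpha> (U v p q w) = fls_nth ((fls_X_inv - fls_const z) powi p * fls_X_inv powi q * \<Psi>) 1
       - fls_nth ((fls_X - fls_const z) powi p * fls_X powi q * \<Phi>) (-1))" for w
  proof -
    obtain f where f: "f \<in> Qz_ring z"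
      and s: "\<And>x. 0 < norm x \<Longrightarrow> norm x < norm z \<Longrightarrow> ((\<lambda>m. matrix_coeff Y \<alpha> v w m * x powi m) has_sum f x) UNIV"
      and po: "pole_order f (-z) \<le> M" "pole_order_infinity f \<le> N" using * by blast
    from Qz_witness[OF lin f s] obtain c d k l where
      fin: "finite {y. rat \<alpha> v w y \<noteq> combination c d (int k) (int l) y (y + z) id}"
        "finite {y. f y \<noteq> combination c d (int k) (int l) y (y + z) id}"
      and mat: "matrix_fls \<alpha> v w = combination c d (int k) (int l) fls_X (fls_X + fls_const z) fls_const" by blast
    let ?\<Phi> = "combination c d (int k) (int l) (fls_X - fls_const z) fls_X fls_const"
    let ?\<Psi> = "combination c d (int k) (int l) (fls_X_inv - fls_const z) fls_X_inv fls_const"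
    let ?\<Psi>' = "combination c d (int k) (int l) fls_X_inv (fls_X_inv + fls_const z) fls_const"
    have "laurent_expansion f (- z) = ?\<Phi>"
      by (rule laurent_expansion_eqI) (use combination_expansions(1)[OF fin(2)] in simp)
    then have 1: "\<forall>n < - int M. fls_nth ?\<Phi> n = 0" using po(1) by (simp add: pole_order_le_iff)
    have "laurent_expansion (\<lambda>t. f (1 / t)) 0 = ?\<Psi>'"
      by (rule laurent_expansion_0_eqI[OF combination_expansions(3)[OF fin(2)]])
    then have "- int N \<le> fls_subdegree ?\<Psi>'"
      using po(2) by (simp add: pole_order_infinity_def pole_order_def)
    moreover have "fls_subdegree ?\<Psi> = fls_subdegree ?\<Psi>'"
      by (rule fls_compose_subdegree_bound[OF combination_expansions(3,2)[OF fin(2)]])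
    ultimately have 2: "fls_subdegree ?\<Psi> \<ge> - int N" by simp
    have 3: "\<alpha> (U v p q w) = fls_nth ((fls_X_inv - fls_const z) powi p * fls_X_inv powi q * ?\<Psi>) 1
       - fls_nth ((fls_X - fls_const z) powi p * fls_X powi q * ?\<Phi>) (-1)" for p q
      unfolding functional_U[OF lin] mat by (rule combination_residue_sum[OF z])
    show ?thesis using combination_expansions(1,2)[OF fin(1)] 1 2 3 by blast
  qed
  then show ?thesis using that by metis
qed

lemma Lq_Rq_properties:
  assumes \<alpha>: "\<alpha> \<in> Qz_functionals Y z"
  shows "\<alpha> (U v p q w) = Lq v p q \<alpha> w - Rq v p q \<alpha> w"
    and "pascal z (\<lambda>p q. Lq v p q \<alpha>)" "pascal z (\<lambda>p q. Rq v p q \<alpha>)"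
    and "vanishes_inf (\<lambda>p q. Lq v p q \<alpha>)" "vanishes_z (\<lambda>p q. Rq v p q \<alpha>)"
    and "Lq v 0 n \<alpha> = YL_Q_opposite Y z v n \<alpha>" "Rq v 0 n \<alpha> = YR_Q Y z v n \<alpha>"
proof -
  obtain M N \<Phi> \<Psi> where
    e: "\<And>w. (\<lambda>x. rat \<alpha> v w (x - z)) has_laurent_expansion \<Phi> w"
      "\<And>w. (\<lambda>t. rat \<alpha> v w (1 / t - z)) has_laurent_expansion \<Psi> w"
    and b: "\<And>w n. n < - int M \<Longrightarrow> fls_nth (\<Phi> w) n = 0"
      "\<And>w. \<Psi> w \<noteq> 0 \<Longrightarrow> fls_subdegree (\<Psi> w) \<ge> - int N"
    and d: "\<And>w p q. \<alpha> (U v p q w) = fls_nth ((fls_X_inv - fls_const z) powi p * fls_X_inv powi q * \<Psi> w) 1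
       - fls_nth ((fls_X - fls_const z) powi p * fls_X powi q * \<Phi> w) (-1)"
    by (rule Qz_functionals_expansions[OF \<alpha>, of v]) (rule that, assumption+)
  note L = Lq_eq[OF e(2)] and R = Rq_eq[OF e(1)]
  show "\<alpha> (U v p q w) = Lq v p q \<alpha> w - Rq v p q \<alpha> w" unfolding L R by (rule d)
  have PL: "pascal z (\<lambda>p q. Lq v p q \<alpha> w)" for w
    unfolding L by (rule pascal_fls) (use nz[OF z] in auto)
  have PR: "pascal z (\<lambda>p q. Rq v p q \<alpha> w)" for w
    unfolding R by (rule pascal_fls) (use nz[OF z] in auto)
  show "pascal z (\<lambda>p q. Lq v p q \<alpha>)" "pascal z (\<lambda>p q. Rq v p q \<alpha>)"
    using PL PR by (simp_all add: pascal_def fun_eq_iff scaleC_apply)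
  \<comment> \<open>The series then starts at index 2 or later, past the coefficient 1 that defines
    \<open>Lq\<close>.\<close>
  have "Lq v p q \<alpha> = 0" if "p + q \<le> - int N - 2" for p q
  proof
    fix w
    show "Lq v p q \<alpha> w = 0 w"
    proof (cases "\<Psi> w = 0")
      case False
      have "fls_subdegree ((fls_X_inv - fls_const z) powi p * fls_X_inv powi q * \<Psi> w) = - p - q + fls_subdegree (\<Psi> w)"
        unfolding fls_subdegree_powi_mult[OF nz(6,5)[OF z] False] subdegree_Yi[OF z] by simp
      then show ?thesis unfolding L zero_fun_def using b(2)[OF False] that
        by (intro fls_eq0_below_subdegree) simp
    qed (simp add: L)
  qed
  then show "vanishes_inf (\<lambda>p q. Lq v p q \<alpha>)" unfolding vanishes_inf_def by blast
  \<comment> \<open>The factor of order \<open>q\<close> cancels the pole, so there is no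
    coefficient at index -1.\<close>
  have "Rq v p q \<alpha> = 0" if "q \<ge> int M" for p q
  proof
    fix w
    show "Rq v p q \<alpha> w = 0 w"
    proof (cases "\<Phi> w = 0")
      case False
      have "- int M \<le> fls_subdegree (\<Phi> w)" by (rule fls_subdegree_geI[OF False]) (rule b(1))
      moreover have "fls_subdegree ((fls_X - fls_const z) powi p * fls_X powi q * \<Phi> w) = q + fls_subdegree (\<Phi> w)"
        unfolding fls_subdegree_powi_mult[OF nz(4,3)[OF z] False] subdegree_Yz[OF z] by simp
      ultimately show ?thesis unfolding R zero_fun_def using that
        by (intro fls_eq0_below_subdegree) simp
    qed (simp add: R)
  qed
  then show "vanishes_z (\<lambda>p q. Rq v p q \<alpha>)" unfolding vanishes_z_def by blast
  show "Rq v 0 n \<alpha> = YR_Q Y z v n \<alpha>"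
  proof
    fix w
    have "YR_Q Y z v n \<alpha> w = fls_nth (\<Phi> w) (- n - 1)"
      using iota_zero_eq[OF e(1)] by (simp add: YR_Q_def rat_def)
    moreover have "Rq v 0 n \<alpha> w = fls_nth (\<Phi> w) (- 1 - n)"
      by (simp add: R fls_X_intpow_times_conv_shift)
    moreover have "- 1 - n = - n - 1" by simp
    ultimately show "Rq v 0 n \<alpha> w = YR_Q Y z v n \<alpha> w" by metis
  qed
  show "Lq v 0 n \<alpha> = YL_Q_opposite Y z v n \<alpha>"
  proof
    fix w
    have "YL_Q_opposite Y z v n \<alpha> w = fls_nth (\<Psi> w) (- (- n - 1))"
      unfolding YL_Q_opposite_def rat_def[symmetric]
      by (rule iota_infinity_eq[where f = "\<lambda>x. rat \<alpha> v w (x - z)", OF e(2)])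
    then show "Lq v 0 n \<alpha> w = YL_Q_opposite Y z v n \<alpha> w"
      by (simp only: L power_int_0_right mult_1 Xi_powi[OF z] fls_X_intpow_times_conv_shift) (simp add: add.commute)
  qed
qed

lemma combination_holomorphic:
  "(\<lambda>y. combination c d k l y (y + z) id) holomorphic_on ball 0 (norm z) - {0}"
proof -
  have "y + z \<noteq> 0" if "norm y < norm z" for y
    using that by (auto simp: add_eq_0_iff2)
  then show ?thesis unfolding combination_def id_def by (intro holomorphic_intros) auto
qed

lemma combination_Qz_ring:
  "(\<lambda>y. combination c d (int k) (int l) y (y + z) id) \<in> Qz_ring z"
proof -
  have "combination c d (int k) (int l) y (y + z) id = poly (\<Sum>j\<le>d. monom (c j) j) y / (y ^ k * (y + z) ^ l)"
    if "y \<noteq> 0" "y \<noteq> - z" for y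
  proof -
    have "y + z \<noteq> 0" using that by (simp add: add_eq_0_iff2)
    then show ?thesis unfolding combination_def poly_sum sum_divide_distrib poly_monom
      using that by (intro sum.cong) (auto simp: power_int_diff power_int_minus field_simps)
  qed
  then show ?thesis unfolding Qz_ring_def by blast
qed

lemma combination_nth_vanish:
  assumes "Yv \<noteq> 0" "Xv \<noteq> 0"
    and "\<And>j. j \<le> d \<Longrightarrow> n < fls_subdegree Yv * (int j - k) - fls_subdegree Xv * l"
  shows "fls_nth (combination c d k l Yv Xv fls_const) n = 0"
  using assms combination_nth[OF z, of Yv Xv 0 0 c d k l n]
  by (auto intro!: sum.neutral fls_eq0_below_subdegree simp: algebra_simps)

text \<open>The coefficients of \<open>(y + z)^N\<close> times the matrix coefficient are values of
  \<open>\<alpha>\<close> on \<open>U\<close> and vanish in high degree by assumption. The product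
  is thus a Laurent polynomial of degree bounded uniformly in \<open>w\<close>; dividing by
  \<open>(y + z)^N\<close> gives the rational function and its pole bounds.\<close>

lemma Qz_functionalsI:
  assumes lin: "clinear \<alpha>"
    and van: "\<And>v. \<exists>N. \<forall>p q w. q \<ge> N \<longrightarrow> p + q \<le> - N \<longrightarrow> \<alpha> (U v p q w) = 0"
  shows "\<alpha> \<in> Qz_functionals Y z"
  unfolding Qz_functionals_def
proof (intro CollectI conjI allI)
  have a0: "\<alpha> 0 = 0" by (rule linear_zero[OF lin])
  show "clinear \<alpha>" by (rule lin)
  fix v
  obtain N0 where N0: "\<And>p q w. q \<ge> N0 \<Longrightarrow> p + q \<le> - N0 \<Longrightarrow> \<alpha> (U v p q w) = 0" using van by blast
  define N where "N = nat N0"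
  have N: "\<alpha> (U v p (int N) w) = 0" if "p + 2 * int N \<le> 0" for p w
    by (rule N0) (use that in \<open>auto simp: N_def split: if_splits\<close>)
  have "\<exists>f\<in>Qz_ring z. (\<forall>x. 0 < norm x \<longrightarrow> norm x < norm z \<longrightarrow>
           (\<lambda>m. norm (matrix_coeff Y \<alpha> v w m * x powi m)) summable_on UNIV \<and>
           ((\<lambda>m. matrix_coeff Y \<alpha> v w m * x powi m) has_sum f x) UNIV) \<and>
        pole_order f (-z) \<le> N \<and> pole_order_infinity f \<le> 2 * N" for w
  proof -
    define B where "B = (fls_X + fls_const z) powi int N * matrix_fls \<alpha> v w"
    have B: "fls_nth B m = \<alpha> (U v (- m - 1) (int N) w)" for m
    proof -
      have "fls_nth (fls_X powi (- m - 1) * G) (-1) = fls_nth G m" for G :: "complex fls"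
        unfolding fls_X_power_int fls_X_intpow_times_conv_shift by simp
      then show ?thesis unfolding functional_U[OF lin] B_def mult.assoc by simp
    qed
    have B_top: "fls_nth B m = 0" if "m \<ge> 2 * int N" for m
      unfolding B by (rule N) (use that in simp)
    define k where "k = nat (- fls_subdegree B)"
    have B_bot: "fls_nth B m = 0" if "m < - int k" for m
      by (rule fls_eq0_below_subdegree) (use that in \<open>auto simp: k_def split: if_splits\<close>)
    \<comment> \<open>The coefficients of the Laurent polynomial \<open>B\<close>, from degree
      \<open>-k\<close>, which depends on \<open>w\<close>, up to degree \<open>2 N\<close>, which
      does not.\<close>
    define c where "c j = fls_nth B (int j - int k)" for j
    define f where "f y = combination c (k + 2 * N) (int k) (int N) y (y + z) id" for y
    have "B = (\<Sum>j\<le>k + 2 * N. fls_const (c j) * fls_X powi (int j - int k))"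
    proof (rule fls_eqI)
      fix m
      have "fls_nth (\<Sum>j\<le>k + 2 * N. fls_const (c j) * fls_X powi (int j - int k)) m
        = (\<Sum>j\<le>k + 2 * N. if int j - int k = m then fls_nth B m else 0)"
        unfolding fls_nth_sum fls_nth_const_mult by (intro sum.cong) (auto simp: c_def)
      also have "\<dots> = fls_nth B m"
      proof (cases "- int k \<le> m \<and> m \<le> 2 * int N")
        case True
        then have "(\<Sum>j\<le>k + 2 * N. if int j - int k = m then fls_nth B m else 0) =
          (\<Sum>j\<in>{nat (m + int k)}. if int j - int k = m then fls_nth B m else 0)"
          by (intro sum.mono_neutral_right) auto
        then show ?thesis using True by simp
      next
        case False
        then have "fls_nth B m = 0" using B_top[of m] B_bot[of m] by force
        then show ?thesis by (simp cong: if_cong)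
      qed
      finally show "fls_nth B m = fls_nth (\<Sum>j\<le>k + 2 * N. fls_const (c j) * fls_X powi (int j - int k)) m" ..
    qed
    moreover have "matrix_fls \<alpha> v w = B * (fls_X + fls_const z) powi (- int N)"
      using nz(1)[OF z] by (simp add: B_def power_int_minus field_simps)
    ultimately have A: "matrix_fls \<alpha> v w = combination c (k + 2 * N) (int k) (int N) fls_X (fls_X + fls_const z) fls_const"
      by (simp add: combination_def sum_distrib_right mult.assoc)
    have fl: "f has_laurent_expansion matrix_fls \<alpha> v w"
      unfolding A f_def by (intro combination_laurent[OF z] laurent_expansion_intros)
    have hol: "f holomorphic_on ball 0 (norm z) - {0}"
      unfolding f_def by (rule combination_holomorphic)
    have fin: "finite {y. f y \<noteq> combination c (k + 2 * N) (int k) (int N) y (y + z) id}" by (simp add: f_def)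
    show ?thesis
    proof (intro bexI conjI allI impI)
      show "f \<in> Qz_ring z" unfolding f_def by (rule combination_Qz_ring)
      fix x :: complex assume x: "0 < norm x" "norm x < norm z"
      show "(\<lambda>m. norm (matrix_coeff Y \<alpha> v w m * x powi m)) summable_on UNIV"
        "((\<lambda>m. matrix_coeff Y \<alpha> v w m * x powi m) has_sum f x) UNIV"
        using has_sum_of_laurent[OF fl hol x] by (simp_all add: matrix_fls_nth[where \<alpha> = \<alpha>, OF a0])
    next
      have "laurent_expansion f (- z) = combination c (k + 2 * N) (int k) (int N) (fls_X - fls_const z) fls_X fls_const"
        by (rule laurent_expansion_eqI) (use combination_expansions(1)[OF fin] in simp)
      then show "pole_order f (- z) \<le> N" unfolding pole_order_le_iff
        by (auto intro!: combination_nth_vanish[OF nz(4,3)[OF z]] simp: subdegree_Yz[OF z])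
      have "laurent_expansion (\<lambda>t. f (1 / t)) 0 =
        combination c (k + 2 * N) (int k) (int N) fls_X_inv (fls_X_inv + fls_const z) fls_const"
        by (rule laurent_expansion_0_eqI[OF combination_expansions(3)[OF fin]])
      moreover have "fls_subdegree (fls_X_inv + fls_const z) = -1" by (rule fls_subdegree_eqI) auto
      moreover from this have "fls_X_inv + fls_const z \<noteq> 0" by fastforce
      ultimately show "pole_order_infinity f \<le> 2 * N" unfolding pole_order_infinity_def pole_order_le_iff
        by (auto intro!: combination_nth_vanish)
    qed
  qed
  then show "\<exists>M N. \<forall>w. \<exists>f\<in>Qz_ring z. (\<forall>x. 0 < norm x \<longrightarrow> norm x < norm z \<longrightarrow>
           (\<lambda>m. norm (matrix_coeff Y \<alpha> v w m * x powi m)) summable_on UNIV \<and>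
           ((\<lambda>m. matrix_coeff Y \<alpha> v w m * x powi m) has_sum f x) UNIV) \<and>
        pole_order f (-z) \<le> M \<and> pole_order_infinity f \<le> N" by blast
qed

text \<open>The bridge from analysis to arrays: the theorems on \<open>D\<close>, \<open>L\<close>
  and \<open>R\<close> now apply to expansions of rational functions.\<close>

sublocale functional_decomposition V Y z "Qz_functionals Y z" Lq Rq
proof
  show "\<alpha> \<in> Qz_functionals Y z \<longleftrightarrow>
    clinear \<alpha> \<and> (\<forall>v. \<exists>N. \<forall>p q w. q \<ge> N \<longrightarrow> p + q \<le> - N \<longrightarrow> \<alpha> (U v p q w) = 0)" for \<alpha>
  proof
    assume \<alpha>: "\<alpha> \<in> Qz_functionals Y z"
    have "\<exists>N. \<forall>p q w. q \<ge> N \<longrightarrow> p + q \<le> - N \<longrightarrow> \<alpha> (U v p q w) = 0" for v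
    proof -
      obtain M where M: "\<And>p q. p + q \<le> M \<Longrightarrow> Lq v p q \<alpha> = 0"
        using Lq_Rq_properties(4)[OF \<alpha>, of v] unfolding vanishes_inf_def by blast
      obtain N where N: "\<And>p q. q \<ge> N \<Longrightarrow> Rq v p q \<alpha> = 0"
        using Lq_Rq_properties(5)[OF \<alpha>, of v] unfolding vanishes_z_def by blast
      have "\<alpha> (U v p q w) = 0" if "q \<ge> max N (- M)" "p + q \<le> - max N (- M)" for p q w
        using that by (simp add: Lq_Rq_properties(1)[OF \<alpha>] M N)
      then show ?thesis by blast
    qed
    then show "clinear \<alpha> \<and> (\<forall>v. \<exists>N. \<forall>p q w. q \<ge> N \<longrightarrow> p + q \<le> - N \<longrightarrow> \<alpha> (U v p q w) = 0)"
      using \<alpha> by (simp add: Qz_functionals_def)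
  next
    assume "clinear \<alpha> \<and> (\<forall>v. \<exists>N. \<forall>p q w. q \<ge> N \<longrightarrow> p + q \<le> - N \<longrightarrow> \<alpha> (U v p q w) = 0)"
    then show "\<alpha> \<in> Qz_functionals Y z" using Qz_functionalsI[of \<alpha>] by simp
  qed
qed (rule Lq_Rq_properties; assumption)+

text \<open>The matrix coefficient of the vacuum is the constant \<open>\<alpha> w\<close>, which
  has the same expansion at every point.\<close>

lemma Lq_Rq_vacuum:
  assumes \<alpha>: "\<alpha> \<in> Qz_functionals Y z"
  shows "Rq (vac V) 0 n \<alpha> = (if n = -1 then \<alpha> else 0)" "Lq (vac V) 0 n \<alpha> = (if n = -1 then \<alpha> else 0)"
proof -
  have a0: "\<alpha> 0 = 0" using \<alpha> by (rule D_linear)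
  have fin: "finite {y. rat \<alpha> (vac V) w y \<noteq> \<alpha> w}" for w
    unfolding rat_def
  proof (rule iota_zero_inverse_cofinite)
    show "(\<lambda>_. \<alpha> w) \<in> rational_functions" unfolding rational_functions_iff
      by (intro exI[of _ "[:\<alpha> w:]"] exI[of _ 1]) simp
    show "iota_zero (\<lambda>_. \<alpha> w) = matrix_coeff Y \<alpha> (vac V) w"
      using iota_zero_eq[OF has_laurent_expansion_const] by (auto simp: matrix_coeff_def vacuum a0)
  qed
  have i: "inj (\<lambda>x::complex. x - z)" "inj (\<lambda>t::complex. 1 / t - z)" by (auto simp: inj_def)
  have e1: "(\<lambda>x. rat \<alpha> (vac V) w (x - z)) has_laurent_expansion fls_const (\<alpha> w)" for w
    by (subst has_laurent_expansion_cong[OF cofinite_eq_eventually[OF cofinite_eq_comp[OF fin i(1)]] refl]) simp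
  have e2: "(\<lambda>t. rat \<alpha> (vac V) w (1 / t - z)) has_laurent_expansion fls_const (\<alpha> w)" for w
    by (subst has_laurent_expansion_cong[OF cofinite_eq_eventually[OF cofinite_eq_comp[OF fin i(2)]] refl]) simp
  show "Rq (vac V) 0 n \<alpha> = (if n = -1 then \<alpha> else 0)"
    by (auto simp: fun_eq_iff Rq_eq[OF e1] fls_X_intpow_times_conv_shift)
  show "Lq (vac V) 0 n \<alpha> = (if n = -1 then \<alpha> else 0)"
    by (auto simp: fun_eq_iff Lq_eq[OF e2] Xi_powi[OF z] fls_X_intpow_times_conv_shift)
qed

end

section \<open>Opposite vertex operators\<close>

lemma finite_support_sum:
  "finite A \<Longrightarrow> (\<And>j. j \<in> A \<Longrightarrow> finite {i. f j i \<noteq> 0}) \<Longrightarrow> finite {i. (\<Sum>j\<in>A. f j i) \<noteq> (0::'b::comm_monoid_add)}"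
proof (rule finite_subset[of _ "\<Union>j\<in>A. {i. f j i \<noteq> 0}"])
  have "(\<Sum>j\<in>A. f j i) = 0" if "\<forall>j\<in>A. f j i = 0" for i using that by (rule sum.neutral)
  then show "{i. (\<Sum>j\<in>A. f j i) \<noteq> 0} \<subseteq> (\<Union>j\<in>A. {i. f j i \<noteq> 0})" by blast
qed simp

lemma antidiag_finite_sum:
  assumes "finite A" "\<And>j. j \<in> A \<Longrightarrow> antidiag_finite (f j)"
  shows "antidiag_finite (\<lambda>m n. \<Sum>j\<in>A. f j m n :: 'b::comm_monoid_add)"
  unfolding antidiag_finite_def
  by (intro allI finite_support_sum) (use assms in \<open>auto simp: antidiag_finite_def\<close>)

lemma diff_pow_zero: "diff_pow l (\<lambda>m n. 0) m n = 0"
  by (simp add: diff_pow_vanish)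

lemma diff_pow_sum:
  assumes "finite A" "\<And>j. j \<in> A \<Longrightarrow> antidiag_finite (f j)"
  shows "diff_pow l (\<lambda>m n. \<Sum>j\<in>A. f j m n) m n = (\<Sum>j\<in>A. diff_pow l (f j) m n)"
  using assms
proof (induction A rule: finite_induct)
  case empty
  show ?case by (simp add: diff_pow_zero)
next
  case (insert a A)
  then show ?case by (simp add: diff_pow_add antidiag_finite_sum)
qed

text \<open>Indexes the part of degree \<open>k\<close> in a product of three series in
  \<open>x\<close>: \<open>j\<close> and \<open>t\<close> count powers of \<open>L(1)\<close> on the
  two vectors, \<open>s\<close> comes from a binomial expansion.\<close>

definition triples :: "nat \<Rightarrow> (nat \<times> nat \<times> nat) set" where
  "triples k = {(j, s, t). j + s + t = k}"

lemma finite_triples [simp]: "finite (triples k)"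
  by (rule finite_subset[of _ "{..k} \<times> {..k} \<times> {..k}"]) (auto simp: triples_def)

lemma triples_0: "triples 0 = {(0, 0, 0)}" by (auto simp: triples_def)

text \<open>An index shift in one component; as \<open>F\<close> vanishes where that component is 0,
  no boundary terms arise.\<close>

lemma sum_triples_Suc:
  fixes F :: "nat \<Rightarrow> nat \<Rightarrow> nat \<Rightarrow> 'b::comm_monoid_add"
  shows "(\<And>j s. F j s 0 = 0) \<Longrightarrow> (\<Sum>(j, s, t)\<in>triples k. F j s (Suc t)) = (\<Sum>(j, s, t)\<in>triples (Suc k). F j s t)"
    and "(\<And>j t. F j 0 t = 0) \<Longrightarrow> (\<Sum>(j, s, t)\<in>triples k. F j (Suc s) t) = (\<Sum>(j, s, t)\<in>triples (Suc k). F j s t)"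
    and "(\<And>s t. F 0 s t = 0) \<Longrightarrow> (\<Sum>(j, s, t)\<in>triples k. F (Suc j) s t) = (\<Sum>(j, s, t)\<in>triples (Suc k). F j s t)"
proof -
  assume z: "\<And>j s. F j s 0 = 0"
  show "(\<Sum>(j, s, t)\<in>triples k. F j s (Suc t)) = (\<Sum>(j, s, t)\<in>triples (Suc k). F j s t)"
    by (rule sum.reindex_bij_witness_not_neutral[of "{}" "{(j, s, t). t = 0} \<inter> triples (Suc k)"
          _ "\<lambda>(j, s, t). (j, s, t - 1)" "\<lambda>(j, s, t). (j, s, Suc t)"])
       (auto simp: triples_def z intro: finite_subset[OF _ finite_triples[of "Suc k"]])
next
  assume z: "\<And>j t. F j 0 t = 0"
  show "(\<Sum>(j, s, t)\<in>triples k. F j (Suc s) t) = (\<Sum>(j, s, t)\<in>triples (Suc k). F j s t)"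
    by (rule sum.reindex_bij_witness_not_neutral[of "{}" "{(j, s, t). s = 0} \<inter> triples (Suc k)"
          _ "\<lambda>(j, s, t). (j, s - 1, t)" "\<lambda>(j, s, t). (j, Suc s, t)"])
       (auto simp: triples_def z intro: finite_subset[OF _ finite_triples[of "Suc k"]])
next
  assume z: "\<And>s t. F 0 s t = 0"
  show "(\<Sum>(j, s, t)\<in>triples k. F (Suc j) s t) = (\<Sum>(j, s, t)\<in>triples (Suc k). F j s t)"
    by (rule sum.reindex_bij_witness_not_neutral[of "{}" "{(j, s, t). j = 0} \<inter> triples (Suc k)"
          _ "\<lambda>(j, s, t). (j - 1, s, t)" "\<lambda>(j, s, t). (Suc j, s, t)"])
       (auto simp: triples_def z intro: finite_subset[OF _ finite_triples[of "Suc k"]])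
qed

lemma sum_triples_box:
  fixes F :: "nat \<Rightarrow> nat \<Rightarrow> nat \<Rightarrow> 'b::comm_monoid_add"
  assumes "J + S + T \<le> K" "\<And>j s t. j \<ge> J \<or> s \<ge> S \<or> t \<ge> T \<Longrightarrow> F j s t = 0"
  shows "(\<Sum>k<K. \<Sum>(j, s, t)\<in>triples k. F j s t) = (\<Sum>j<J. \<Sum>t<T. \<Sum>s<S. F j s t)"
proof -
  have "(\<Sum>k<K. \<Sum>(j, s, t)\<in>triples k. F j s t) = (\<Sum>(j, s, t)\<in>(\<Union>k<K. triples k). F j s t)"
    by (rule sum.UNION_disjoint[symmetric]) (simp, simp, auto simp: triples_def)
  also have "\<dots> = (\<Sum>(j, s, t)\<in>{..<J} \<times> {..<S} \<times> {..<T}. F j s t)"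
  proof (rule sum.mono_neutral_right)
    show "{..<J} \<times> {..<S} \<times> {..<T} \<subseteq> (\<Union>k<K. triples k)" using assms(1) by (auto simp: triples_def)
    show "\<forall>x\<in>(\<Union>k<K. triples k) - {..<J} \<times> {..<S} \<times> {..<T}. (case x of (j, s, t) \<Rightarrow> F j s t) = 0"
      by (auto intro!: assms(2) simp: not_less)
  qed auto
  also have "\<dots> = (\<Sum>j<J. \<Sum>s<S. \<Sum>t<T. F j s t)"
    by (simp only: sum.cartesian_product)
  also have "\<dots> = (\<Sum>j<J. \<Sum>t<T. \<Sum>s<S. F j s t)"
    by (intro sum.cong refl sum.swap)
  finally show ?thesis .
qed

section \<open>Gradings and conjugation by the exponential of \<open>L(1)\<close>\<close>

context vertex_operator_algebra
begin

lemma vop_linear [simp]: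
  "vop V (u + v) n w = vop V u n w + vop V v n w" "vop V (c *\<^sub>C u) n w = c *\<^sub>C vop V u n w"
  "vop V u n (w + w') = vop V u n w + vop V u n w'" "vop V u n (c *\<^sub>C w) = c *\<^sub>C vop V u n w"
  by (simp_all add: add_left scale_left add_right scale_right)

lemma vop_zero [simp]: "vop V 0 n w = 0" "vop V u n 0 = 0"
  using scale_left[of w 0 0 n] scale_right[of 0 u n 0] by simp_all

lemma vop_truncation: "\<exists>N. \<forall>n\<ge>N. vop V u n v = 0"
  using truncation by simp

lemma virasoro_linear [simp]:
  "virasoro V n (u + v) = virasoro V n u + virasoro V n v" "virasoro V n (c *\<^sub>C v) = c *\<^sub>C virasoro V n v"
  "virasoro V n 0 = 0"
  by (simp_all add: virasoro_def)

text \<open>The Jacobi identity with \<open>l = 0\<close> for the modes 1 and 2 of the conformal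
  vector, which are \<open>L(0)\<close> and \<open>L(1)\<close>; the term with
  \<open>L(-1) u\<close> is rewritten by the derivative property.\<close>

lemma virasoro_commutator:
  "virasoro V 0 (vop V u n w) = vop V u n (virasoro V 0 w) - of_int (n + 1) *\<^sub>C vop V u n w + vop V (virasoro V 0 u) n w"
  "virasoro V 1 (vop V u n w) = vop V u n (virasoro V 1 w) - of_int (n + 2) *\<^sub>C vop V u (n + 1) w
     + 2 *\<^sub>C vop V (virasoro V 0 u) (n + 1) w + vop V (virasoro V 1 u) n w"
proof -
  obtain N where N: "\<And>c. c \<ge> N \<Longrightarrow> vop V (conf V) c u = 0" using vop_truncation by blast
  define g where "g c d = vop V (vop V (conf V) c u) d w" for c d
  have g: "\<And>c d. c \<ge> N \<Longrightarrow> g c d = 0" by (simp add: g_def N)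
  have s: "shift_pow l g (m + 1) n = shift_pow (l + 1) g m n + shift_pow l g m (n + 1)" for l m n
    using shift_pow_Suc[OF g, of N] by simp
  have 1: "shift_pow 0 g 1 n = g 1 n + g 0 (n + 1)" for n
    using s[of 0 0 n] by simp
  have 2: "shift_pow 0 g 2 n = g 2 n + 2 *\<^sub>C g 1 (n + 1) + g 0 (n + 2)"
  proof -
    have "(2::complex) *\<^sub>C x = x + x" for x :: 'v
      using scaleC_add_left[of 1 1 x] by (simp add: scaleC_one)
    then show ?thesis using s[of 0 1 n] s[of 1 0 n] 1[of "n + 1"] by (simp add: algebra_simps)
  qed
  have L: "g 0 d = - of_int d *\<^sub>C vop V u (d - 1) w" for d
    unfolding g_def using L_minus1_derivative[of u d w] by (simp add: virasoro_def)
  have "vop V (conf V) 1 (vop V u n w) - vop V u n (vop V (conf V) 1 w) = shift_pow 0 g 1 n"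
    using jacobi_diff_pow[of w 0 "conf V" u 1 n] by (simp add: g_def[abs_def] scaleC_one)
  then show "virasoro V 0 (vop V u n w) = vop V u n (virasoro V 0 w) - of_int (n + 1) *\<^sub>C vop V u n w + vop V (virasoro V 0 u) n w"
    unfolding 1 L by (simp add: virasoro_def g_def algebra_simps)
  have "vop V (conf V) 2 (vop V u n w) - vop V u n (vop V (conf V) 2 w) = shift_pow 0 g 2 n"
    using jacobi_diff_pow[of w 0 "conf V" u 2 n] by (simp add: g_def[abs_def] scaleC_one)
  then show "virasoro V 1 (vop V u n w) = vop V u n (virasoro V 1 w) - of_int (n + 2) *\<^sub>C vop V u (n + 1) w
     + 2 *\<^sub>C vop V (virasoro V 0 u) (n + 1) w + vop V (virasoro V 1 u) n w"
    unfolding 2 L by (simp add: virasoro_def g_def algebra_simps)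
qed

lemma grade_0 [simp]: "0 \<in> grade V n"
  using grade_subspace by (rule complex_vector.subspace_0)

lemmas grade_scale = complex_vector.subspace_scale[OF grade_subspace]
  and grade_add = complex_vector.subspace_add[OF grade_subspace]

lemma homogeneous_part:
  "finite {n. homogeneous_part V v n \<noteq> 0}" "homogeneous_part V v n \<in> grade V n"
  "v = Sum_any (homogeneous_part V v)"
  using theI'[OF grade_direct_sum[of v]] unfolding homogeneous_part_def by blast+

lemma homogeneous_part_unique:
  assumes "finite {n. f n \<noteq> 0}" "\<And>n. f n \<in> grade V n" "v = Sum_any f"
  shows "homogeneous_part V v = f"
  unfolding homogeneous_part_def by (rule the1_equality[OF grade_direct_sum]) (use assms in auto)

lemma homogeneous_part_add: "homogeneous_part V (u + v) n = homogeneous_part V u n + homogeneous_part V v n"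
proof -
  have "homogeneous_part V (u + v) = (\<lambda>n. homogeneous_part V u n + homogeneous_part V v n)"
    by (rule homogeneous_part_unique)
       (auto intro!: grade_add finite_support_add homogeneous_part(1,2) simp: Sum_any.distrib[OF homogeneous_part(1) homogeneous_part(1)] homogeneous_part(3)[symmetric])
  then show ?thesis by simp
qed

lemma homogeneous_part_scale: "homogeneous_part V (c *\<^sub>C v) n = c *\<^sub>C homogeneous_part V v n"
proof -
  have "homogeneous_part V (c *\<^sub>C v) = (\<lambda>n. c *\<^sub>C homogeneous_part V v n)"
    by (rule homogeneous_part_unique)
       (auto intro!: grade_scale homogeneous_part(2) simp del: complex_vector.scale_eq_0_iff
         simp: finite_support_scale[OF homogeneous_part(1)] Sum_any_scale[symmetric] homogeneous_part(3)[symmetric])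
  then show ?thesis by simp
qed

lemma homogeneous_part_grade:
  assumes "v \<in> grade V h" shows "homogeneous_part V v n = (if n = h then v else 0)"
proof -
  have "homogeneous_part V v = (\<lambda>n. if n = h then v else 0)"
    by (rule homogeneous_part_unique) (use assms in \<open>auto intro: finite_subset[of _ "{h}"]\<close>)
  then show ?thesis by simp
qed

lemma homogeneous_induct [case_names homogeneous add]:
  assumes "\<And>h v. v \<in> grade V h \<Longrightarrow> P v" "\<And>u v. P u \<Longrightarrow> P v \<Longrightarrow> P (u + v)"
  shows "P v"
proof -
  have "Sum_any (homogeneous_part V v) \<in> {v. P v}"
    by (rule Sum_any_in) (use assms(2) assms(1)[OF homogeneous_part(2)] assms(1)[OF grade_0] in auto)
  then show ?thesis using homogeneous_part(3)[of v] by simp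
qed

text \<open>Decomposing \<open>L(0) v = k v\<close> into homogeneous parts gives
  \<open>n v_n = k v_n\<close>, so only \<open>v_k\<close> survives. Grades are therefore exactly
  the eigenspaces of \<open>L(0)\<close>, and weights can be found from commutators.\<close>

lemma gradeI:
  assumes "virasoro V 0 v = of_int k *\<^sub>C v" shows "v \<in> grade V k"
proof -
  let ?f = "homogeneous_part V v"
  have "virasoro V 0 (Sum_any ?f) = Sum_any (\<lambda>n. virasoro V 0 (?f n))"
    by (rule Sum_any_additive[where W = UNIV]) (auto simp: homogeneous_part(1))
  also have "\<dots> = Sum_any (\<lambda>n. of_int n *\<^sub>C ?f n)"
    by (simp add: L0_grade[OF homogeneous_part(2)])
  finally have L0: "virasoro V 0 v = Sum_any (\<lambda>n. of_int n *\<^sub>C ?f n)" using homogeneous_part(3)[of v] by simp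
  have "of_int k *\<^sub>C v = Sum_any (\<lambda>n. of_int k *\<^sub>C ?f n)"
    unfolding Sum_any_scale[symmetric] homogeneous_part(3)[symmetric] ..
  then have "Sum_any (\<lambda>n. of_int n *\<^sub>C ?f n) = Sum_any (\<lambda>n. of_int k *\<^sub>C ?f n)" using L0 assms by simp
  moreover have "homogeneous_part V (virasoro V 0 v) = (\<lambda>n. of_int n *\<^sub>C ?f n)"
    by (rule homogeneous_part_unique[OF finite_support_scale[OF homogeneous_part(1)] _ L0])
       (intro grade_scale homogeneous_part(2))
  ultimately have "of_int n *\<^sub>C ?f n = of_int k *\<^sub>C ?f n" for n
    using homogeneous_part_scale[of "of_int k" v n] assms by simp
  then have "?f n = 0" if "n \<noteq> k" for n
    using that complex_vector.scale_cancel_right[of "of_int n" "?f n" "of_int k"] by auto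
  then have "Sum_any ?f = ?f k" by (rule Sum_any_single)
  then show ?thesis using homogeneous_part(2)[of v k] homogeneous_part(3)[of v] by simp
qed

lemma vop_grade:
  assumes "u \<in> grade V h" "v \<in> grade V h'" shows "vop V u n v \<in> grade V (h + h' - n - 1)"
  by (rule gradeI) (simp add: virasoro_commutator L0_grade[OF assms(1)] L0_grade[OF assms(2)] algebra_simps)

lemma L1_grade:
  assumes "v \<in> grade V h" shows "virasoro V 1 v \<in> grade V (h - 1)"
proof (rule gradeI)
  obtain c where "\<And>m n v. virasoro V m (virasoro V n v) - virasoro V n (virasoro V m v) =
         of_int (m - n) *\<^sub>C virasoro V (m + n) v
         + (if m + n = 0 then (of_int (m ^ 3 - m) / 12 * c) *\<^sub>C v else 0)" using virasoro_relations by blast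
  from this[of 0 1 v] show "virasoro V 0 (virasoro V 1 v) = of_int (h - 1) *\<^sub>C virasoro V 1 v"
    by (simp add: L0_grade[OF assms] algebra_simps scaleC_one)
qed

text \<open>The divided power, i.e. the coefficient of \<open>x^k\<close> in the exponential of
  \<open>x L(1)\<close>.\<close>

definition L1_div :: "nat \<Rightarrow> 'v \<Rightarrow> 'v" where
  "L1_div k v = (1 / fact k) *\<^sub>C (virasoro V 1 ^^ k) v"

lemma L1_funpow_linear [simp]:
  "(virasoro V 1 ^^ k) (u + v) = (virasoro V 1 ^^ k) u + (virasoro V 1 ^^ k) v"
  "(virasoro V 1 ^^ k) (c *\<^sub>C v) = c *\<^sub>C (virasoro V 1 ^^ k) v"
  "(virasoro V 1 ^^ k) 0 = 0"
  by (induction k) auto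

lemma L1_div_0 [simp]: "L1_div 0 v = v" by (simp add: L1_div_def scaleC_one)

lemma L1_L1_div: "virasoro V 1 (L1_div k v) = of_nat (Suc k) *\<^sub>C L1_div (Suc k) v"
proof -
  have "of_nat (Suc k) * (1 / fact (Suc k)) = (1 / fact k :: complex)"
    unfolding fact_Suc by (simp only: times_divide_eq_right mult_1_right) (simp del: of_nat_Suc)
  then show ?thesis by (simp add: L1_div_def scaleC_scaleC del: of_nat_Suc fact_Suc)
qed

lemma L1_funpow_grade: "v \<in> grade V h \<Longrightarrow> (virasoro V 1 ^^ k) v \<in> grade V (h - int k)"
proof (induction k)
  case (Suc k)
  then show ?case using L1_grade[of "(virasoro V 1 ^^ k) v" "h - int k"] by (simp add: algebra_simps)
qed simp

lemma L1_div_grade: "v \<in> grade V h \<Longrightarrow> L1_div k v \<in> grade V (h - int k)"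
  unfolding L1_div_def by (intro grade_scale L1_funpow_grade)

lemma L1_funpow_nilpotent:
  assumes "v \<in> grade V h" shows "\<exists>K. \<forall>k\<ge>K. (virasoro V 1 ^^ k) v = 0"
proof -
  obtain N where N: "\<And>n. n < N \<Longrightarrow> grade V n = {0}" using grade_bounded_below by blast
  have "(virasoro V 1 ^^ k) v = 0" if "k \<ge> nat (h - N + 1)" for k
    using L1_funpow_grade[OF assms, of k] N[of "h - int k"] that by auto
  then show ?thesis by blast
qed

lemma L1_div_nilpotent: "v \<in> grade V h \<Longrightarrow> \<exists>K. \<forall>k\<ge>K. L1_div k v = 0"
  using L1_funpow_nilpotent[of v h] by (auto simp: L1_div_def)

text \<open>The coefficients of
  \<open>e\<^bsup>xL(1)\<^esup> Y(u,y) = Y(e\<^bsup>x(1-xy)L(1)\<^esup>(1-xy)\<^bsup>-2L(0)\<^esup>u, y/(1-xy)) e\<^bsup>xL(1)\<^esup>\<close>.\<close>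

lemma L1_div_vop:
  assumes u: "u \<in> grade V h"
  shows "L1_div k (vop V u n v) = (\<Sum>(j, s, t)\<in>triples k.
    (of_int (2 * h - int j - n - 2) gchoose s) *\<^sub>C vop V (L1_div j u) (n + int s) (L1_div t v))"
proof (induction k)
  case 0
  show ?case by (simp add: triples_0 scaleC_one)
next
  case (Suc k)
  define X where "X j s t = vop V (L1_div j u) (n + int s) (L1_div t v)" for j s t
  define a where "a j = (of_int (2 * h - int j - n - 2) :: complex)" for j
  \<comment> \<open>\<open>L(1)\<close> raises exactly one of the three indices; the middle factor
    comes from the weight \<open>h - j\<close> of \<open>L1_div j u\<close>.\<close>
  have L1: "virasoro V 1 (X j s t) = of_nat (Suc t) *\<^sub>C X j s (Suc t) + (a j - of_nat j - of_nat s) *\<^sub>C X j (Suc s) t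
     + of_nat (Suc j) *\<^sub>C X (Suc j) s t" for j s t
  proof -
    define e where "e = (of_int (h - int j) :: complex)"
    have "virasoro V 0 (L1_div j u) = e *\<^sub>C L1_div j u"
      unfolding e_def by (rule L0_grade[OF L1_div_grade[OF u]])
    then have "virasoro V 1 (X j s t) = of_nat (Suc t) *\<^sub>C X j s (Suc t)
      + (2 * e - of_int (n + int s + 2)) *\<^sub>C X j (Suc s) t + of_nat (Suc j) *\<^sub>C X (Suc j) s t"
      unfolding X_def virasoro_commutator(2) L1_L1_div
      by (simp add: scaleC_scaleC complex_vector.scale_left_diff_distrib add.assoc add.commute add.left_commute)
    moreover have "2 * e - of_int (n + int s + 2) = a j - of_nat j - of_nat s"
      by (simp add: a_def e_def)
    ultimately show ?thesis by simp
  qed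
  \<comment> \<open>Here \<open>Suc k = j + s + t\<close>. Absorption rewrites \<open>s\<close>
    times the binomial coefficient, and \<open>a (j - 1) = a j + 1\<close> permits Pascal's
    rule.\<close>
  have coeff: "of_nat (Suc k) * (a j gchoose s) = of_nat t * (a j gchoose s)
      + (if s = 0 then 0 else (a j - of_nat j - of_nat (s - 1)) * (a j gchoose (s - 1)))
      + (if j = 0 then 0 else of_nat j * (a (j - 1) gchoose s))"
    if "(j, s, t) \<in> triples (Suc k)" for j s t
  proof -
    have k: "of_nat (Suc k) = (of_nat j + of_nat s + of_nat t :: complex)"
      using that unfolding triples_def by (metis (mono_tags, lifting) case_prodD mem_Collect_eq of_nat_add)
    have j: "(if j = 0 then 0 else of_nat j * (a (j - 1) gchoose s)) = of_nat j * (a j + 1 gchoose s)"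
      by (cases j) (auto simp: a_def algebra_simps)
    show ?thesis
    proof (cases s)
      case 0
      then show ?thesis unfolding j k by (simp add: algebra_simps)
    next
      case (Suc r)
      have "of_nat s * (a j gchoose s) = (a j - of_nat r) * (a j gchoose r)"
        using gbinomial_absorb_comp[of "a j" r] gbinomial_absorption[of r "a j"] Suc by simp
      then show ?thesis unfolding j k unfolding Suc unfolding gbinomial_Suc_Suc by (simp add: algebra_simps)
    qed
  qed
  have "of_nat (Suc k) *\<^sub>C L1_div (Suc k) (vop V u n v) = virasoro V 1 (\<Sum>(j, s, t)\<in>triples k. (a j gchoose s) *\<^sub>C X j s t)"
    using Suc unfolding L1_L1_div[symmetric] X_def a_def by simp
  also have "\<dots> = (\<Sum>(j, s, t)\<in>triples k. virasoro V 1 ((a j gchoose s) *\<^sub>C X j s t))"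
  proof -
    have "virasoro V 1 (sum f A) = (\<Sum>x\<in>A. virasoro V 1 (f x))" if "finite A" for f :: "nat \<times> nat \<times> nat \<Rightarrow> 'v" and A
      using that by (induction A rule: finite_induct) auto
    then show ?thesis by (simp add: case_prod_beta)
  qed
  also have "\<dots> = (\<Sum>(j, s, t)\<in>triples k. of_nat (Suc t) *\<^sub>C (a j gchoose s) *\<^sub>C X j s (Suc t))
     + (\<Sum>(j, s, t)\<in>triples k. ((a j - of_nat j - of_nat (Suc s - 1)) * (a j gchoose (Suc s - 1))) *\<^sub>C X j (Suc s) t)
     + (\<Sum>(j, s, t)\<in>triples k. (of_nat (Suc j) * (a (Suc j - 1) gchoose s)) *\<^sub>C X (Suc j) s t)"
    unfolding sum.distrib[symmetric]
    by (intro sum.cong refl) (auto simp: L1 scaleC_add_right scaleC_scaleC mult.commute simp del: of_nat_Suc)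
  also have "(\<Sum>(j, s, t)\<in>triples k. of_nat (Suc t) *\<^sub>C (a j gchoose s) *\<^sub>C X j s (Suc t)) =
     (\<Sum>(j, s, t)\<in>triples (Suc k). (of_nat t * (a j gchoose s)) *\<^sub>C X j s t)"
    by (subst sum_triples_Suc(1)[symmetric]) (auto simp: scaleC_scaleC simp del: of_nat_Suc)
  also have "(\<Sum>(j, s, t)\<in>triples k. ((a j - of_nat j - of_nat (Suc s - 1)) * (a j gchoose (Suc s - 1))) *\<^sub>C X j (Suc s) t) =
     (\<Sum>(j, s, t)\<in>triples (Suc k). (if s = 0 then 0 else (a j - of_nat j - of_nat (s - 1)) * (a j gchoose (s - 1))) *\<^sub>C X j s t)"
    by (subst sum_triples_Suc(2)[symmetric]) auto
  also have "(\<Sum>(j, s, t)\<in>triples k. (of_nat (Suc j) * (a (Suc j - 1) gchoose s)) *\<^sub>C X (Suc j) s t) =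
     (\<Sum>(j, s, t)\<in>triples (Suc k). (if j = 0 then 0 else of_nat j * (a (j - 1) gchoose s)) *\<^sub>C X j s t)"
    by (subst sum_triples_Suc(3)[symmetric]) auto
  also have "(\<Sum>(j, s, t)\<in>triples (Suc k). (of_nat t * (a j gchoose s)) *\<^sub>C X j s t) +
     (\<Sum>(j, s, t)\<in>triples (Suc k). (if s = 0 then 0 else (a j - of_nat j - of_nat (s - 1)) * (a j gchoose (s - 1))) *\<^sub>C X j s t) +
     (\<Sum>(j, s, t)\<in>triples (Suc k). (if j = 0 then 0 else of_nat j * (a (j - 1) gchoose s)) *\<^sub>C X j s t)
     = (\<Sum>(j, s, t)\<in>triples (Suc k). (of_nat (Suc k) * (a j gchoose s)) *\<^sub>C X j s t)"
    unfolding sum.distrib[symmetric]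
  proof (rule sum.cong[OF refl], clarify)
    fix j s t assume "(j, s, t) \<in> triples (Suc k)"
    from coeff[OF this] show "(of_nat t * (a j gchoose s)) *\<^sub>C X j s t
      + (if s = 0 then 0 else (a j - of_nat j - of_nat (s - 1)) * (a j gchoose (s - 1))) *\<^sub>C X j s t
      + (if j = 0 then 0 else of_nat j * (a (j - 1) gchoose s)) *\<^sub>C X j s t
      = (of_nat (Suc k) * (a j gchoose s)) *\<^sub>C X j s t"
      by (simp only: scaleC_add_left)
  qed
  also have "\<dots> = of_nat (Suc k) *\<^sub>C (\<Sum>(j, s, t)\<in>triples (Suc k). (a j gchoose s) *\<^sub>C X j s t)"
    unfolding complex_vector.scale_sum_right by (intro sum.cong refl) (auto simp: scaleC_scaleC simp del: of_nat_Suc)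
  finally have "L1_div (Suc k) (vop V u n v) = (\<Sum>(j, s, t)\<in>triples (Suc k). (a j gchoose s) *\<^sub>C X j s t)"
    by (simp add: complex_vector.scale_left_imp_eq del: of_nat_Suc)
  then show ?case by (simp add: X_def a_def)
qed

end

text \<open>Negating the upper index of the second factor makes it \<open>p - b - 1\<close>, free of
  \<open>i\<close>; Vandermonde's convolution applies, and a second negation removes the
  sign.\<close>

lemma gbinomial_alternating_convolution:
  fixes m b :: "'a::field_char_0"
  shows "(\<Sum>i\<le>p. (-1) ^ i * (m gchoose i) * ((b - of_nat i) gchoose (p - i))) = (b - m) gchoose p"
proof -
  have "(-1) ^ i * (m gchoose i) * ((b - of_nat i) gchoose (p - i)) = (-1) ^ p * ((m gchoose i) * ((of_nat p - b - 1) gchoose (p - i)))"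
    if "i \<le> p" for i
  proof -
    have "(b - of_nat i) gchoose (p - i) = (-1) ^ (p - i) * ((of_nat (p - i) - (b - of_nat i) - 1) gchoose (p - i))"
      by (rule gbinomial_negated_upper)
    also have "of_nat (p - i) - (b - of_nat i) - 1 = of_nat p - b - 1" using that by (simp add: of_nat_diff)
    finally have *: "(b - of_nat i) gchoose (p - i) = (-1) ^ (p - i) * ((of_nat p - b - 1) gchoose (p - i))" .
    have "(-1) ^ i * (-1) ^ (p - i) = ((-1) ^ p :: 'a)" using that by (simp flip: power_add)
    then show ?thesis unfolding * by (metis (no_types, opaque_lifting) mult.assoc mult.left_commute)
  qed
  then have "(\<Sum>i\<le>p. (-1) ^ i * (m gchoose i) * ((b - of_nat i) gchoose (p - i)))
    = (-1) ^ p * (\<Sum>i\<le>p. (m gchoose i) * ((of_nat p - b - 1) gchoose (p - i)))"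
    unfolding sum_distrib_left by (intro sum.cong refl) simp
  also have "(\<Sum>i\<le>p. (m gchoose i) * ((of_nat p - b - 1) gchoose (p - i))) = (m + (of_nat p - b - 1)) gchoose p"
    using gbinomial_Vandermonde[of m "of_nat p - b - 1" p] by (simp add: atMost_atLeast0)
  also have "m + (of_nat p - b - 1) = of_nat p - (b - m) - 1" by simp
  also have "(-1) ^ p * ((of_nat p - (b - m) - 1) gchoose p) = (b - m) gchoose p"
    by (rule gbinomial_negated_upper[symmetric])
  finally show ?thesis .
qed

text \<open>Terms with equal \<open>i + s\<close> share the same entry of \<open>g\<close>, and
  their coefficients add up by the alternating convolution. This is how the exponent
  \<open>m\<close> turns into \<open>b - m\<close> when the variables are inverted.\<close>

lemma shift_pow_reexpand:
  fixes g :: "int \<Rightarrow> int \<Rightarrow> 'b::complex_vector"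
  assumes g: "\<And>c d. c \<ge> N \<Longrightarrow> g c d = 0" and S: "S = nat (N - l)"
  shows "(\<Sum>i<S. \<Sum>s<S. ((of_int m gchoose i) * (-1) ^ i * (of_int (b - int i) gchoose s)) *\<^sub>C g (l + int i + int s) (M - int i - int s))
    = shift_pow l g (b - m) (M - (b - m))"
proof -
  let ?F = "\<lambda>i s. ((of_int m gchoose i) * (-1) ^ i * (of_int (b - int i) gchoose s)) *\<^sub>C g (l + int i + int s) (M - int i - int s)"
  have "(\<Sum>i<S. \<Sum>s<S. ?F i s) = (\<Sum>(i, s)\<in>{..<S} \<times> {..<S}. ?F i s)" by (rule sum.cartesian_product)
  also have "\<dots> = (\<Sum>(i, s)\<in>{(i, s). i + s < S}. ?F i s)"
  proof (rule sum.mono_neutral_right)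
    show "\<forall>x\<in>{..<S} \<times> {..<S} - {(i, s). i + s < S}. (case x of (i, s) \<Rightarrow> ?F i s) = 0"
      by (auto simp: S intro!: g split: if_splits)
  qed auto
  also have "\<dots> = (\<Sum>p<S. \<Sum>i\<le>p. ?F i (p - i))" by (rule sum.triangle_reindex)
  also have "\<dots> = (\<Sum>p<S. (of_int (b - m) gchoose p) *\<^sub>C g (l + int p) (M - int p))"
  proof (rule sum.cong[OF refl])
    fix p
    have "(\<Sum>i\<le>p. ?F i (p - i)) = (\<Sum>i\<le>p. ((-1) ^ i * (of_int m gchoose i) * ((of_int b - of_nat i) gchoose (p - i))) *\<^sub>C g (l + int p) (M - int p))"
      by (rule sum.cong[OF refl]) (auto simp: of_nat_diff mult.commute)
    also have "\<dots> = (of_int (b - m) gchoose p) *\<^sub>C g (l + int p) (M - int p)"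
      unfolding complex_vector.scale_sum_left[symmetric] gbinomial_alternating_convolution by simp
    finally show "(\<Sum>i\<le>p. ?F i (p - i)) = (of_int (b - m) gchoose p) *\<^sub>C g (l + int p) (M - int p)" .
  qed
  also have "\<dots> = shift_pow l g (b - m) (M - (b - m))"
    unfolding shift_pow_def binom_sum_def
    by (subst Sum_any_nat_bound[of S]) (auto simp: S intro!: g)
  finally show ?thesis .
qed

lemma shift_pow_add:
  assumes "\<And>c d. c \<ge> N \<Longrightarrow> g c d = 0" "\<And>c d. c \<ge> N \<Longrightarrow> h c d = 0"
  shows "shift_pow l (\<lambda>c d. g c d + h c d) m n = shift_pow l g m n + shift_pow l h m n"
  unfolding shift_pow_def by (rule binom_sum_add) (rule shift_pow_finite, erule assms)+

text \<open>\<open>G_jacobi\<close> is the Jacobi identity for the opposite of a left action: the factors are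
  multiplied in reverse order and the modes are truncated from the other side.\<close>

locale opposite_action = vertex_operator_algebra V
  for V :: "'v::complex_vector voa" +
  fixes D :: "'b::complex_vector set" and G :: "'v \<Rightarrow> int \<Rightarrow> 'b \<Rightarrow> 'b"
  assumes D_subspace: "complex_vector.subspace D"
    and G_closed: "\<alpha> \<in> D \<Longrightarrow> G u n \<alpha> \<in> D"
    and G_add_left: "\<alpha> \<in> D \<Longrightarrow> G (u + v) n \<alpha> = G u n \<alpha> + G v n \<alpha>"
    and G_scale_left: "\<alpha> \<in> D \<Longrightarrow> G (c *\<^sub>C u) n \<alpha> = c *\<^sub>C G u n \<alpha>"
    and G_add_right: "\<alpha> \<in> D \<Longrightarrow> \<beta> \<in> D \<Longrightarrow> G u n (\<alpha> + \<beta>) = G u n \<alpha> + G u n \<beta>"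
    and G_scale_right: "\<alpha> \<in> D \<Longrightarrow> G u n (c *\<^sub>C \<alpha>) = c *\<^sub>C G u n \<alpha>"
    and G_truncation: "\<alpha> \<in> D \<Longrightarrow> \<exists>N. \<forall>n\<le>N. G u n \<alpha> = 0"
    and G_vacuum: "\<alpha> \<in> D \<Longrightarrow> G (vac V) n \<alpha> = (if n = -1 then \<alpha> else 0)"
    and G_jacobi: "\<alpha> \<in> D \<Longrightarrow>
      diff_pow l (\<lambda>m n. G v n (G u m \<alpha>)) m n - (-1) powi l *\<^sub>C diff_pow l (\<lambda>n m. G u m (G v n \<alpha>)) n m
      = shift_pow l (\<lambda>c d. G (vop V u c v) d \<alpha>) m n"
begin

lemmas D_0 [simp] = complex_vector.subspace_0[OF D_subspace]
  and D_plus = complex_vector.subspace_add[OF D_subspace]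
  and D_scaleC = complex_vector.subspace_scale[OF D_subspace]
  and D_sum = complex_vector.subspace_sum[OF D_subspace]

lemma G_zero_left [simp]: "\<alpha> \<in> D \<Longrightarrow> G 0 n \<alpha> = 0" using G_scale_left[of \<alpha> 0 0 n] by simp
lemma G_zero_right [simp]: "G u n 0 = 0" using G_scale_right[of 0 u n 0] by simp

lemma G_sum_left: "\<alpha> \<in> D \<Longrightarrow> finite A \<Longrightarrow> G (\<Sum>x\<in>A. f x) n \<alpha> = (\<Sum>x\<in>A. G (f x) n \<alpha>)"
  by (induction A rule: infinite_finite_induct) (auto simp: G_add_left)

lemma G_sum_right: "(\<And>x. x \<in> A \<Longrightarrow> f x \<in> D) \<Longrightarrow> G u n (\<Sum>x\<in>A. f x) = (\<Sum>x\<in>A. G u n (f x))"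
  by (induction A rule: infinite_finite_induct) (auto simp: G_add_right D_sum)

definition H :: "'v \<Rightarrow> int \<Rightarrow> 'b \<Rightarrow> 'b" where
  "H u n \<alpha> = opposite V (\<lambda>u m. G u m \<alpha>) u n"

lemma opposite_arg_homogeneous:
  assumes "u \<in> grade V h"
  shows "opposite_arg V u j = (if j + 2 * h \<ge> 0 then (-1) powi h *\<^sub>C L1_div (nat (j + 2 * h)) u else 0)"
proof (cases "j + 2 * h \<ge> 0")
  case True
  have "opposite_arg V u j = (\<lambda>(k::nat, h'). if int k - 2 * h' = j
       then ((-1) powi h' / fact k) *\<^sub>C (virasoro V 1 ^^ k) (homogeneous_part V u h') else 0) (nat (j + 2 * h), h)"
    unfolding opposite_arg_def by (rule Sum_any_single) (use True in \<open>auto simp: homogeneous_part_grade[OF assms] split: if_splits\<close>)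
  then show ?thesis using True by (simp add: homogeneous_part_grade[OF assms] L1_div_def scaleC_scaleC)
next
  case False
  then have "(\<lambda>(k::nat, h'). if int k - 2 * h' = j
       then ((-1) powi h' / fact k) *\<^sub>C (virasoro V 1 ^^ k) (homogeneous_part V u h') else 0) = (\<lambda>_. 0)"
    by (auto simp: fun_eq_iff homogeneous_part_grade[OF assms])
  then show ?thesis using False by (simp add: opposite_arg_def)
qed

lemma opposite_arg_finite:
  "finite {x. (case x of (k::nat, h) \<Rightarrow> if int k - 2 * h = j
       then ((-1) powi h / fact k) *\<^sub>C (virasoro V 1 ^^ k) (homogeneous_part V v h) else 0) \<noteq> 0}"
proof (rule finite_subset)
  let ?S = "{h. homogeneous_part V v h \<noteq> 0}"
  show "{x. (case x of (k::nat, h) \<Rightarrow> if int k - 2 * h = j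
       then ((-1) powi h / fact k) *\<^sub>C (virasoro V 1 ^^ k) (homogeneous_part V v h) else 0) \<noteq> 0} \<subseteq>
     (\<Union>h\<in>?S. {k. (virasoro V 1 ^^ k) (homogeneous_part V v h) \<noteq> 0} \<times> {h})"
    by (auto split: if_splits)
  show "finite (\<Union>h\<in>?S. {k. (virasoro V 1 ^^ k) (homogeneous_part V v h) \<noteq> 0} \<times> {h})"
    using L1_funpow_nilpotent[OF homogeneous_part(2)]
    by (intro finite_UN_I homogeneous_part(1) finite_cartesian_product) (auto simp: finite_support_nat_iff)
qed

lemma opposite_arg_add: "opposite_arg V (u + v) j = opposite_arg V u j + opposite_arg V v j"
  unfolding opposite_arg_def
  by (subst Sum_any.distrib[symmetric, OF opposite_arg_finite opposite_arg_finite], rule Sum_any.cong)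
     (auto simp: homogeneous_part_add scaleC_add_right)

lemma opposite_arg_scale: "opposite_arg V (c *\<^sub>C v) j = c *\<^sub>C opposite_arg V v j"
  unfolding opposite_arg_def Sum_any_scale
  by (rule Sum_any.cong) (auto simp: homogeneous_part_scale scaleC_scaleC mult.commute)

lemma opposite_arg_support: "finite {j. opposite_arg V v j \<noteq> 0}"
proof (induction v rule: homogeneous_induct)
  case (homogeneous h v)
  obtain K where K: "\<And>k. k \<ge> K \<Longrightarrow> L1_div k v = 0" using L1_div_nilpotent[OF homogeneous] by blast
  have "{j. opposite_arg V v j \<noteq> 0} \<subseteq> {- 2 * h..<int K - 2 * h}"
  proof
    fix j assume "j \<in> {j. opposite_arg V v j \<noteq> 0}"
    then have "j + 2 * h \<ge> 0" "L1_div (nat (j + 2 * h)) v \<noteq> 0"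
      by (auto simp: opposite_arg_homogeneous[OF homogeneous] split: if_splits)
    moreover from this have "nat (j + 2 * h) < K" using K not_le by blast
    ultimately show "j \<in> {- 2 * h..<int K - 2 * h}" by auto
  qed
  then show ?case by (rule finite_subset) simp
next
  case (add u v)
  then show ?case unfolding opposite_arg_add by (rule finite_support_add)
qed

lemma H_support: "\<alpha> \<in> D \<Longrightarrow> finite {j. G (opposite_arg V u j) (- j - n - 2) \<alpha> \<noteq> 0}"
  by (rule finite_subset[OF _ opposite_arg_support[of u]]) auto

lemma H_add_left: "\<alpha> \<in> D \<Longrightarrow> H (u + v) n \<alpha> = H u n \<alpha> + H v n \<alpha>"
  unfolding H_def opposite_def opposite_arg_add
  by (simp add: G_add_left Sum_any.distrib H_support)

lemma H_scale_left: "\<alpha> \<in> D \<Longrightarrow> H (c *\<^sub>C u) n \<alpha> = c *\<^sub>C H u n \<alpha>"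
  unfolding H_def opposite_def opposite_arg_scale Sum_any_scale by (simp add: G_scale_left)

lemma H_add_right: "\<alpha> \<in> D \<Longrightarrow> \<beta> \<in> D \<Longrightarrow> H u n (\<alpha> + \<beta>) = H u n \<alpha> + H u n \<beta>"
  unfolding H_def opposite_def by (simp add: G_add_right Sum_any.distrib H_support)

lemma H_scale_right: "\<alpha> \<in> D \<Longrightarrow> H u n (c *\<^sub>C \<alpha>) = c *\<^sub>C H u n \<alpha>"
  unfolding H_def opposite_def Sum_any_scale by (simp add: G_scale_right)

lemma H_closed: "\<alpha> \<in> D \<Longrightarrow> H u n \<alpha> \<in> D"
  unfolding H_def opposite_def by (rule Sum_any_in) (auto intro: G_closed D_plus)

lemma H_zero_right [simp]: "H u n 0 = 0" using H_scale_right[of 0 u n 0] by simp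
lemma H_zero_left [simp]: "\<alpha> \<in> D \<Longrightarrow> H 0 n \<alpha> = 0" using H_scale_left[of \<alpha> 0 0 n] by simp

lemma H_homogeneous:
  assumes u: "u \<in> grade V h" and K: "\<forall>k\<ge>K. L1_div k u = 0" and \<alpha>: "\<alpha> \<in> D"
  shows "H u n \<alpha> = (\<Sum>k<K. (-1) powi h *\<^sub>C G (L1_div k u) (2 * h - int k - n - 2) \<alpha>)"
proof -
  have "H u n \<alpha> = (\<Sum>j\<in>(\<lambda>k. int k - 2 * h) ` {..<K}. G (opposite_arg V u j) (- j - n - 2) \<alpha>)"
    unfolding H_def opposite_def
  proof (rule Sum_any.expand_superset)
    show "{j. G (opposite_arg V u j) (- j - n - 2) \<alpha> \<noteq> 0} \<subseteq> (\<lambda>k. int k - 2 * h) ` {..<K}"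
    proof
      fix j assume "j \<in> {j. G (opposite_arg V u j) (- j - n - 2) \<alpha> \<noteq> 0}"
      then have "opposite_arg V u j \<noteq> 0" using \<alpha> by auto
      then have "j + 2 * h \<ge> 0" "L1_div (nat (j + 2 * h)) u \<noteq> 0"
        by (auto simp: opposite_arg_homogeneous[OF u] split: if_splits)
      moreover from this have "nat (j + 2 * h) < K" using K not_le by blast
      ultimately have "j + 2 * h \<ge> 0" "nat (j + 2 * h) < K" by auto
      then show "j \<in> (\<lambda>k. int k - 2 * h) ` {..<K}" by (intro image_eqI[of _ _ "nat (j + 2 * h)"]) auto
    qed
  qed simp
  also have "\<dots> = (\<Sum>k<K. G (opposite_arg V u (int k - 2 * h)) (- (int k - 2 * h) - n - 2) \<alpha>)"
    by (subst sum.reindex) (auto simp: inj_on_def)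
  also have "\<dots> = (\<Sum>k<K. (-1) powi h *\<^sub>C G (L1_div k u) (2 * h - int k - n - 2) \<alpha>)"
    by (intro sum.cong refl) (simp add: opposite_arg_homogeneous[OF u] G_scale_left \<alpha>)
  finally show ?thesis .
qed

lemma H_truncation:
  assumes \<alpha>: "\<alpha> \<in> D" shows "\<exists>N. \<forall>n\<ge>N. H u n \<alpha> = 0"
proof (induction u rule: homogeneous_induct)
  case (homogeneous h u)
  obtain K where K: "\<forall>k\<ge>K. L1_div k u = 0" using L1_div_nilpotent[OF homogeneous] by blast
  have "\<exists>M. \<forall>n\<ge>M. G (L1_div k u) (2 * h - int k - n - 2) \<alpha> = 0" for k
  proof -
    obtain N where "\<forall>n\<le>N. G (L1_div k u) n \<alpha> = 0" using G_truncation[OF \<alpha>] by blast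
    then show ?thesis by (intro exI[of _ "2 * h - int k - 2 - N"]) simp
  qed
  from finite_choice_ge[of "\<lambda>k n. G (L1_div k u) (2 * h - int k - n - 2) \<alpha> = 0", OF this, of K]
  obtain M where "\<forall>k<K. \<forall>n\<ge>M. G (L1_div k u) (2 * h - int k - n - 2) \<alpha> = 0" ..
  then show ?case unfolding H_homogeneous[OF homogeneous K \<alpha>] by (intro exI[of _ M]) simp
next
  case (add u v)
  then obtain N M where "\<forall>n\<ge>N. H u n \<alpha> = 0" "\<forall>n\<ge>M. H v n \<alpha> = 0" by blast
  then have "\<forall>n\<ge>max N M. H (u + v) n \<alpha> = 0" by (simp add: H_add_left[OF \<alpha>])
  then show ?case by blast
qed

lemma H_vacuum:
  assumes \<alpha>: "\<alpha> \<in> D" shows "H (vac V) n \<alpha> = (if n = -1 then \<alpha> else 0)"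
proof -
  have L: "virasoro V 0 (vac V) = 0" "virasoro V 1 (vac V) = 0"
    by (simp_all add: virasoro_def creation(2))
  then have v: "vac V \<in> grade V 0" by (intro gradeI) simp
  have "(virasoro V 1 ^^ Suc k) (vac V) = 0" for k
    by (simp only: funpow_Suc_right o_apply L L1_funpow_linear)
  then have "L1_div k (vac V) = 0" if "k \<ge> 1" for k
    using that by (cases k) (simp_all add: L1_div_def)
  then have "\<forall>k\<ge>1. L1_div k (vac V) = 0" by blast
  from H_homogeneous[OF v this \<alpha>, where n = n] show ?thesis by (simp add: G_vacuum[OF \<alpha>] scaleC_one)
qed

lemma antidiag_finite_HH: "\<alpha> \<in> D \<Longrightarrow> antidiag_finite (\<lambda>m n. H u m (H v n \<alpha>))"
proof -
  assume "\<alpha> \<in> D"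
  then obtain N where "\<forall>n\<ge>N. H v n \<alpha> = 0" using H_truncation by blast
  then show ?thesis by (intro antidiag_finite_right[of N]) auto
qed

text \<open>Opposite modes carry negated indices: \<open>m + l - i\<close> becomes
  \<open>(2 h - j - l - 2 - m) + i\<close>. The increasing and the decreasing index of
  \<open>diff_pow\<close> therefore change places, which is why \<open>l\<close> enters both new
  starting indices.\<close>

lemma diff_pow_HH:
  assumes u: "u \<in> grade V h" and J: "\<forall>k\<ge>J. L1_div k u = 0"
    and v: "v \<in> grade V h'" and T: "\<forall>k\<ge>T. L1_div k v = 0" and \<alpha>: "\<alpha> \<in> D"
  shows "diff_pow l (\<lambda>m n. H u m (H v n \<alpha>)) m n = (-1) powi (h + h') *\<^sub>C
    (\<Sum>j<J. \<Sum>t<T. diff_pow l (\<lambda>n m. G (L1_div j u) m (G (L1_div t v) n \<alpha>))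
      (2 * h' - int t - l - 2 - n) (2 * h - int j - l - 2 - m))"
proof -
  let ?F = "\<lambda>j t m n. G (L1_div j u) (2 * h - int j - m - 2) (G (L1_div t v) (2 * h' - int t - n - 2) \<alpha>)"
  have "H u m (H v n \<alpha>) = (-1) powi (h + h') *\<^sub>C (\<Sum>j<J. \<Sum>t<T. ?F j t m n)" for m n
    unfolding H_homogeneous[OF u J H_closed[OF \<alpha>]] unfolding H_homogeneous[OF v T \<alpha>]
    by (simp add: G_sum_right G_scale_right G_closed D_scaleC \<alpha> complex_vector.scale_sum_right scaleC_scaleC power_int_add)
  then have "diff_pow l (\<lambda>m n. H u m (H v n \<alpha>)) m n =
    (-1) powi (h + h') *\<^sub>C diff_pow l (\<lambda>m n. \<Sum>j<J. \<Sum>t<T. ?F j t m n) m n"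
    by (simp add: diff_pow_scale)
  also have "diff_pow l (\<lambda>m n. \<Sum>j<J. \<Sum>t<T. ?F j t m n) m n = (\<Sum>j<J. \<Sum>t<T. diff_pow l (?F j t) m n)"
  proof -
    have af: "antidiag_finite (?F j t)" for j t
    proof -
      obtain N where N: "\<forall>n\<le>N. G (L1_div t v) n \<alpha> = 0" using G_truncation[OF \<alpha>] by blast
      show ?thesis by (rule antidiag_finite_right[of "2 * h' - N"]) (simp add: N)
    qed
    then show ?thesis by (simp add: diff_pow_sum antidiag_finite_sum)
  qed
  also have "(\<Sum>j<J. \<Sum>t<T. diff_pow l (?F j t) m n) =
    (\<Sum>j<J. \<Sum>t<T. diff_pow l (\<lambda>n m. G (L1_div j u) m (G (L1_div t v) n \<alpha>))
      (2 * h' - int t - l - 2 - n) (2 * h - int j - l - 2 - m))"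
    unfolding diff_pow_def by (intro sum.cong refl binom_sum_cong) (simp add: algebra_simps)
  finally show ?thesis .
qed

text \<open>The conjugation formula expresses the right side by
  \<open>vop V (L1_div j u) c (L1_div t v)\<close>. After the sums over \<open>i\<close> and
  \<open>s\<close> are merged, each pair \<open>j, t\<close> contributes the right side of
  \<open>G_jacobi\<close>; its left side is reassembled by \<open>diff_pow_HH\<close>.\<close>

lemma H_jacobi_homogeneous:
  assumes u: "u \<in> grade V h" and v: "v \<in> grade V h'" and \<alpha>: "\<alpha> \<in> D"
  shows "diff_pow l (\<lambda>m n. H u m (H v n \<alpha>)) m n - (-1) powi l *\<^sub>C diff_pow l (\<lambda>n m. H v n (H u m \<alpha>)) n m
      = shift_pow l (\<lambda>c d. H (vop V u c v) d \<alpha>) m n"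
proof -
  obtain J where J: "\<forall>k\<ge>J. L1_div k u = 0" using L1_div_nilpotent[OF u] by blast
  obtain T where T: "\<forall>k\<ge>T. L1_div k v = 0" using L1_div_nilpotent[OF v] by blast
  have "\<exists>M. \<forall>c\<ge>M. \<forall>t<T. vop V (L1_div j u) c (L1_div t v) = 0" for j
    using finite_choice_ge[of "\<lambda>t c. vop V (L1_div j u) c (L1_div t v) = 0" T] vop_truncation by blast
  from finite_choice_ge[of "\<lambda>j c. \<forall>t<T. vop V (L1_div j u) c (L1_div t v) = 0", OF this, of J]
  obtain N where N': "\<And>j t c. j < J \<Longrightarrow> t < T \<Longrightarrow> c \<ge> N \<Longrightarrow> vop V (L1_div j u) c (L1_div t v) = 0" by blast
  have N: "vop V (L1_div j u) c (L1_div t v) = 0" if "c \<ge> N" for j t c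
    using N'[of j t c] that J T by (cases "j < J"; cases "t < T") auto
  define S where "S = nat (N - l)"
  define g where "g j t c d = G (vop V (L1_div j u) c (L1_div t v)) d \<alpha>" for j t c d
  \<comment> \<open>With \<open>c = l + i\<close> the vector \<open>vop V u c v\<close> has weight
    \<open>h + h' - c - 1\<close>, and its opposite modes lead to \<open>G\<close>-indices
    \<open>M j t - i - s\<close>. Likewise \<open>b j - i\<close> is the upper binomial index in
    \<open>L1_div_vop\<close>.\<close>
  define M where "M j t = 2 * (h + h' - l - 1) - int j - int t - 2 - m - n" for j t
  define b where "b j = 2 * h - int j - l - 2" for j
  let ?A = "\<lambda>j t. diff_pow l (\<lambda>m n. G (L1_div t v) n (G (L1_div j u) m \<alpha>)) (2 * h - int j - l - 2 - m) (2 * h' - int t - l - 2 - n)"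
  let ?B = "\<lambda>j t. diff_pow l (\<lambda>n m. G (L1_div j u) m (G (L1_div t v) n \<alpha>)) (2 * h' - int t - l - 2 - n) (2 * h - int j - l - 2 - m)"
  let ?Z = "\<lambda>i j t s. ((of_int m gchoose i) * (-1) ^ i * (of_int (b j - int i) gchoose s)) *\<^sub>C g j t (l + int i + int s) (M j t - int i - int s)"
  have gN: "\<And>c d. c \<ge> N \<Longrightarrow> g j t c d = 0" for j t by (simp add: g_def N \<alpha>)
  have H: "H (vop V u (l + int i) v) (m + n - int i) \<alpha> = (-1) powi (h + h' - l - 1) *\<^sub>C
     (\<Sum>j<J. \<Sum>t<T. \<Sum>s<S. ((-1) ^ i * (of_int (b j - int i) gchoose s)) *\<^sub>C g j t (l + int i + int s) (M j t - int i - int s))" for i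
  proof -
    let ?c = "l + int i"
    let ?X = "\<lambda>j s t. (of_int (2 * h - int j - ?c - 2) gchoose s) *\<^sub>C vop V (L1_div j u) (?c + int s) (L1_div t v)"
    let ?GX = "\<lambda>j s t. G (?X j s t) (2 * (h + h' - ?c - 1) - int (j + s + t) - (m + n - int i) - 2) \<alpha>"
    have star: "L1_div k (vop V u ?c v) = (\<Sum>(j, s, t)\<in>triples k. ?X j s t)" for k by (rule L1_div_vop[OF u])
    have X0: "?X j s t = 0" if "j \<ge> J \<or> s \<ge> S \<or> t \<ge> T" for j s t
    proof -
      have "vop V (L1_div j u) (?c + int s) (L1_div t v) = 0"
        using that J T N[of "?c + int s" j t] by (auto simp: S_def)
      then show ?thesis by simp
    qed
    have K: "\<forall>k\<ge>J + S + T. L1_div k (vop V u ?c v) = 0"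
      unfolding star
    proof (intro allI impI sum.neutral ballI)
      fix k x assume k: "J + S + T \<le> k" and x: "x \<in> triples k"
      obtain j s t where jst: "x = (j, s, t)" by (cases x)
      then have "j \<ge> J \<or> s \<ge> S \<or> t \<ge> T" using k x by (auto simp: triples_def)
      from X0[OF this] show "(case x of (j, s, t) \<Rightarrow> ?X j s t) = 0" by (simp only: jst prod.case)
    qed
    have grade: "vop V u ?c v \<in> grade V (h + h' - ?c - 1)" by (rule vop_grade[OF u v])
    have sgn: "(-1) powi (h + h' - ?c - 1) = (-1) powi (h + h' - l - 1) * ((-1) ^ i :: complex)"
      using power_int_add[of "-1::complex" "h + h' - l - 1" "- int i"]
      by (simp add: power_int_minus algebra_simps flip: power_inverse)
    have "H (vop V u ?c v) (m + n - int i) \<alpha> = (\<Sum>k<J+S+T. (-1) powi (h + h' - ?c - 1) *\<^sub>C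
        G (L1_div k (vop V u ?c v)) (2 * (h + h' - ?c - 1) - int k - (m + n - int i) - 2) \<alpha>)"
      by (rule H_homogeneous[OF grade K \<alpha>])
    also have "\<dots> = (\<Sum>k<J+S+T. \<Sum>(j, s, t)\<in>triples k. (-1) powi (h + h' - ?c - 1) *\<^sub>C ?GX j s t)"
      unfolding star
      by (intro sum.cong refl, subst G_sum_left[OF \<alpha> finite_triples], unfold complex_vector.scale_sum_right, intro sum.cong refl)
        (auto simp: triples_def algebra_simps)
    also have "\<dots> = (\<Sum>j<J. \<Sum>t<T. \<Sum>s<S. (-1) powi (h + h' - ?c - 1) *\<^sub>C ?GX j s t)"
    proof (rule sum_triples_box[OF order_refl])
      fix j s t assume "j \<ge> J \<or> s \<ge> S \<or> t \<ge> T"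
      note X = X0[OF this]
      show "(-1) powi (h + h' - ?c - 1) *\<^sub>C ?GX j s t = 0"
        unfolding X G_zero_left[OF \<alpha>] by simp
    qed
    also have "\<dots> = (\<Sum>j<J. \<Sum>t<T. \<Sum>s<S. (-1) powi (h + h' - l - 1) *\<^sub>C
        (((-1) ^ i * (of_int (b j - int i) gchoose s)) *\<^sub>C g j t (l + int i + int s) (M j t - int i - int s)))"
    proof (intro sum.cong refl)
      fix j t s
      have "2 * h - int j - ?c - 2 = b j - int i" by (simp add: b_def)
      moreover have "2 * (h + h' - ?c - 1) - int (j + s + t) - (m + n - int i) - 2 = M j t - int i - int s"
        by (simp add: M_def)
      ultimately show "(-1) powi (h + h' - ?c - 1) *\<^sub>C ?GX j s t = (-1) powi (h + h' - l - 1) *\<^sub>C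
        (((-1) ^ i * (of_int (b j - int i) gchoose s)) *\<^sub>C g j t (l + int i + int s) (M j t - int i - int s))"
        unfolding sgn by (simp only: G_scale_left[OF \<alpha>] scaleC_scaleC mult.assoc g_def)
    qed
    finally show ?thesis by (simp only: complex_vector.scale_sum_right)
  qed
  have H0: "H (vop V u (l + int i) v) (m + n - int i) \<alpha> = 0" if "i \<ge> S" for i
    unfolding H by (intro complex_vector.scale_eq_0_iff[THEN iffD2] disjI2 sum.neutral ballI)
      (use that in \<open>auto simp: S_def intro!: gN\<close>)
  have "shift_pow l (\<lambda>c d. H (vop V u c v) d \<alpha>) m n = (\<Sum>i<S. (of_int m gchoose i) *\<^sub>C H (vop V u (l + int i) v) (m + n - int i) \<alpha>)"
    unfolding shift_pow_def binom_sum_def by (rule Sum_any_nat_bound) (simp add: H0)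
  also have "\<dots> = (-1) powi (h + h' - l - 1) *\<^sub>C (\<Sum>i<S. \<Sum>j<J. \<Sum>t<T. \<Sum>s<S. ?Z i j t s)"
    unfolding H by (simp add: complex_vector.scale_sum_right scaleC_scaleC mult.assoc mult.left_commute)
  also have "(\<Sum>i<S. \<Sum>j<J. \<Sum>t<T. \<Sum>s<S. ?Z i j t s)
     = (\<Sum>j<J. \<Sum>t<T. \<Sum>i<S. \<Sum>s<S. ?Z i j t s)"
    by (rule trans[OF sum.swap], rule sum.cong[OF refl], rule sum.swap)
  also have "\<dots> = (\<Sum>j<J. \<Sum>t<T. shift_pow l (g j t) (b j - m) (M j t - (b j - m)))"
    by (intro sum.cong refl, rule shift_pow_reexpand[OF _ S_def], erule gN)
  also have "\<dots> = (\<Sum>j<J. \<Sum>t<T. ?A j t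
      - (-1) powi l *\<^sub>C ?B j t)"
  proof (intro sum.cong refl)
    fix j t
    have e: "b j - m = 2 * h - int j - l - 2 - m" "M j t - (b j - m) = 2 * h' - int t - l - 2 - n"
      by (simp_all add: b_def M_def)
    show "shift_pow l (g j t) (b j - m) (M j t - (b j - m)) =  ?A j t
      - (-1) powi l *\<^sub>C ?B j t"
      unfolding e(2) unfolding e(1) g_def[abs_def] by (rule G_jacobi[OF \<alpha>, symmetric])
  qed
  also have "\<dots> = (\<Sum>j<J. \<Sum>t<T. ?A j t)
      - (-1) powi l *\<^sub>C (\<Sum>j<J. \<Sum>t<T. ?B j t)"
    by (simp add: sum_subtractf complex_vector.scale_sum_right)
  also have "(\<Sum>j<J. \<Sum>t<T. ?A j t)
    = (-1) powi (h + h') *\<^sub>C diff_pow l (\<lambda>n m. H v n (H u m \<alpha>)) n m"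
    unfolding diff_pow_HH[OF v T u J \<alpha>] by (subst sum.swap) (simp add: scaleC_scaleC add.commute power_int_minus_one_mult_self scaleC_one)
  also have "(\<Sum>j<J. \<Sum>t<T. ?B j t)
    = (-1) powi (h + h') *\<^sub>C diff_pow l (\<lambda>m n. H u m (H v n \<alpha>)) m n"
    unfolding diff_pow_HH[OF u J v T \<alpha>] by (simp add: scaleC_scaleC power_int_minus_one_mult_self scaleC_one)
  finally have eq: "shift_pow l (\<lambda>c d. H (vop V u c v) d \<alpha>) m n = (-1) powi (h + h' - l - 1) *\<^sub>C
    ((-1) powi (h + h') *\<^sub>C diff_pow l (\<lambda>n m. H v n (H u m \<alpha>)) n m
     - (-1) powi l *\<^sub>C (-1) powi (h + h') *\<^sub>C diff_pow l (\<lambda>m n. H u m (H v n \<alpha>)) m n)" .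
  define e where "e = ((-1) powi (h + h') :: complex)"
  define f where "f = ((-1) powi l :: complex)"
  \<comment> \<open>The leftover sign is minus \<open>(-1)^l\<close>. It interchanges the roles of
    the two products and so turns the opposite form of the identity into the ordinary one.\<close>
  have "(-1) powi (h + h' - l - 1) = e * f * (-1)"
    unfolding e_def f_def by (simp add: power_int_diff power_int_minus_one_minus divide_inverse flip: power_int_minus)
  moreover have "e * e = 1" "f * f = 1" by (simp_all add: e_def f_def power_int_minus_one_mult_self)
  ultimately show ?thesis unfolding eq e_def[symmetric] f_def[symmetric]
    by (simp add: complex_vector.scale_right_diff_distrib scaleC_scaleC mult.commute mult.left_commute scaleC_one)
qed

theorem H_jacobi:
  assumes \<alpha>: "\<alpha> \<in> D"
  shows "diff_pow l (\<lambda>m n. H u m (H v n \<alpha>)) m n - (-1) powi l *\<^sub>C diff_pow l (\<lambda>n m. H v n (H u m \<alpha>)) n m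
      = shift_pow l (\<lambda>c d. H (vop V u c v) d \<alpha>) m n"
proof (induction u rule: homogeneous_induct)
  case (homogeneous h u)
  note u = this
  show ?case
  proof (induction v rule: homogeneous_induct)
    case (homogeneous h' v)
    then show ?case by (rule H_jacobi_homogeneous[OF u _ \<alpha>])
  next
    case (add v v')
    obtain N N' where "\<forall>n\<ge>N. vop V u n v = 0" "\<forall>n\<ge>N'. vop V u n v' = 0" using vop_truncation by metis
    then have "shift_pow l (\<lambda>c d. H (vop V u c v) d \<alpha> + H (vop V u c v') d \<alpha>) m n =
      shift_pow l (\<lambda>c d. H (vop V u c v) d \<alpha>) m n + shift_pow l (\<lambda>c d. H (vop V u c v') d \<alpha>) m n"
      by (intro shift_pow_add[of "max N N'"]) (auto simp: \<alpha>)
    then show ?case using add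
      by (simp add: H_add_left H_add_right H_closed \<alpha> diff_pow_add antidiag_finite_HH scaleC_add_right algebra_simps)
  qed
next
  case (add u u')
  obtain N N' where "\<forall>n\<ge>N. vop V u n v = 0" "\<forall>n\<ge>N'. vop V u' n v = 0" using vop_truncation by metis
  then have "shift_pow l (\<lambda>c d. H (vop V u c v) d \<alpha> + H (vop V u' c v) d \<alpha>) m n =
    shift_pow l (\<lambda>c d. H (vop V u c v) d \<alpha>) m n + shift_pow l (\<lambda>c d. H (vop V u' c v) d \<alpha>) m n"
    by (intro shift_pow_add[of "max N N'"]) (auto simp: \<alpha>)
  then show ?case using add
    by (simp add: H_add_left H_add_right H_closed \<alpha> diff_pow_add antidiag_finite_HH scaleC_add_right algebra_simps)
qed

theorem H_weak_module: "weak_module V D H"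
  by (rule weak_moduleI[OF D_subspace])
    (rule H_closed H_add_left H_scale_left H_add_right H_scale_right H_truncation H_vacuum H_jacobi; assumption)+

end

section \<open>Convolution of arrays\<close>

lemma Sum_any_pair:
  fixes g :: "'a \<Rightarrow> 'c \<Rightarrow> 'b::comm_monoid_add"
  assumes "finite {(x, y). g x y \<noteq> 0}"
  shows "Sum_any (\<lambda>x. Sum_any (g x)) = Sum_any (\<lambda>(x, y). g x y)"
proof (rule Sum_any.cartesian_product)
  let ?S = "{(x, y). g x y \<noteq> 0}"
  show "finite (fst ` ?S \<times> snd ` ?S)" using assms by blast
  show "{a. \<exists>b. g a b \<noteq> 0} \<times> {b. \<exists>a. g a b \<noteq> 0} \<subseteq> fst ` ?S \<times> snd ` ?S" by force
qed

lemma Sum_any_reindex: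
  fixes F :: "'a \<Rightarrow> 'b::comm_monoid_add"
  assumes "inj \<phi>" "{x. F x \<noteq> 0} \<subseteq> range \<phi>"
  shows "Sum_any (\<lambda>x. F (\<phi> x)) = Sum_any F"
proof -
  have "{x. F x \<noteq> 0} = \<phi> ` {x. F (\<phi> x) \<noteq> 0}" using assms(2) by auto
  then show ?thesis using assms(1)
    by (simp add: Sum_any.expand_set sum.reindex inj_on_subset[OF assms(1)])
qed

text \<open>The product of two series in \<open>x1\<close> and \<open>x2\<close>: modes
  \<open>a\<close> and \<open>a'\<close> stand for \<open>x1^(-a-1)\<close> and
  \<open>x1^(-a'-1)\<close>, so they contribute to the mode \<open>m\<close> with
  \<open>a + a' = m - 1\<close>, and similarly for \<open>x2\<close>.\<close>

definition conv :: "(int \<Rightarrow> int \<Rightarrow> int \<Rightarrow> int \<Rightarrow> 'b::comm_monoid_add) \<Rightarrow> int \<Rightarrow> int \<Rightarrow> 'b" where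
  "conv Q m n = Sum_any (\<lambda>(a, b). Q a b (m - 1 - a) (n - 1 - b))"

definition conv_finite :: "(int \<Rightarrow> int \<Rightarrow> int \<Rightarrow> int \<Rightarrow> 'b::zero) \<Rightarrow> bool" where
  "conv_finite Q \<longleftrightarrow> (\<forall>m n. finite {(a, b). Q a b (m - 1 - a) (n - 1 - b) \<noteq> 0})"

text \<open>Multiplication by \<open>x1 - x2\<close>; likewise \<open>fwd_sum\<close> is
  multiplication by \<open>x0 + x2\<close>.\<close>

definition fwd_diff :: "(int \<Rightarrow> int \<Rightarrow> 'b::ab_group_add) \<Rightarrow> int \<Rightarrow> int \<Rightarrow> 'b" where
  "fwd_diff F m n = F (m + 1) n - F m (n + 1)"

definition fwd_sum :: "(int \<Rightarrow> int \<Rightarrow> 'b::ab_group_add) \<Rightarrow> int \<Rightarrow> int \<Rightarrow> 'b" where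
  "fwd_sum F m n = F (m + 1) n + F m (n + 1)"

text \<open>Multiplying either factor by a variable multiplies the product by it. So a power needed
  in the first factor and a power needed in the second both act on the product.\<close>

lemma conv_shift:
  fixes Q :: "int \<Rightarrow> int \<Rightarrow> int \<Rightarrow> int \<Rightarrow> 'b::comm_monoid_add"
  shows "conv (\<lambda>a b a' b'. Q (a + 1) b a' b') m n = conv Q (m + 1) n"
    "conv (\<lambda>a b a' b'. Q a (b + 1) a' b') m n = conv Q m (n + 1)"
    "conv (\<lambda>a b a' b'. Q a b (a' + 1) b') m n = conv Q (m + 1) n"
    "conv (\<lambda>a b a' b'. Q a b a' (b' + 1)) m n = conv Q m (n + 1)"
proof -
  have "inj (\<lambda>(a::int, b::int). (a + 1, b))" "inj (\<lambda>(a::int, b::int). (a, b + 1))"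
    by (auto simp: inj_def)
  moreover have "range (\<lambda>(a::int, b::int). (a + 1, b)) = UNIV" "range (\<lambda>(a::int, b::int). (a, b + 1)) = UNIV"
    by (auto intro: image_eqI[of _ _ "(x - 1, y)" for x y] image_eqI[of _ _ "(x, y - 1)" for x y])
  ultimately have
    "Sum_any (\<lambda>x. (\<lambda>(a, b). Q a b (m + 1 - 1 - a) (n - 1 - b)) ((\<lambda>(a::int, b::int). (a + 1, b)) x)) = conv Q (m + 1) n"
    "Sum_any (\<lambda>x. (\<lambda>(a, b). Q a b (m - 1 - a) (n + 1 - 1 - b)) ((\<lambda>(a::int, b::int). (a, b + 1)) x)) = conv Q m (n + 1)"
    unfolding conv_def by (intro Sum_any_reindex; simp)+
  then show "conv (\<lambda>a b a' b'. Q (a + 1) b a' b') m n = conv Q (m + 1) n"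
    "conv (\<lambda>a b a' b'. Q a (b + 1) a' b') m n = conv Q m (n + 1)"
    by (simp_all add: conv_def case_prod_unfold algebra_simps)
  show "conv (\<lambda>a b a' b'. Q a b (a' + 1) b') m n = conv Q (m + 1) n"
    "conv (\<lambda>a b a' b'. Q a b a' (b' + 1)) m n = conv Q m (n + 1)"
    by (simp_all add: conv_def algebra_simps)
qed

lemma conv_finite_shift:
  assumes "conv_finite Q"
  shows "conv_finite (\<lambda>a b a' b'. Q (a + 1) b a' b')" "conv_finite (\<lambda>a b a' b'. Q a (b + 1) a' b')"
    "conv_finite (\<lambda>a b a' b'. Q a b (a' + 1) b')" "conv_finite (\<lambda>a b a' b'. Q a b a' (b' + 1))"
proof -
  have fin: "finite {(a, b). Q a b (m - 1 - a) (n - 1 - b) \<noteq> 0}" for m n using assms by (simp add: conv_finite_def)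
  show "conv_finite (\<lambda>a b a' b'. Q (a + 1) b a' b')" unfolding conv_finite_def
  proof (intro allI)
    fix m n
    have "{(a, b). Q (a + 1) b (m - 1 - a) (n - 1 - b) \<noteq> 0} =
      (\<lambda>(a, b). (a + 1, b)) -` {(a, b). Q a b (m + 1 - 1 - a) (n - 1 - b) \<noteq> 0}" by (auto simp: algebra_simps)
    then show "finite {(a, b). Q (a + 1) b (m - 1 - a) (n - 1 - b) \<noteq> 0}"
      by (simp only:) (rule finite_vimageI[OF fin], auto simp: inj_def)
  qed
  show "conv_finite (\<lambda>a b a' b'. Q a (b + 1) a' b')" unfolding conv_finite_def
  proof (intro allI)
    fix m n
    have "{(a, b). Q a (b + 1) (m - 1 - a) (n - 1 - b) \<noteq> 0} =
      (\<lambda>(a, b). (a, b + 1)) -` {(a, b). Q a b (m - 1 - a) (n + 1 - 1 - b) \<noteq> 0}" by (auto simp: algebra_simps)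
    then show "finite {(a, b). Q a (b + 1) (m - 1 - a) (n - 1 - b) \<noteq> 0}"
      by (simp only:) (rule finite_vimageI[OF fin], auto simp: inj_def)
  qed
  show "conv_finite (\<lambda>a b a' b'. Q a b (a' + 1) b')" unfolding conv_finite_def
    using fin[of "m + 1" for m] by (simp add: algebra_simps)
  show "conv_finite (\<lambda>a b a' b'. Q a b a' (b' + 1))" unfolding conv_finite_def
    using fin[of _ "n + 1" for n] by (simp add: algebra_simps)
qed

lemma conv_add:
  assumes "conv_finite Q" "conv_finite R"
  shows "conv (\<lambda>a b a' b'. Q a b a' b' + R a b a' b') m n = conv Q m n + conv R m n"
    "conv_finite (\<lambda>a b a' b'. Q a b a' b' + R a b a' b')"
proof -
  have fin: "finite {x. (case x of (a, b) \<Rightarrow> Q a b (m - 1 - a) (n - 1 - b)) \<noteq> 0}"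
    "finite {x. (case x of (a, b) \<Rightarrow> R a b (m - 1 - a) (n - 1 - b)) \<noteq> 0}" for m n
    using assms by (simp_all add: conv_finite_def case_prod_unfold)
  show "conv (\<lambda>a b a' b'. Q a b a' b' + R a b a' b') m n = conv Q m n + conv R m n"
    unfolding conv_def by (subst Sum_any.distrib[symmetric, OF fin]) (auto simp: case_prod_unfold)
  show "conv_finite (\<lambda>a b a' b'. Q a b a' b' + R a b a' b')"
    unfolding conv_finite_def
  proof (intro allI)
    fix m n
    show "finite {(a, b). Q a b (m - 1 - a) (n - 1 - b) + R a b (m - 1 - a) (n - 1 - b) \<noteq> 0}"
      by (rule finite_subset[OF _ finite_UnI[OF fin[of m n]]]) auto
  qed
qed

lemma conv_uminus:
  fixes Q :: "int \<Rightarrow> int \<Rightarrow> int \<Rightarrow> int \<Rightarrow> 'b::ab_group_add"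
  shows "conv (\<lambda>a b a' b'. - Q a b a' b') m n = - conv Q m n"
    "conv_finite Q \<Longrightarrow> conv_finite (\<lambda>a b a' b'. - Q a b a' b')"
  by (simp_all add: conv_def conv_finite_def case_prod_unfold Sum_any_uminus)

lemma conv_diff:
  fixes Q :: "int \<Rightarrow> int \<Rightarrow> int \<Rightarrow> int \<Rightarrow> 'b::ab_group_add"
  assumes "conv_finite Q" "conv_finite R"
  shows "conv (\<lambda>a b a' b'. Q a b a' b' - R a b a' b') m n = conv Q m n - conv R m n"
    "conv_finite (\<lambda>a b a' b'. Q a b a' b' - R a b a' b')"
  using conv_add[OF assms(1) conv_uminus(2)[OF assms(2)]] by (simp_all add: conv_uminus)

definition in_first :: "((int \<Rightarrow> int \<Rightarrow> 'b) \<Rightarrow> int \<Rightarrow> int \<Rightarrow> 'b) \<Rightarrow> (int \<Rightarrow> int \<Rightarrow> int \<Rightarrow> int \<Rightarrow> 'b) \<Rightarrow> int \<Rightarrow> int \<Rightarrow> int \<Rightarrow> int \<Rightarrow> 'b"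
  where "in_first f Q a b a' b' = f (\<lambda>a b. Q a b a' b') a b"

definition in_second :: "((int \<Rightarrow> int \<Rightarrow> 'b) \<Rightarrow> int \<Rightarrow> int \<Rightarrow> 'b) \<Rightarrow> (int \<Rightarrow> int \<Rightarrow> int \<Rightarrow> int \<Rightarrow> 'b) \<Rightarrow> int \<Rightarrow> int \<Rightarrow> int \<Rightarrow> int \<Rightarrow> 'b"
  where "in_second f Q a b a' b' = f (\<lambda>a' b'. Q a b a' b') a' b'"

lemma in_first_funpow: "(in_first f ^^ k) Q a b a' b' = (f ^^ k) (\<lambda>a b. Q a b a' b') a b"
proof (induction k arbitrary: a b)
  case (Suc k)
  have "(\<lambda>a b. (in_first f ^^ k) Q a b a' b') = (f ^^ k) (\<lambda>a b. Q a b a' b')" using Suc by (simp add: fun_eq_iff)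
  then show ?case by (simp add: in_first_def[of f "(in_first f ^^ k) Q"])
qed simp

lemma in_second_funpow: "(in_second f ^^ k) Q a b a' b' = (f ^^ k) (\<lambda>a' b'. Q a b a' b') a' b'"
proof (induction k arbitrary: a' b')
  case (Suc k)
  have "(\<lambda>a' b'. (in_second f ^^ k) Q a b a' b') = (f ^^ k) (\<lambda>a' b'. Q a b a' b')" using Suc by (simp add: fun_eq_iff)
  then show ?case by (simp add: in_second_def[of f "(in_second f ^^ k) Q"])
qed simp

lemma conv_fwd_step:
  fixes Q :: "int \<Rightarrow> int \<Rightarrow> int \<Rightarrow> int \<Rightarrow> 'b::ab_group_add"
  assumes "conv_finite Q"
  shows "conv_finite (in_first fwd_diff Q)" "conv (in_first fwd_diff Q) = fwd_diff (conv Q)"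
    "conv_finite (in_second fwd_diff Q)" "conv (in_second fwd_diff Q) = fwd_diff (conv Q)"
    "conv_finite (in_first fwd_sum Q)" "conv (in_first fwd_sum Q) = fwd_sum (conv Q)"
    "conv_finite (in_second fwd_sum Q)" "conv (in_second fwd_sum Q) = fwd_sum (conv Q)"
  unfolding in_first_def[abs_def] in_second_def[abs_def] fwd_diff_def[abs_def] fwd_sum_def[abs_def]
  by (simp_all add: conv_diff conv_add conv_finite_shift assms conv_shift fun_eq_iff)

lemma conv_fwd:
  fixes Q :: "int \<Rightarrow> int \<Rightarrow> int \<Rightarrow> int \<Rightarrow> 'b::ab_group_add"
  assumes "conv_finite Q"
  shows "conv_finite ((in_first fwd_diff ^^ k) Q)" "conv ((in_first fwd_diff ^^ k) Q) = (fwd_diff ^^ k) (conv Q)"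
    "conv_finite ((in_second fwd_diff ^^ k) Q)" "conv ((in_second fwd_diff ^^ k) Q) = (fwd_diff ^^ k) (conv Q)"
    "conv_finite ((in_first fwd_sum ^^ k) Q)" "conv ((in_first fwd_sum ^^ k) Q) = (fwd_sum ^^ k) (conv Q)"
    "conv_finite ((in_second fwd_sum ^^ k) Q)" "conv ((in_second fwd_sum ^^ k) Q) = (fwd_sum ^^ k) (conv Q)"
proof -
  have "conv_finite ((f ^^ k) Q) \<and> conv ((f ^^ k) Q) = (g ^^ k) (conv Q)"
    if "\<And>R. conv_finite R \<Longrightarrow> conv_finite (f R) \<and> conv (f R) = g (conv R)"
    for f :: "(int \<Rightarrow> int \<Rightarrow> int \<Rightarrow> int \<Rightarrow> 'b) \<Rightarrow> (int \<Rightarrow> int \<Rightarrow> int \<Rightarrow> int \<Rightarrow> 'b)" and g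
    by (induction k) (use assms that in auto)
  note * = this
  show "conv_finite ((in_first fwd_diff ^^ k) Q)" "conv ((in_first fwd_diff ^^ k) Q) = (fwd_diff ^^ k) (conv Q)"
    using *[of "in_first fwd_diff" fwd_diff] conv_fwd_step(1,2) by blast+
  show "conv_finite ((in_second fwd_diff ^^ k) Q)" "conv ((in_second fwd_diff ^^ k) Q) = (fwd_diff ^^ k) (conv Q)"
    using *[of "in_second fwd_diff" fwd_diff] conv_fwd_step(3,4) by blast+
  show "conv_finite ((in_first fwd_sum ^^ k) Q)" "conv ((in_first fwd_sum ^^ k) Q) = (fwd_sum ^^ k) (conv Q)"
    using *[of "in_first fwd_sum" fwd_sum] conv_fwd_step(5,6) by blast+
  show "conv_finite ((in_second fwd_sum ^^ k) Q)" "conv ((in_second fwd_sum ^^ k) Q) = (fwd_sum ^^ k) (conv Q)"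
    using *[of "in_second fwd_sum" fwd_sum] conv_fwd_step(7,8) by blast+
qed

lemma funpow_commute:
  assumes "\<And>x. A (B x) = B (A x)"
  shows "(A ^^ k) ((B ^^ j) x) = (B ^^ j) ((A ^^ k) x)"
proof -
  have 1: "A ((B ^^ j) x) = (B ^^ j) (A x)" for x by (induction j) (simp_all add: assms)
  show ?thesis by (induction k) (simp_all add: 1)
qed

lemma fwd_diff_commute:
  fixes Q :: "int \<Rightarrow> int \<Rightarrow> int \<Rightarrow> int \<Rightarrow> 'b::ab_group_add"
  shows "(in_first fwd_diff ^^ k) ((in_second fwd_diff ^^ j) Q) = (in_second fwd_diff ^^ j) ((in_first fwd_diff ^^ k) Q)"
  by (rule funpow_commute) (simp add: in_first_def in_second_def fwd_diff_def fun_eq_iff)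

lemma diff_pow_nat:
  assumes "antidiag_finite F" shows "diff_pow (int k) F m n = (fwd_diff ^^ k) F m n"
proof (induction k arbitrary: m n)
  case (Suc k)
  then show ?case using diff_pow_Suc[OF assms, of "int k" m n] by (simp add: fwd_diff_def add.commute)
qed simp

lemma shift_pow_nat:
  assumes "\<And>c d. c \<ge> N \<Longrightarrow> F c d = 0" shows "shift_pow l F (int k) n = (fwd_sum ^^ k) F l n"
proof (induction k arbitrary: l n)
  case (Suc k)
  have "shift_pow l F (int k + 1) n = shift_pow (l + 1) F (int k) n + shift_pow l F (int k) (n + 1)"
    using shift_pow_Suc[of N F l "int k" n] assms by simp
  then show ?case using Suc by (simp add: fwd_sum_def add.commute)
qed simp

lemma fwd_diff_flip:
  fixes F :: "int \<Rightarrow> int \<Rightarrow> 'b::complex_vector"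
  shows "(fwd_diff ^^ k) (\<lambda>n m. F m n) n m = (-1) ^ k *\<^sub>C (fwd_diff ^^ k) F m n"
  by (induction k arbitrary: m n) (auto simp: fwd_diff_def scaleC_one complex_vector.scale_right_diff_distrib)

text \<open>Re-expanding both factors at \<open>x\<^sub>1 = x\<^sub>2 + x\<^sub>0\<close> and then multiplying amounts to re-expanding the product.\<close>

lemma conv_diff_pow:
  fixes Q :: "int \<Rightarrow> int \<Rightarrow> int \<Rightarrow> int \<Rightarrow> 'b::complex_vector"
  assumes b: "\<And>a b a' b'. b \<ge> B \<Longrightarrow> Q a b a' b' = 0" and b': "\<And>a b a' b'. b' \<ge> B \<Longrightarrow> Q a b a' b' = 0"
    and a: "\<And>b b'. \<exists>A. \<forall>a a'. a \<ge> A \<or> a' \<ge> A \<longrightarrow> Q a b a' b' = 0"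
  shows "conv (\<lambda>c d c' d'. diff_pow c' (\<lambda>a' b'. diff_pow c (\<lambda>a b. Q a b a' b') M d) M' d') l n
     = diff_pow l (conv Q) (M + M') n"
proof -
  let ?q = "\<lambda>j a b. Q a b (M + M' + l - int j - 1 - a) (n + int j - 1 - b)"
  let ?k = "\<lambda>a j i. (-1 :: complex) ^ i * (of_int (M - a - 1) gchoose i) * ((of_int (l - 1 - (a - M)) - of_nat i) gchoose (j - i))"
  \<comment> \<open>The terms of the left side, indexed by the modes \<open>a, b\<close> of the
    first factor and the total exponent \<open>j = i + i'\<close> of the two expansions;
    \<open>c = a - M + i\<close> has been eliminated.\<close>
  define F where "F = (\<lambda>((a, b), j, i). if i \<le> j then ((-1) ^ j * (of_int (a - M + int i) gchoose i) *
      (of_int (l - 1 - (a - M + int i)) gchoose (j - i))) *\<^sub>C Q a b (M + M' + l - 1 - a - int j) (n - 1 - b + int j) else 0)"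
  have neg: "of_int (a - M + int i) gchoose i = (-1) ^ i * ((of_int (M - a - 1) :: complex) gchoose i)" for a i
    using gbinomial_negated_upper[of "of_int (a - M + int i) :: complex" i] by (simp add: algebra_simps)
  have fin: "finite {x. F x \<noteq> 0}"
  proof -
    obtain A where A: "\<And>b b' a a'. a \<ge> A b b' \<or> a' \<ge> A b b' \<Longrightarrow> Q a b a' b' = 0" using a by metis
    \<comment> \<open>Both second indices are below \<open>B\<close>, which bounds \<open>j\<close>
      and \<open>b\<close>; for each of these finitely many choices the first indices are bounded as
      well.\<close>
    define J where "J = nat (2 * B - n + 1)"
    define bs where "bs = {n - 1 - B..B}"
    define As where "As = (\<Union>b\<in>bs. \<Union>j\<in>{..J}. {M + M' + l - 1 - int j - A b (n - 1 - b + int j)..A b (n - 1 - b + int j)})"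
    have "{x. F x \<noteq> 0} \<subseteq> (As \<times> bs) \<times> {..J} \<times> {..J}"
    proof
      fix x assume "x \<in> {x. F x \<noteq> 0}"
      then obtain a b j i where x: "x = ((a, b), j, i)" and ij: "i \<le> j"
        and Q: "Q a b (M + M' + l - 1 - a - int j) (n - 1 - b + int j) \<noteq> 0"
        by (auto simp: F_def split: prod.splits if_splits)
      have 1: "b < B" "n - 1 - b + int j < B" using b b' Q by (meson not_le)+
      have 2: "a < A b (n - 1 - b + int j)" "M + M' + l - 1 - a - int j < A b (n - 1 - b + int j)"
        using A Q by (meson not_le)+
      have "j \<le> J" "b \<in> bs" using 1 by (auto simp: J_def bs_def)
      moreover from this have "a \<in> As" unfolding As_def using 2 by fastforce
      ultimately show "x \<in> (As \<times> bs) \<times> {..J} \<times> {..J}" using ij by (auto simp: x)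
    qed
    then show ?thesis by (rule finite_subset) (auto simp: As_def bs_def)
  qed
  define \<phi> where "\<phi> = (\<lambda>((c, d), i', i). ((M + c - int i, d + int i), i + i', i :: nat))"
  have inj: "inj \<phi>" by (auto simp: inj_def \<phi>_def)
  have range: "{x. F x \<noteq> 0} \<subseteq> range \<phi>"
  proof
    fix x assume "x \<in> {x. F x \<noteq> 0}"
    then obtain a b j i where x: "x = ((a, b), j, i)" and ij: "i \<le> j"
      by (auto simp: F_def split: prod.splits if_splits)
    have "x = \<phi> ((a - M + int i, b - int i), j - i, i)" using ij by (simp add: x \<phi>_def)
    then show "x \<in> range \<phi>" by blast
  qed
  have fin\<phi>: "finite {x. F (\<phi> x) \<noteq> 0}" using finite_vimageI[OF fin inj] by (simp add: vimage_def)
  have F\<phi>: "F (\<phi> ((c, d), i', i)) = ((-1) ^ i' * (of_int (l - 1 - c) gchoose i')) *\<^sub>C ((-1) ^ i * (of_int c gchoose i)) *\<^sub>C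
      Q (M + c - int i) (d + int i) (M' + (l - 1 - c) - int i') (n - 1 - d + int i')" for c d i' i
    by (simp add: F_def \<phi>_def scaleC_scaleC algebra_simps power_add)
  have "conv (\<lambda>c d c' d'. diff_pow c' (\<lambda>a' b'. diff_pow c (\<lambda>a b. Q a b a' b') M d) M' d') l n
    = Sum_any (\<lambda>x. Sum_any (\<lambda>i'. Sum_any (\<lambda>i. F (\<phi> (x, i', i)))))"
    unfolding conv_def jacobi_first[symmetric] Sum_any_scale
    by (rule Sum_any.cong) (auto simp: F\<phi>)
  also have "\<dots> = Sum_any (\<lambda>x. Sum_any (\<lambda>y. F (\<phi> (x, y))))"
  proof (rule Sum_any.cong)
    fix x
    have "finite {(i', i). F (\<phi> (x, i', i)) \<noteq> 0}"
    proof (rule finite_subset[OF _ finite_imageI[OF fin\<phi>, of snd]], clarify)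
      fix i' i assume "F (\<phi> (x, i', i)) \<noteq> 0"
      then have "(x, i', i) \<in> {x. F (\<phi> x) \<noteq> 0}" by simp
      then show "(i', i) \<in> snd ` {x. F (\<phi> x) \<noteq> 0}" by (rule image_eqI[rotated]) simp
    qed
    from Sum_any_pair[OF this] show "Sum_any (\<lambda>i'. Sum_any (\<lambda>i. F (\<phi> (x, i', i)))) = Sum_any (\<lambda>y. F (\<phi> (x, y)))"
      by (simp add: case_prod_unfold)
  qed
  also have "\<dots> = Sum_any (\<lambda>x. F (\<phi> x))"
  proof -
    have "finite {(x, y). F (\<phi> (x, y)) \<noteq> 0}" using fin\<phi> by (simp add: case_prod_unfold)
    from Sum_any_pair[OF this] show ?thesis by (simp add: case_prod_unfold)
  qed
  also have "\<dots> = Sum_any F" by (rule Sum_any_reindex[OF inj range])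
  also have "\<dots> = Sum_any (\<lambda>(j, ab). Sum_any (\<lambda>i. F (ab, j, i)))"
  proof -
    define \<psi> where "\<psi> = (\<lambda>((j::nat, ab::int\<times>int), i::nat). (ab, j, i))"
    have inj\<psi>: "inj \<psi>" by (auto simp: inj_def \<psi>_def)
    have "Sum_any F = Sum_any (\<lambda>x. F (\<psi> x))"
    proof (rule Sum_any_reindex[OF inj\<psi>, symmetric])
      have "x = \<psi> ((fst (snd x), fst x), snd (snd x))" for x by (simp add: \<psi>_def)
      then show "{x. F x \<noteq> 0} \<subseteq> range \<psi>" by blast
    qed
    also have "finite {(x, y). F (\<psi> (x, y)) \<noteq> 0}"
      using finite_vimageI[OF fin inj\<psi>] by (simp add: vimage_def case_prod_unfold)
    from Sum_any_pair[OF this] have "Sum_any (\<lambda>x. F (\<psi> x)) = Sum_any (\<lambda>x. Sum_any (\<lambda>i. F (\<psi> (x, i))))"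
      by (simp add: case_prod_unfold)
    finally show ?thesis by (simp add: \<psi>_def case_prod_unfold)
  qed
  also have "\<dots> = Sum_any (\<lambda>(j, a, b). ((-1) ^ j * (of_int l gchoose j)) *\<^sub>C ?q j a b)"
  \<comment> \<open>For fixed \<open>j, a, b\<close> all terms contain the same entry of
    \<open>Q\<close>. Once the first binomial is negated, the alternating convolution sums the
    coefficients to \<open>l\<close> over \<open>j\<close>.\<close>
  proof (rule Sum_any.cong, clarify)
    fix j a b
    have "Sum_any (\<lambda>i. F ((a, b), j, i)) = (\<Sum>i\<le>j. F ((a, b), j, i))"
      by (rule Sum_any.expand_superset) (auto simp: F_def split: if_splits)
    also have "\<dots> = (\<Sum>i\<le>j. (?k a j i) *\<^sub>C
        ((-1) ^ j *\<^sub>C ?q j a b))"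
    proof (rule sum.cong[OF refl])
      fix i assume "i \<in> {..j}"
      then show "F ((a, b), j, i) = (?k a j i) *\<^sub>C
        ((-1) ^ j *\<^sub>C ?q j a b)"
        using neg[of a i] by (simp add: F_def scaleC_scaleC algebra_simps)
    qed
    also have "\<dots> = (of_int (l - 1 - (a - M)) - of_int (M - a - 1) gchoose j) *\<^sub>C
        ((-1) ^ j *\<^sub>C ?q j a b)"
      unfolding complex_vector.scale_sum_left[symmetric] gbinomial_alternating_convolution ..
    also have "of_int (l - 1 - (a - M)) - of_int (M - a - 1) = (of_int l :: complex)" by simp
    finally show "Sum_any (\<lambda>i. F ((a, b), j, i)) =
      ((-1) ^ j * (of_int l gchoose j)) *\<^sub>C ?q j a b"
      by (simp add: scaleC_scaleC mult.commute)
  qed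
  also have "\<dots> = Sum_any (\<lambda>j. Sum_any (\<lambda>(a, b). ((-1) ^ j * (of_int l gchoose j)) *\<^sub>C ?q j a b))"
  proof -
    let ?g = "\<lambda>j (a, b). ((-1) ^ j * (of_int l gchoose j)) *\<^sub>C ?q j a b"
    have "finite {(j, ab). ?g j ab \<noteq> 0}"
    proof (rule finite_subset)
      show "{(j, ab). ?g j ab \<noteq> 0} \<subseteq> (\<lambda>(ab, j, i). (j, ab)) ` {x. F x \<noteq> 0}"
      \<comment> \<open>A nonzero binomial coefficient of \<open>l\<close> is a sum over
        \<open>i\<close>, so some summand is nonzero and yields a point in the finite support of
        \<open>F\<close>.\<close>
      proof clarify
        fix j a b assume "((-1) ^ j * (of_int l gchoose j)) *\<^sub>C ?q j a b \<noteq> 0"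
        then have "(of_int l :: complex) gchoose j \<noteq> 0"
          and Q: "?q j a b \<noteq> 0" by auto
        have "(\<Sum>i\<le>j. ?k a j i) = ((of_int l :: complex) gchoose j)"
          unfolding gbinomial_alternating_convolution by simp
        then have "(\<Sum>i\<le>j. ?k a j i) \<noteq> (0::complex)"
          using \<open>(of_int l :: complex) gchoose j \<noteq> 0\<close> by simp
        then obtain i where i: "i \<le> j" and nz: "?k a j i \<noteq> (0::complex)"
          by (meson atMost_iff sum.not_neutral_contains_not_neutral)
        then have "F ((a, b), j, i) \<noteq> 0" using Q neg[of a i] by (simp add: F_def algebra_simps)
        then show "(j, a, b) \<in> (\<lambda>(ab, j, i). (j, ab)) ` {x. F x \<noteq> 0}" by force
      qed
    qed (rule finite_imageI[OF fin])
    from Sum_any_pair[OF this] show ?thesis by (simp add: case_prod_unfold)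
  qed
  also have "\<dots> = diff_pow l (conv Q) (M + M') n"
    unfolding jacobi_first[symmetric] conv_def Sum_any_scale by (simp add: case_prod_unfold)
  finally show ?thesis .
qed

section \<open>Tensor products of vertex algebras acting through commuting modules\<close>

lemma abs_tensor_eqI: "tensor_rel p q \<Longrightarrow> abs_tensor p = abs_tensor q"
  by (simp add: tensor.abs_eq_iff)

lemma tensor_bilinear:
  "(a + a') \<otimes>\<^sub>C b = a \<otimes>\<^sub>C b + a' \<otimes>\<^sub>C b" "a \<otimes>\<^sub>C (b + b') = a \<otimes>\<^sub>C b + a \<otimes>\<^sub>C b'"
  "(c *\<^sub>C a) \<otimes>\<^sub>C b = c *\<^sub>C (a \<otimes>\<^sub>C b)" "a \<otimes>\<^sub>C (c *\<^sub>C b) = c *\<^sub>C (a \<otimes>\<^sub>C b)"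
proof -
  have "tensor_rel (Poly_Mapping.single (a + a', b) 1) (Poly_Mapping.single (a, b) 1 + Poly_Mapping.single (a', b) 1)"
    "tensor_rel (Poly_Mapping.single (a, b + b') 1) (Poly_Mapping.single (a, b) 1 + Poly_Mapping.single (a, b') 1)"
    "tensor_rel (Poly_Mapping.single (c *\<^sub>C a, b) 1) (c *\<^sub>C Poly_Mapping.single (a, b) 1)"
    "tensor_rel (Poly_Mapping.single (a, c *\<^sub>C b) 1) (c *\<^sub>C Poly_Mapping.single (a, b) 1)"
    unfolding tensor_rel_def diff_diff_eq[symmetric]
    by (rule complex_vector.span_base; unfold bilinear_relators_def; blast)+
  then show "(a + a') \<otimes>\<^sub>C b = a \<otimes>\<^sub>C b + a' \<otimes>\<^sub>C b" "a \<otimes>\<^sub>C (b + b') = a \<otimes>\<^sub>C b + a \<otimes>\<^sub>C b'"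
    "(c *\<^sub>C a) \<otimes>\<^sub>C b = c *\<^sub>C (a \<otimes>\<^sub>C b)" "a \<otimes>\<^sub>C (c *\<^sub>C b) = c *\<^sub>C (a \<otimes>\<^sub>C b)"
    by (simp_all add: tensor.abs_eq plus_tensor.abs_eq scaleC_tensor.abs_eq abs_tensor_eqI)
qed

lemma tensor_zero: "0 \<otimes>\<^sub>C b = 0" "a \<otimes>\<^sub>C 0 = 0"
  using tensor_bilinear(3)[of 0 0 b] tensor_bilinear(4)[of a 0 0] by simp_all

text \<open>No case for scalars is needed, since a scalar can be moved into the first tensor
  factor.\<close>

lemma tensor_induct [case_names tensor add]:
  assumes t: "\<And>a b. P (a \<otimes>\<^sub>C b)" and add: "\<And>s t. P s \<Longrightarrow> P t \<Longrightarrow> P (s + t)"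
  shows "P s"
proof (induct s)
  fix p :: "('a \<times> 'b) \<Rightarrow>\<^sub>0 complex"
  have single: "P (abs_tensor (Poly_Mapping.single k c))" for k c
  proof -
    obtain a b where k: "k = (a, b)" by (cases k)
    have "Poly_Mapping.single k c = c *\<^sub>C Poly_Mapping.single k 1"
      by (rule poly_mapping_eqI) (simp add: scaleC_poly_mapping.rep_eq lookup_single scaleC_complex_def when_def)
    moreover have "(c *\<^sub>C a) \<otimes>\<^sub>C b = c *\<^sub>C abs_tensor (Poly_Mapping.single k 1)"
      unfolding tensor_bilinear(3) k by (simp only: tensor.abs_eq)
    ultimately have "abs_tensor (Poly_Mapping.single k c) = (c *\<^sub>C a) \<otimes>\<^sub>C b"
      by (simp only: scaleC_tensor.abs_eq)
    then show ?thesis using t by simp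
  qed
  have "P (abs_tensor (\<Sum>k\<in>A. Poly_Mapping.single k (Poly_Mapping.lookup p k)))" if "finite A" for A
    using that
  proof (induction A rule: finite_induct)
    case empty
    show ?case using single[of undefined 0] by simp
  next
    case (insert k A)
    then show ?case using add[OF single] by (simp add: plus_tensor.abs_eq[symmetric])
  qed
  moreover have "(\<Sum>k\<in>Poly_Mapping.keys p. Poly_Mapping.single k (Poly_Mapping.lookup p k)) = p"
    by (rule poly_mapping_eqI) (simp add: lookup_sum lookup_single when_def sum.delta in_keys_iff)
  ultimately show "P (abs_tensor p)" using finite_keys[of p] by metis
qed

lemma tensor_lift_add: "tensor_lift (\<lambda>u v. f u v + g u v) t = tensor_lift f t + tensor_lift g t"
  by (simp add: tensor_lift_def free_lift_def scaleC_add_right sum.distrib case_prod_unfold)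

lemma tensor_lift_scale: "tensor_lift (\<lambda>u v. c *\<^sub>C f u v) t = c *\<^sub>C tensor_lift f t"
  by (simp add: tensor_lift_def free_lift_def complex_vector.scale_sum_right scaleC_scaleC mult.commute case_prod_unfold)

lemma clinearI: "(\<And>x y. f (x + y) = f x + f y) \<Longrightarrow> (\<And>c x. f (c *\<^sub>C x) = c *\<^sub>C f x) \<Longrightarrow> clinear f"
  by (simp add: Vector_Spaces.linear_iff complex_vector.vector_space_axioms)

lemma finite_support_int:
  assumes "\<And>i::int. i \<ge> A \<Longrightarrow> f i = 0" "\<And>i. i \<le> B \<Longrightarrow> f i = 0"
  shows "finite {i. f i \<noteq> 0}"
  by (rule finite_subset[of _ "{B..A}"]) (use assms in \<open>auto, (meson linear)+\<close>)

context
  fixes V1 :: "'v1::complex_vector voa" and V2 :: "'v2::complex_vector voa"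
  assumes A1: "weak_module V1 UNIV (vop V1)" and A2: "weak_module V2 UNIV (vop V2)"
begin

interpretation A1: weak_module V1 UNIV "vop V1" by (rule A1)
interpretation A2: weak_module V2 UNIV "vop V2" by (rule A2)

lemma vop_finite:
  "finite {i. vop V1 u i u' \<otimes>\<^sub>C vop V2 v (n - 1 - i) v' \<noteq> 0}"
proof -
  obtain N M where N: "\<forall>n\<ge>N. vop V1 u n u' = 0" and M: "\<forall>n\<ge>M. vop V2 v n v' = 0"
    using A1.truncation A2.truncation by (metis UNIV_I)
  show ?thesis by (rule finite_support_int[of N _ "n - 1 - M"]) (simp_all add: N M tensor_zero)
qed

definition prod_mode :: "int \<Rightarrow> 'v1 \<Rightarrow> 'v2 \<Rightarrow> 'v1 \<Rightarrow> 'v2 \<Rightarrow> ('v1, 'v2) tensor" where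
  "prod_mode n u v u' v' = Sum_any (\<lambda>i. vop V1 u i u' \<otimes>\<^sub>C vop V2 v (n - 1 - i) v')"

lemma tensor_voa_prod_mode:
  "vop (tensor_voa V1 V2) s n t = tensor_lift (\<lambda>u v. tensor_lift (prod_mode n u v) t) s"
  by (simp add: tensor_voa_def prod_mode_def[abs_def])

lemma prod_mode_linear:
  "prod_mode n (u + w) v u' v' = prod_mode n u v u' v' + prod_mode n w v u' v'" "prod_mode n (c *\<^sub>C u) v u' v' = c *\<^sub>C prod_mode n u v u' v'"
  "prod_mode n u (v + x) u' v' = prod_mode n u v u' v' + prod_mode n u x u' v'" "prod_mode n u (c *\<^sub>C v) u' v' = c *\<^sub>C prod_mode n u v u' v'"
  "prod_mode n u v (u' + w) v' = prod_mode n u v u' v' + prod_mode n u v w v'" "prod_mode n u v (c *\<^sub>C u') v' = c *\<^sub>C prod_mode n u v u' v'"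
  "prod_mode n u v u' (v' + x) = prod_mode n u v u' v' + prod_mode n u v u' x" "prod_mode n u v u' (c *\<^sub>C v') = c *\<^sub>C prod_mode n u v u' v'"
  unfolding prod_mode_def
  by (simp_all add: A1.add_left A1.scale_left A1.add_right A1.scale_right A2.add_left A2.scale_left A2.add_right A2.scale_right
        tensor_bilinear Sum_any.distrib[OF vop_finite vop_finite] Sum_any_scale)

lemma tensor_voa_vop:
  "vop (tensor_voa V1 V2) (u \<otimes>\<^sub>C v) n (u' \<otimes>\<^sub>C v') = Sum_any (\<lambda>i. vop V1 u i u' \<otimes>\<^sub>C vop V2 v (n - 1 - i) v')"
proof -
  have 1: "tensor_lift (prod_mode n u v) (u' \<otimes>\<^sub>C v') = prod_mode n u v u' v'" for u v
    by (rule tensor_lift_tensor; rule clinearI) (rule prod_mode_linear)+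
  have "tensor_lift (\<lambda>u v. tensor_lift (prod_mode n u v) (u' \<otimes>\<^sub>C v')) (u \<otimes>\<^sub>C v) = tensor_lift (prod_mode n u v) (u' \<otimes>\<^sub>C v')"
    by (rule tensor_lift_tensor; rule clinearI) (simp_all only: prod_mode_linear tensor_lift_add tensor_lift_scale 1)
  then show ?thesis by (simp add: tensor_voa_prod_mode 1 prod_mode_def)
qed

lemma tensor_voa_add:
  "vop (tensor_voa V1 V2) (s + s') n t = vop (tensor_voa V1 V2) s n t + vop (tensor_voa V1 V2) s' n t"
  "vop (tensor_voa V1 V2) s n (t + t') = vop (tensor_voa V1 V2) s n t + vop (tensor_voa V1 V2) s n t'"
proof -
  have eq: "prod_mode n (u + w) v = (\<lambda>a b. prod_mode n u v a b + prod_mode n w v a b)"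
    "prod_mode n (c *\<^sub>C u) v = (\<lambda>a b. c *\<^sub>C prod_mode n u v a b)"
    "prod_mode n u (v + x) = (\<lambda>a b. prod_mode n u v a b + prod_mode n u x a b)"
    "prod_mode n u (c *\<^sub>C v) = (\<lambda>a b. c *\<^sub>C prod_mode n u v a b)" for u w v x c
    by (intro ext prod_mode_linear)+
  have "clinear (tensor_lift (\<lambda>u v. tensor_lift (prod_mode n u v) t))"
    by (rule clinear_tensor_lift; rule clinearI) (simp_all only: eq tensor_lift_add tensor_lift_scale)
  then show "vop (tensor_voa V1 V2) (s + s') n t = vop (tensor_voa V1 V2) s n t + vop (tensor_voa V1 V2) s' n t"
    by (simp add: tensor_voa_prod_mode Vector_Spaces.linear_iff)
  have "clinear (tensor_lift (prod_mode n u v))" for u v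
    by (rule clinear_tensor_lift; rule clinearI) (rule prod_mode_linear)+
  then have "tensor_lift (prod_mode n u v) (t + t') = tensor_lift (prod_mode n u v) t + tensor_lift (prod_mode n u v) t'" for u v
    by (simp add: Vector_Spaces.linear_iff)
  then show "vop (tensor_voa V1 V2) s n (t + t') = vop (tensor_voa V1 V2) s n t + vop (tensor_voa V1 V2) s n t'"
    by (simp add: tensor_voa_prod_mode tensor_lift_add)
qed

lemma tensor_voa_truncation: "\<exists>N. \<forall>n\<ge>N. vop (tensor_voa V1 V2) s n t = 0"
proof (induction s rule: tensor_induct)
  case (tensor u v)
  show ?case
  proof (induction t rule: tensor_induct)
    case (tensor u' v')
    obtain N M where N: "\<forall>n\<ge>N. vop V1 u n u' = 0" and M: "\<forall>n\<ge>M. vop V2 v n v' = 0"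
      using A1.truncation A2.truncation by (metis UNIV_I)
    have "vop V1 u i u' \<otimes>\<^sub>C vop V2 v (n - 1 - i) v' = 0" if "n \<ge> N + M" for n i
      using that by (cases "i \<ge> N") (simp_all add: N M tensor_zero)
    then have "\<forall>n\<ge>N + M. vop (tensor_voa V1 V2) (u \<otimes>\<^sub>C v) n (u' \<otimes>\<^sub>C v') = 0"
      by (simp add: tensor_voa_vop)
    then show ?case by blast
  next
    case (add s t)
    then obtain N M where "\<forall>n\<ge>N. vop (tensor_voa V1 V2) (u \<otimes>\<^sub>C v) n s = 0"
      "\<forall>n\<ge>M. vop (tensor_voa V1 V2) (u \<otimes>\<^sub>C v) n t = 0" by blast
    then show ?case by (intro exI[of _ "max N M"]) (simp add: tensor_voa_add)
  qed
next
  case (add s s')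
  then obtain N M where "\<forall>n\<ge>N. vop (tensor_voa V1 V2) s n t = 0"
    "\<forall>n\<ge>M. vop (tensor_voa V1 V2) s' n t = 0" by blast
  then show ?case by (intro exI[of _ "max N M"]) (simp add: tensor_voa_add)
qed

end

lemma conv_finiteI:
  fixes Q :: "int \<Rightarrow> int \<Rightarrow> int \<Rightarrow> int \<Rightarrow> 'b::zero"
  assumes b: "\<And>a b a' b'. b \<ge> B \<Longrightarrow> Q a b a' b' = 0" and b': "\<And>a b a' b'. b' \<ge> B \<Longrightarrow> Q a b a' b' = 0"
    and a: "\<And>b b'. \<exists>A. \<forall>a a'. a \<ge> A \<or> a' \<ge> A \<longrightarrow> Q a b a' b' = 0"
  shows "conv_finite Q"
  unfolding conv_finite_def
proof (intro allI)
  fix m n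
  obtain A where A: "\<And>b b' a a'. a \<ge> A b b' \<or> a' \<ge> A b b' \<Longrightarrow> Q a b a' b' = 0" using a by metis
  have "{(a, b). Q a b (m - 1 - a) (n - 1 - b) \<noteq> 0} \<subseteq>
    (\<Union>b\<in>{n - 1 - B..B}. {m - 1 - A b (n - 1 - b)..A b (n - 1 - b)} \<times> {b})"
  proof clarify
    fix a b assume Q: "Q a b (m - 1 - a) (n - 1 - b) \<noteq> 0"
    have 1: "b < B" "n - 1 - b < B" using b b' Q by (meson not_le)+
    have 2: "a < A b (n - 1 - b)" "m - 1 - a < A b (n - 1 - b)" using A Q by (meson not_le)+
    show "(a, b) \<in> (\<Union>b\<in>{n - 1 - B..B}. {m - 1 - A b (n - 1 - b)..A b (n - 1 - b)} \<times> {b})"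
      using 1 2 by auto
  qed
  then show "finite {(a, b). Q a b (m - 1 - a) (n - 1 - b) \<noteq> 0}" by (rule finite_subset) auto
qed

lemma diff_pow_additive_on:
  assumes "antidiag_finite f" "\<And>m n. f m n \<in> W" "complex_vector.subspace W"
    "\<And>x y. x \<in> W \<Longrightarrow> y \<in> W \<Longrightarrow> h (x + y) = h x + h y" "\<And>x c. x \<in> W \<Longrightarrow> h (c *\<^sub>C x) = c *\<^sub>C h x"
  shows "h (diff_pow l f m n) = diff_pow l (\<lambda>m n. h (f m n)) m n"
  unfolding diff_pow_def
  by (subst binom_sum_additive[where W = W and h = h])
    (use assms in \<open>auto intro!: antidiag_finiteD complex_vector.subspace_0 complex_vector.subspace_add complex_vector.subspace_scale\<close>)

lemma diff_pow_in:
  assumes "\<And>m n. f m n \<in> W" "complex_vector.subspace W"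
  shows "diff_pow l f m n \<in> W"
  unfolding diff_pow_def
  by (rule binom_sum_in) (use assms in \<open>auto intro!: complex_vector.subspace_0 complex_vector.subspace_add complex_vector.subspace_scale\<close>)

section \<open>Locality and associativity\<close>

context weak_module
begin

lemmas W_0 = complex_vector.subspace_0[OF subspace]
  and W_add = complex_vector.subspace_add[OF subspace]
  and W_scale = complex_vector.subspace_scale[OF subspace]

lemma zero_right [simp]: "Y u n 0 = 0" using scale_right[OF W_0, of u n 0] by simp
lemma zero_left [simp]: "w \<in> W \<Longrightarrow> Y 0 n w = 0" using scale_left[of w 0 0 n] by simp

lemma antidiag_finite_YY: "w \<in> W \<Longrightarrow> antidiag_finite (\<lambda>m n. Y u m (Y v n w))"
proof -
  assume "w \<in> W"
  then obtain N where "\<forall>n\<ge>N. Y v n w = 0" using truncation by blast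
  then show ?thesis by (intro antidiag_finite_right[of N]) auto
qed

text \<open>For \<open>l = k\<close> the right side of the Jacobi identity contains only products
  with index at least \<open>k\<close>. The sign of the second term cancels against that from
  exchanging the variables.\<close>

lemma locality:
  assumes k: "\<And>c. c \<ge> int k \<Longrightarrow> vop V u c v = 0" and w: "w \<in> W"
  shows "(fwd_diff ^^ k) (\<lambda>m n. Y u m (Y v n w)) m n = (fwd_diff ^^ k) (\<lambda>m n. Y v n (Y u m w)) m n"
proof -
  have "shift_pow (int k) (\<lambda>c d. Y (vop V u c v) d w) m n = 0"
    by (rule shift_pow_vanish) (simp add: k w)
  then have "diff_pow (int k) (\<lambda>m n. Y u m (Y v n w)) m n = (-1) powi (int k) *\<^sub>C diff_pow (int k) (\<lambda>n m. Y v n (Y u m w)) n m"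
    using jacobi_diff_pow[OF w, of "int k" u v m n] by simp
  then show ?thesis
    unfolding diff_pow_nat[OF antidiag_finite_YY[OF w]] fwd_diff_flip[of k "\<lambda>m n. Y v n (Y u m w)"]
    by (simp add: scaleC_scaleC scaleC_one flip: power_add)
qed

text \<open>In the second product of the Jacobi identity \<open>u\<close> acts on \<open>w\<close>
  with modes at least \<open>M\<close>, so that product disappears, for every
  \<open>l\<close>.\<close>

lemma associativity:
  assumes M: "\<And>m. m \<ge> M \<Longrightarrow> Y u m w = 0" and w: "w \<in> W"
  shows "shift_pow l (\<lambda>c d. Y (vop V u c v) d w) M n = diff_pow l (\<lambda>m n. Y u m (Y v n w)) M n"
proof -
  have "diff_pow l (\<lambda>n m. Y v n (Y u m w)) n M = 0" by (rule diff_pow_vanish) (simp add: M)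
  then show ?thesis using jacobi_diff_pow[OF w, of l u v M n] by simp
qed

end

section \<open>Tensor product action of two commuting modules\<close>

locale commuting_modules =
  A1: weak_module V1 UNIV "vop V1" + A2: weak_module V2 UNIV "vop V2" +
  M1: weak_module V1 D Y1 + M2: weak_module V2 D Y2
  for V1 :: "'v1::complex_vector voa" and V2 :: "'v2::complex_vector voa"
    and D :: "'b::complex_vector set" and Y1 Y2 +
  assumes commute: "w \<in> D \<Longrightarrow> Y1 u m (Y2 v n w) = Y2 v n (Y1 u m w)"
begin

definition P :: "'v1 \<Rightarrow> 'v2 \<Rightarrow> int \<Rightarrow> 'b \<Rightarrow> 'b" where
  "P u v n w = Sum_any (\<lambda>i. Y1 u i (Y2 v (n - 1 - i) w))"

definition YY :: "('v1, 'v2) tensor \<Rightarrow> int \<Rightarrow> 'b \<Rightarrow> 'b" where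
  "YY s n w = tensor_lift (\<lambda>u v. P u v n w) s"

lemma bounds:
  assumes "w \<in> D" shows "\<exists>N. (\<forall>n\<ge>N. Y1 u n w = 0) \<and> (\<forall>n\<ge>N. Y2 v n w = 0)"
proof -
  obtain N M where "\<forall>n\<ge>N. Y1 u n w = 0" "\<forall>n\<ge>M. Y2 v n w = 0"
    using M1.truncation[OF assms] M2.truncation[OF assms] by blast
  then show ?thesis by (intro exI[of _ "max N M"]) simp
qed

lemma P_finite:
  assumes w: "w \<in> D" shows "finite {i. Y1 u i (Y2 v (n - 1 - i) w) \<noteq> 0}"
proof -
  obtain N where N: "\<forall>n\<ge>N. Y1 u n w = 0" "\<forall>n\<ge>N. Y2 v n w = 0" using bounds[OF w] by blast
  show ?thesis
  proof (rule finite_support_int)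
    show "Y1 u i (Y2 v (n - 1 - i) w) = 0" if "i \<ge> N" for i using that by (simp add: N commute[OF w])
    show "Y1 u i (Y2 v (n - 1 - i) w) = 0" if "i \<le> n - 1 - N" for i using that by (simp add: N)
  qed
qed

lemma P_closed: "w \<in> D \<Longrightarrow> P u v n w \<in> D"
  unfolding P_def by (rule Sum_any_in) (auto intro: M1.closed M2.closed M1.W_0 M1.W_add)

lemma P_linear:
  assumes w: "w \<in> D"
  shows "P (u + u') v n w = P u v n w + P u' v n w" "P (c *\<^sub>C u) v n w = c *\<^sub>C P u v n w"
    "P u (v + v') n w = P u v n w + P u v' n w" "P u (c *\<^sub>C v) n w = c *\<^sub>C P u v n w"
  unfolding P_def
  by (simp_all add: M1.add_left M1.scale_left M1.add_right M1.scale_right M2.add_left M2.scale_left M2.closed w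
     Sum_any.distrib P_finite Sum_any_scale)

lemma P_linear_right:
  assumes w: "w \<in> D"
  shows "w' \<in> D \<Longrightarrow> P u v n (w + w') = P u v n w + P u v n w'" "P u v n (c *\<^sub>C w) = c *\<^sub>C P u v n w"
  unfolding P_def
  by (simp_all add: M1.add_right M1.scale_right M2.add_right M2.scale_right M2.closed w
     Sum_any.distrib P_finite Sum_any_scale)

lemma P_0_right [simp]: "P u v n 0 = 0" by (simp add: P_def)

lemma P_vanish:
  assumes "\<forall>n\<ge>N. Y1 u n w = 0" "\<forall>n\<ge>M. Y2 v n w = 0" "w \<in> D" "n \<ge> N + M"
  shows "P u v n w = 0"
proof -
  have "Y1 u i (Y2 v (n - 1 - i) w) = 0" for i
  proof (cases "i \<ge> N")
    case True
    then show ?thesis using assms by (simp add: commute)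
  next
    case False
    then show ?thesis using assms by simp
  qed
  then show ?thesis by (simp add: P_def)
qed

lemma P_truncation:
  assumes w: "w \<in> D" shows "\<exists>N. \<forall>n\<ge>N. P u v n w = 0"
proof -
  obtain N where "\<forall>n\<ge>N. Y1 u n w = 0" "\<forall>n\<ge>N. Y2 v n w = 0" using bounds[OF w] by blast
  from P_vanish[OF this w] show ?thesis by blast
qed

lemma YY_tensor: "w \<in> D \<Longrightarrow> YY (u \<otimes>\<^sub>C v) n w = P u v n w"
  unfolding YY_def by (rule tensor_lift_tensor; rule clinearI) (simp_all add: P_linear)

lemma YY_linear:
  assumes "w \<in> D"
  shows "YY (s + t) n w = YY s n w + YY t n w" "YY (c *\<^sub>C s) n w = c *\<^sub>C YY s n w"
proof -
  have "clinear (\<lambda>s. YY s n w)"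
    unfolding YY_def by (rule clinear_tensor_lift; rule clinearI) (simp_all add: P_linear assms)
  then show "YY (s + t) n w = YY s n w + YY t n w" "YY (c *\<^sub>C s) n w = c *\<^sub>C YY s n w"
    by (auto simp: Vector_Spaces.linear_iff)
qed

lemma YY_0: "w \<in> D \<Longrightarrow> YY 0 n w = 0"
  using YY_linear(2)[of w 0 0 n] by simp

lemma YY_closed: "w \<in> D \<Longrightarrow> YY s n w \<in> D"
  by (induction s rule: tensor_induct) (auto simp: YY_tensor YY_linear intro: P_closed M1.W_add)

lemma YY_linear_right:
  assumes "w \<in> D" "w' \<in> D"
  shows "YY s n (w + w') = YY s n w + YY s n w'" "YY s n (c *\<^sub>C w) = c *\<^sub>C YY s n w"
proof -
  show "YY s n (w + w') = YY s n w + YY s n w'"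
    by (induction s rule: tensor_induct) (simp_all add: YY_tensor YY_linear P_linear_right assms M1.W_add)
  show "YY s n (c *\<^sub>C w) = c *\<^sub>C YY s n w"
    by (induction s rule: tensor_induct) (simp_all add: YY_tensor YY_linear P_linear_right assms M1.W_scale scaleC_add_right)
qed

lemma YY_0_right [simp]: "YY s n 0 = 0"
  using YY_linear_right(2)[of 0 0 s n 0] M1.W_0 by simp

lemma YY_truncation:
  assumes w: "w \<in> D" shows "\<exists>N. \<forall>n\<ge>N. YY s n w = 0"
proof (induction s rule: tensor_induct)
  case (tensor u v)
  show ?case using P_truncation[OF w] by (simp add: YY_tensor[OF w])
next
  case (add s t)
  then obtain N M where "\<forall>n\<ge>N. YY s n w = 0" "\<forall>n\<ge>M. YY t n w = 0" by blast
  then show ?case by (intro exI[of _ "max N M"]) (simp add: YY_linear[OF w])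
qed

lemma YY_vacuum:
  assumes w: "w \<in> D" shows "YY (vac (tensor_voa V1 V2)) n w = (if n = -1 then w else 0)"
proof -
  have "P (vac V1) (vac V2) n w = Y1 (vac V1) (-1) (Y2 (vac V2) (n - 1 - (-1)) w)"
    unfolding P_def by (rule Sum_any_single) (simp add: M1.vacuum M2.closed w)
  also have "\<dots> = (if n = -1 then w else 0)"
    by (simp add: M1.vacuum M2.closed M2.vacuum w M1.W_0)
  finally show ?thesis by (simp add: tensor_voa_def YY_tensor w)
qed

lemma antidiag_finite_YYYY: "w \<in> D \<Longrightarrow> antidiag_finite (\<lambda>m n. YY s m (YY t n w))"
proof -
  assume "w \<in> D"
  then obtain N where "\<forall>n\<ge>N. YY t n w = 0" using YY_truncation by blast
  then show ?thesis by (intro antidiag_finite_right[of N]) auto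
qed

text \<open>Commutativity collects the modes of each algebra, so that a product of two tensor modes
  becomes the convolution of two independent two-variable series.\<close>

definition Q :: "'v1 \<Rightarrow> 'v1 \<Rightarrow> 'v2 \<Rightarrow> 'v2 \<Rightarrow> 'b \<Rightarrow> int \<Rightarrow> int \<Rightarrow> int \<Rightarrow> int \<Rightarrow> 'b" where
  "Q u v u' v' w a b a' b' = Y1 u a (Y1 v b (Y2 u' a' (Y2 v' b' w)))"

lemmas closed = M1.closed M2.closed

lemma Q_bounds:
  assumes w: "w \<in> D"
  shows "\<exists>B. \<forall>b\<ge>B. \<forall>a a' b'. Q u v u' v' w a b a' b' = 0 \<and> Q u v u' v' w a b' a' b = 0"
    and "\<exists>A. \<forall>a a'. a \<ge> A \<or> a' \<ge> A \<longrightarrow> Q u v u' v' w a b a' b' = 0"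
proof -
  obtain N where N: "\<forall>n\<ge>N. Y1 v n w = 0" "\<forall>n\<ge>N. Y2 v' n w = 0" using bounds[OF w] by blast
  have "Q u v u' v' w a b a' b' = 0" if "b \<ge> N" for a b a' b'
    using that N by (simp add: Q_def commute closed w)
  moreover have "Q u v u' v' w a b a' b' = 0" if "b' \<ge> N" for a b a' b'
    using that N by (simp add: Q_def)
  ultimately show "\<exists>B. \<forall>b\<ge>B. \<forall>a a' b'. Q u v u' v' w a b a' b' = 0 \<and> Q u v u' v' w a b' a' b = 0"
    by blast
  define y where "y = Y1 v b (Y2 v' b' w)"
  have y: "y \<in> D" by (simp add: y_def closed w)
  obtain A where A: "\<forall>n\<ge>A. Y1 u n y = 0" "\<forall>n\<ge>A. Y2 u' n y = 0" using bounds[OF y] by blast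
  have "Q u v u' v' w a b a' b' = Y1 u a (Y2 u' a' y)" for a a'
    by (simp add: Q_def y_def commute closed w)
  moreover have "Y1 u a (Y2 u' a' y) = 0" if "a \<ge> A \<or> a' \<ge> A" for a a'
    using that
  proof
    assume "a \<ge> A" then show ?thesis by (simp add: A commute[OF y])
  next
    assume "a' \<ge> A" then show ?thesis by (simp add: A)
  qed
  ultimately show "\<exists>A. \<forall>a a'. a \<ge> A \<or> a' \<ge> A \<longrightarrow> Q u v u' v' w a b a' b' = 0" by (intro exI[of _ A]) simp
qed

lemma Q_conv_finite: "w \<in> D \<Longrightarrow> conv_finite (Q u v u' v' w)"
proof -
  assume w: "w \<in> D"
  obtain B where "\<forall>b\<ge>B. \<forall>a a' b'. Q u v u' v' w a b a' b' = 0 \<and> Q u v u' v' w a b' a' b = 0"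
    using Q_bounds(1)[OF w] by blast
  then show ?thesis by (intro conv_finiteI[of B] Q_bounds(2)[OF w]) auto
qed

lemma PP_conv:
  assumes w: "w \<in> D"
  shows "P u u' m (P v v' n w) = conv (Q u v u' v' w) m n"
proof -
  have "Y1 u a (Y2 u' (m - 1 - a) (P v v' n w)) = Sum_any (\<lambda>b. Q u v u' v' w a b (m - 1 - a) (n - 1 - b))" for a
  proof -
    have "Y1 u a (Y2 u' (m - 1 - a) (P v v' n w)) = Sum_any (\<lambda>b. Y1 u a (Y2 u' (m - 1 - a) (Y1 v b (Y2 v' (n - 1 - b) w))))"
      unfolding P_def
      by (rule Sum_any_additive[where W = D and h = "\<lambda>x. Y1 u a (Y2 u' (m - 1 - a) x)"])
        (simp_all add: P_finite w closed M1.W_0 M1.W_add M1.add_right M2.add_right)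
    then show ?thesis by (simp add: Q_def commute closed w)
  qed
  then have "P u u' m (P v v' n w) = Sum_any (\<lambda>a. Sum_any (\<lambda>b. Q u v u' v' w a b (m - 1 - a) (n - 1 - b)))"
    unfolding P_def[of u u'] by simp
  also have "\<dots> = conv (Q u v u' v' w) m n" unfolding conv_def
    by (rule Sum_any_pair) (use Q_conv_finite[OF w] in \<open>simp add: conv_finite_def\<close>)
  finally show ?thesis .
qed

text \<open>A power of \<open>x1 - x2\<close> for the first pair exchanges the \<open>Y1\<close>
  modes, another one for the second pair exchanges the \<open>Y2\<close> modes. Convolution merges
  the powers, so the orders add.\<close>

lemma product_locality:
  assumes w: "w \<in> D" and k: "\<And>c. c \<ge> int k \<Longrightarrow> vop V1 u c v = 0" and k': "\<And>c. c \<ge> int k' \<Longrightarrow> vop V2 u' c v' = 0"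
  shows "(fwd_diff ^^ (k' + k)) (\<lambda>m n. P u u' m (P v v' n w)) m n = (fwd_diff ^^ (k' + k)) (\<lambda>m n. P v v' n (P u u' m w)) m n"
proof -
  define QB where "QB a b a' b' = Q v u v' u' w b a b' a'" for a b a' b'
  have QB_fin: "conv_finite QB"
  proof -
    have fin: "finite {(a, b). Q v u v' u' w a b (n - 1 - a) (m - 1 - b) \<noteq> 0}" for m n
      using Q_conv_finite[OF w] by (simp add: conv_finite_def)
    have "{(a, b). QB a b (m - 1 - a) (n - 1 - b) \<noteq> 0} = (\<lambda>(a, b). (b, a)) ` {(a, b). Q v u v' u' w a b (n - 1 - a) (m - 1 - b) \<noteq> 0}" for m n
      by (auto simp: QB_def)
    then show ?thesis using fin by (simp add: conv_finite_def)
  qed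
  have QB: "P v v' n (P u u' m w) = conv QB m n" for m n
  proof -
    have "range (\<lambda>(a, b). (b, a)) = (UNIV :: (int \<times> int) set)" by (auto intro!: image_eqI[of _ _ "(b, a)" for a b])
    then have "inj (\<lambda>(a, b). (b :: int, a :: int))" "{x. F x \<noteq> 0} \<subseteq> range (\<lambda>(a, b). (b :: int, a :: int))"
      for F :: "int \<times> int \<Rightarrow> 'b" by (auto simp: inj_def)
    from Sum_any_reindex[OF this, of "\<lambda>(a, b). QB a b (m - 1 - a) (n - 1 - b)"] show ?thesis
      unfolding PP_conv[OF w] conv_def by (simp add: QB_def case_prod_unfold)
  qed
  \<comment> \<open>The half-way stage: the \<open>Y1\<close> modes are exchanged, the
    \<open>Y2\<close> modes not yet.\<close>
  define QM where "QM a b a' b' = Y1 v b (Y1 u a (Y2 u' a' (Y2 v' b' w)))" for a b a' b'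
  have A: "(in_first fwd_diff ^^ k) (Q u v u' v' w) = (in_first fwd_diff ^^ k) QM"
    unfolding fun_eq_iff in_first_funpow Q_def QM_def
    by (intro allI M1.locality k) (simp_all add: closed w)
  have QM': "QM a b a' b' = Y2 u' a' (Y2 v' b' (Y1 v b (Y1 u a w)))" for a b a' b'
    by (simp add: QM_def commute closed w)
  have QB': "QB a b a' b' = Y2 v' b' (Y2 u' a' (Y1 v b (Y1 u a w)))" for a b a' b'
    by (simp add: QB_def Q_def commute closed w)
  have B: "(in_second fwd_diff ^^ k') QM = (in_second fwd_diff ^^ k') QB"
    unfolding fun_eq_iff in_second_funpow QM' QB'
    by (intro allI M2.locality k') (simp_all add: closed w)
  have "(in_second fwd_diff ^^ k') ((in_first fwd_diff ^^ k) (Q u v u' v' w)) = (in_second fwd_diff ^^ k') ((in_first fwd_diff ^^ k) QB)"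
    unfolding A by (simp only: B flip: fwd_diff_commute)
  then have "conv ((in_second fwd_diff ^^ k') ((in_first fwd_diff ^^ k) (Q u v u' v' w))) = conv ((in_second fwd_diff ^^ k') ((in_first fwd_diff ^^ k) QB))"
    by simp
  then have "(fwd_diff ^^ (k' + k)) (conv (Q u v u' v' w)) = (fwd_diff ^^ (k' + k)) (conv QB)"
    by (simp add: conv_fwd Q_conv_finite[OF w] QB_fin funpow_add)
  moreover have "(\<lambda>m n. P u u' m (P v v' n w)) = conv (Q u v u' v' w)"
    "(\<lambda>m n. P v v' n (P u u' m w)) = conv QB"
    by (intro ext PP_conv[OF w] QB)+
  ultimately show ?thesis by simp
qed

lemma YY_vop_conv:
  assumes w: "w \<in> D"
  shows "YY (vop (tensor_voa V1 V2) (u \<otimes>\<^sub>C u') c (v \<otimes>\<^sub>C v')) d w =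
      conv (\<lambda>i j c' d'. Y1 (vop V1 u i v) j (Y2 (vop V2 u' c' v') d' w)) c d"
    and "conv_finite (\<lambda>i j c' d'. Y1 (vop V1 u i v) j (Y2 (vop V2 u' c' v') d' w))"
proof -
  obtain N M where N: "\<forall>n\<ge>N. vop V1 u n v = 0" and M: "\<forall>n\<ge>M. vop V2 u' n v' = 0"
    using A1.truncation A2.truncation by (metis UNIV_I)
  show fin: "conv_finite (\<lambda>i j c' d'. Y1 (vop V1 u i v) j (Y2 (vop V2 u' c' v') d' w))"
    unfolding conv_finite_def
  proof (intro allI)
    fix c d
    let ?S = "{(i, j). Y1 (vop V1 u i v) j (Y2 (vop V2 u' (c - 1 - i) v') (d - 1 - j) w) \<noteq> 0}"
    have "?S \<subseteq> (\<Union>i\<in>{c - 1 - M..N}. {i} \<times> {j. Y1 (vop V1 u i v) j (Y2 (vop V2 u' (c - 1 - i) v') (d - 1 - j) w) \<noteq> 0})"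
    proof clarify
      fix i j assume nz: "Y1 (vop V1 u i v) j (Y2 (vop V2 u' (c - 1 - i) v') (d - 1 - j) w) \<noteq> 0"
      have "\<not> i \<ge> N" using nz N by (auto simp: closed w)
      moreover have "\<not> c - 1 - i \<ge> M" using nz M by (auto simp: w)
      ultimately show "(i, j) \<in> (\<Union>i\<in>{c - 1 - M..N}. {i} \<times> {j. Y1 (vop V1 u i v) j (Y2 (vop V2 u' (c - 1 - i) v') (d - 1 - j) w) \<noteq> 0})"
        using nz by auto
    qed
    then show "finite ?S" by (rule finite_subset) (auto intro!: P_finite[OF w])
  qed
  have "YY (vop (tensor_voa V1 V2) (u \<otimes>\<^sub>C u') c (v \<otimes>\<^sub>C v')) d w = Sum_any (\<lambda>i. YY (vop V1 u i v \<otimes>\<^sub>C vop V2 u' (c - 1 - i) v') d w)"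
    unfolding tensor_voa_vop[OF A1.weak_module_axioms A2.weak_module_axioms]
    by (rule Sum_any_additive[where W = UNIV and h = "\<lambda>s. YY s d w"])
      (simp_all add: vop_finite[OF A1.weak_module_axioms A2.weak_module_axioms] YY_linear YY_0 w)
  also have "\<dots> = Sum_any (\<lambda>i. Sum_any (\<lambda>j. Y1 (vop V1 u i v) j (Y2 (vop V2 u' (c - 1 - i) v') (d - 1 - j) w)))"
    by (simp add: YY_tensor w P_def)
  also have "\<dots> = conv (\<lambda>i j c' d'. Y1 (vop V1 u i v) j (Y2 (vop V2 u' c' v') d' w)) c d"
    unfolding conv_def by (rule Sum_any_pair) (use fin in \<open>simp add: conv_finite_def\<close>)
  finally show "YY (vop (tensor_voa V1 V2) (u \<otimes>\<^sub>C u') c (v \<otimes>\<^sub>C v')) d w =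
      conv (\<lambda>i j c' d'. Y1 (vop V1 u i v) j (Y2 (vop V2 u' c' v') d' w)) c d" .
qed

text \<open>Each factor is re-expanded at \<open>x1 = x2 + x0\<close> after multiplication by a
  power of \<open>x2 + x0\<close> that kills its second Jacobi term. Convolution multiplies these
  powers, and \<open>conv_diff_pow\<close> identifies the product of the re-expansions.\<close>

lemma product_associativity:
  assumes w: "w \<in> D" and k: "\<And>a. a \<ge> int k \<Longrightarrow> Y1 u a w = 0" and k': "\<And>a. a \<ge> int k' \<Longrightarrow> Y2 u' a w = 0"
  shows "shift_pow l (\<lambda>c d. YY (vop (tensor_voa V1 V2) (u \<otimes>\<^sub>C u') c (v \<otimes>\<^sub>C v')) d w) (int k + int k') n
    = diff_pow l (\<lambda>m n. P u u' m (P v v' n w)) (int k + int k') n"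
proof -
  define QC where "QC = (\<lambda>i j c' d'. Y1 (vop V1 u i v) j (Y2 (vop V2 u' c' v') d' w))"
  \<comment> \<open>The first factor after re-expansion, as a vector of \<open>D\<close>.
    Associativity for the second factor is then applied to this vector in place of
    \<open>w\<close>.\<close>
  define y where "y c d = diff_pow c (\<lambda>m n. Y1 u m (Y1 v n w)) (int k) d" for c d
  have y: "y c d \<in> D" for c d
    unfolding y_def by (rule diff_pow_in) (simp_all add: closed w M1.subspace)
  obtain N where N: "\<And>n. n \<ge> N \<Longrightarrow> vop V1 u n v = 0" using A1.truncation by blast
  obtain N' where N': "\<And>n. n \<ge> N' \<Longrightarrow> vop V2 u' n v' = 0" using A2.truncation by blast
  have pull: "h (y c d) = diff_pow c (\<lambda>m n. h (Y1 u m (Y1 v n w))) (int k) d"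
    if "\<And>x y. x \<in> D \<Longrightarrow> y \<in> D \<Longrightarrow> h (x + y) = h x + h y" "\<And>x c. x \<in> D \<Longrightarrow> h (c *\<^sub>C x) = c *\<^sub>C h x" for h c d
    unfolding y_def
    by (rule diff_pow_additive_on[where W = D, OF M1.antidiag_finite_YY[OF w]]) (simp_all add: closed w M1.subspace that)
  have 1: "(in_first fwd_sum ^^ k) QC = (\<lambda>c d c' d'. Y2 (vop V2 u' c' v') d' (y c d))"
  proof (intro ext)
    fix c d c' d'
    define x where "x = Y2 (vop V2 u' c' v') d' w"
    have x: "x \<in> D" by (simp add: x_def closed w)
    have "(in_first fwd_sum ^^ k) QC c d c' d' = (fwd_sum ^^ k) (\<lambda>c d. Y1 (vop V1 u c v) d x) c d"
      unfolding in_first_funpow QC_def x_def ..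
    also have "\<dots> = shift_pow c (\<lambda>c d. Y1 (vop V1 u c v) d x) (int k) d"
      by (rule shift_pow_nat[symmetric, of N]) (simp add: N x)
    also have "\<dots> = diff_pow c (\<lambda>m n. Y1 u m (Y1 v n x)) (int k) d"
      by (rule M1.associativity[OF _ x]) (simp add: x_def commute[OF w] k)
    also have "\<dots> = Y2 (vop V2 u' c' v') d' (y c d)"
      by (subst pull) (simp_all add: M2.add_right M2.scale_right x_def commute closed w)
    finally show "(in_first fwd_sum ^^ k) QC c d c' d' = Y2 (vop V2 u' c' v') d' (y c d)" .
  qed
  have 2: "(in_second fwd_sum ^^ k') ((in_first fwd_sum ^^ k) QC) =
     (\<lambda>c d c' d'. diff_pow c' (\<lambda>a' b'. diff_pow c (\<lambda>a b. Q u v u' v' w a b a' b') (int k) d) (int k') d')"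
  proof (intro ext)
    fix c d c' d'
    have "(in_second fwd_sum ^^ k') ((in_first fwd_sum ^^ k) QC) c d c' d' = (fwd_sum ^^ k') (\<lambda>c' d'. Y2 (vop V2 u' c' v') d' (y c d)) c' d'"
      unfolding 1 in_second_funpow ..
    also have "\<dots> = shift_pow c' (\<lambda>c' d'. Y2 (vop V2 u' c' v') d' (y c d)) (int k') d'"
      by (rule shift_pow_nat[symmetric, of N']) (simp add: N' y)
    also have "\<dots> = diff_pow c' (\<lambda>m n. Y2 u' m (Y2 v' n (y c d))) (int k') d'"
    proof (rule M2.associativity[OF _ y])
      fix m assume "m \<ge> int k'"
      then have "Y2 u' m w = 0" by (rule k')
      then have "Y2 u' m (Y1 u a (Y1 v b w)) = 0" for a b by (simp add: closed w flip: commute)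
      then show "Y2 u' m (y c d) = 0" by (subst pull) (simp_all add: M2.add_right M2.scale_right diff_pow_vanish)
    qed
    also have "Y2 u' a' (Y2 v' b' (y c d)) = diff_pow c (\<lambda>a b. Q u v u' v' w a b a' b') (int k) d" for a' b'
      by (subst pull[of "\<lambda>x. Y2 u' a' (Y2 v' b' x)"])
         (simp_all add: M2.add_right M2.scale_right closed Q_def commute w)
    then have "diff_pow c' (\<lambda>m n. Y2 u' m (Y2 v' n (y c d))) (int k') d' =
      diff_pow c' (\<lambda>a' b'. diff_pow c (\<lambda>a b. Q u v u' v' w a b a' b') (int k) d) (int k') d'" by simp
    finally show "(in_second fwd_sum ^^ k') ((in_first fwd_sum ^^ k) QC) c d c' d' =
      diff_pow c' (\<lambda>a' b'. diff_pow c (\<lambda>a b. Q u v u' v' w a b a' b') (int k) d) (int k') d'" .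
  qed
  have CC: "(\<lambda>c d. YY (vop (tensor_voa V1 V2) (u \<otimes>\<^sub>C u') c (v \<otimes>\<^sub>C v')) d w) = conv QC"
    using YY_vop_conv(1)[OF w] by (simp add: QC_def fun_eq_iff)
  have fin: "conv_finite QC" unfolding QC_def by (rule YY_vop_conv(2)[OF w])
  obtain T where T: "\<forall>n\<ge>T. vop (tensor_voa V1 V2) (u \<otimes>\<^sub>C u') n (v \<otimes>\<^sub>C v') = 0"
    using tensor_voa_truncation[OF A1.weak_module_axioms A2.weak_module_axioms] by blast
  have "shift_pow l (conv QC) (int (k' + k)) n = (fwd_sum ^^ (k' + k)) (conv QC) l n"
    by (rule shift_pow_nat[of T]) (simp add: T YY_0 w flip: CC)
  also have "\<dots> = conv ((in_second fwd_sum ^^ k') ((in_first fwd_sum ^^ k) QC)) l n"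
    by (simp add: conv_fwd fin funpow_add)
  also have "\<dots> = diff_pow l (conv (Q u v u' v' w)) (int k + int k') n"
  proof -
    obtain B where B: "\<forall>b\<ge>B. \<forall>a a' b'. Q u v u' v' w a b a' b' = 0 \<and> Q u v u' v' w a b' a' b = 0"
      using Q_bounds(1)[OF w] by blast
    show ?thesis unfolding 2 by (rule conv_diff_pow[of B]) (use B Q_bounds(2)[OF w] in auto)
  qed
  finally show ?thesis unfolding CC PP_conv[OF w] by (simp add: add.commute)
qed

lemma YY_jacobi_tensor:
  assumes w: "w \<in> D"
  shows "diff_pow l (\<lambda>m n. P u u' m (P v v' n w)) m n - (-1) powi l *\<^sub>C diff_pow l (\<lambda>n m. P v v' n (P u u' m w)) n m
    = shift_pow l (\<lambda>c d. YY (vop (tensor_voa V1 V2) (u \<otimes>\<^sub>C u') c (v \<otimes>\<^sub>C v')) d w) m n"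
proof -
  define CC where "CC = (\<lambda>c d. YY (vop (tensor_voa V1 V2) (u \<otimes>\<^sub>C u') c (v \<otimes>\<^sub>C v')) d w)"
  define J where "J l m n = diff_pow l (\<lambda>m n. P u u' m (P v v' n w)) m n
    - (-1) powi l *\<^sub>C diff_pow l (\<lambda>n m. P v v' n (P u u' m w)) n m - shift_pow l CC m n" for l m n
  have af: "antidiag_finite (\<lambda>m n. P u u' m (P v v' n w))" for u v u' v'
    using antidiag_finite_YYYY[OF w, of "u \<otimes>\<^sub>C u'" "v \<otimes>\<^sub>C v'"] by (simp add: YY_tensor w P_closed)
  obtain N where N: "\<And>n. n \<ge> N \<Longrightarrow> vop V1 u n v = 0" using A1.truncation by blast
  obtain N' where N': "\<And>n. n \<ge> N' \<Longrightarrow> vop V2 u' n v' = 0" using A2.truncation by blast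
  have CC0: "CC c d = 0" if "c \<ge> int (nat N' + nat N)" for c d
  proof -
    have "vop V1 u i v \<otimes>\<^sub>C vop V2 u' (c - 1 - i) v' = 0" for i
      using that by (cases "i \<ge> N") (simp_all add: N N' tensor_zero split: if_splits)
    then show ?thesis
      by (simp add: CC_def tensor_voa_vop[OF A1.weak_module_axioms A2.weak_module_axioms] YY_0 w)
  qed
  have rec: "J (l + 1) m n = J l (m + 1) n - J l m (n + 1)" for l m n
    unfolding J_def diff_pow_Suc[OF af]
    by (subst shift_pow_Suc[of "int (nat N' + nat N)"])
      (simp_all add: CC0 power_int_add_1 complex_vector.scale_right_diff_distrib)
  \<comment> \<open>If \<open>c \<ge> N + N'\<close>, then \<open>i \<ge> N\<close> or
    \<open>c - 1 - i \<ge> N'\<close>, so all products of index at least \<open>k\<close> vanish;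
    this is the level at which locality starts the recursion.\<close>
  define k where "k = nat N' + nat N"
  have loc: "J (int k) m n = 0" for m n
  proof -
    have "shift_pow (int k) CC m n = 0" by (rule shift_pow_vanish) (simp add: CC0 k_def)
    moreover have "(fwd_diff ^^ k) (\<lambda>m n. P u u' m (P v v' n w)) m n = (fwd_diff ^^ k) (\<lambda>m n. P v v' n (P u u' m w)) m n"
      unfolding k_def by (rule product_locality[OF w]) (simp_all add: N N' split: if_splits)
    ultimately show ?thesis
      unfolding J_def diff_pow_nat[OF af] fwd_diff_flip[of k "\<lambda>m n. P v v' n (P u u' m w)"]
      by (simp add: scaleC_scaleC scaleC_one flip: power_add)
  qed
  obtain K where K: "\<forall>n\<ge>K. Y1 u n w = 0" "\<forall>n\<ge>K. Y2 u' n w = 0" using bounds[OF w] by blast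
  \<comment> \<open>The row \<open>m = 2 K\<close>, taken with \<open>nat K\<close>, kills the
    second product by \<open>P_vanish\<close> and serves as the seed for every
    \<open>l\<close>.\<close>
  have assoc: "J l (int (nat K) + int (nat K)) n = 0" for l n
  proof -
    have "diff_pow l (\<lambda>n m. P v v' n (P u u' m w)) n (int (nat K) + int (nat K)) = 0"
      by (rule diff_pow_vanish) (subst P_vanish[OF K w], auto)
    moreover have "shift_pow l CC (int (nat K) + int (nat K)) n = diff_pow l (\<lambda>m n. P u u' m (P v v' n w)) (int (nat K) + int (nat K)) n"
      unfolding CC_def by (rule product_associativity[OF w]) (simp_all add: K split: if_splits)
    ultimately show ?thesis by (simp add: J_def)
  qed
  have "J l m n = 0" by (rule difference_recursion_zero[where J = J, OF rec loc]) (use assoc in blast)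
  then show ?thesis by (simp add: J_def CC_def)
qed

lemma YY_jacobi:
  assumes w: "w \<in> D"
  shows "diff_pow l (\<lambda>m n. YY s m (YY t n w)) m n - (-1) powi l *\<^sub>C diff_pow l (\<lambda>n m. YY t n (YY s m w)) n m
    = shift_pow l (\<lambda>c d. YY (vop (tensor_voa V1 V2) s c t) d w) m n"
proof (induction s rule: tensor_induct)
  case (tensor u u')
  show ?case
  proof (induction t rule: tensor_induct)
    case (tensor v v')
    show ?case using YY_jacobi_tensor[OF w] by (simp add: YY_tensor P_closed w)
  next
    case (add t t')
    note T = tensor_voa_truncation[OF A1.weak_module_axioms A2.weak_module_axioms]
      and A = tensor_voa_add[OF A1.weak_module_axioms A2.weak_module_axioms]
    obtain N N' where "\<forall>n\<ge>N. vop (tensor_voa V1 V2) (u \<otimes>\<^sub>C u') n t = 0" "\<forall>n\<ge>N'. vop (tensor_voa V1 V2) (u \<otimes>\<^sub>C u') n t' = 0"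
      using T by metis
    then have "shift_pow l (\<lambda>c d. YY (vop (tensor_voa V1 V2) (u \<otimes>\<^sub>C u') c t) d w + YY (vop (tensor_voa V1 V2) (u \<otimes>\<^sub>C u') c t') d w) m n =
      shift_pow l (\<lambda>c d. YY (vop (tensor_voa V1 V2) (u \<otimes>\<^sub>C u') c t) d w) m n + shift_pow l (\<lambda>c d. YY (vop (tensor_voa V1 V2) (u \<otimes>\<^sub>C u') c t') d w) m n"
      by (intro shift_pow_add[of "max N N'"]) (auto simp: w YY_0)
    then show ?case using add
      by (simp add: A YY_linear YY_linear_right YY_closed w diff_pow_add antidiag_finite_YYYY scaleC_add_right algebra_simps)
  qed
next
  case (add s s')
  note T = tensor_voa_truncation[OF A1.weak_module_axioms A2.weak_module_axioms]
    and A = tensor_voa_add[OF A1.weak_module_axioms A2.weak_module_axioms]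
  obtain N N' where "\<forall>n\<ge>N. vop (tensor_voa V1 V2) s n t = 0" "\<forall>n\<ge>N'. vop (tensor_voa V1 V2) s' n t = 0"
    using T by metis
  then have "shift_pow l (\<lambda>c d. YY (vop (tensor_voa V1 V2) s c t) d w + YY (vop (tensor_voa V1 V2) s' c t) d w) m n =
    shift_pow l (\<lambda>c d. YY (vop (tensor_voa V1 V2) s c t) d w) m n + shift_pow l (\<lambda>c d. YY (vop (tensor_voa V1 V2) s' c t) d w) m n"
    by (intro shift_pow_add[of "max N N'"]) (auto simp: w YY_0)
  then show ?case using add
    by (simp add: A YY_linear YY_linear_right YY_closed w diff_pow_add antidiag_finite_YYYY scaleC_add_right algebra_simps)
qed

theorem YY_weak_module: "weak_module (tensor_voa V1 V2) D YY"
  by (rule weak_moduleI[OF M1.subspace])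
    (rule YY_closed YY_linear YY_linear_right YY_truncation YY_vacuum YY_jacobi; assumption)+

end

section \<open>The action on \<open>Q(z)\<close>-linear functionals\<close>

locale Qz_module = module_translation V Y z + vertex_operator_algebra V
  for V :: "'v::complex_vector voa" and Y :: "'v \<Rightarrow> int \<Rightarrow> 'w::complex_vector \<Rightarrow> 'w" and z
begin

abbreviation "D \<equiv> Qz_functionals Y z"

lemma YL_opposite_eq: "\<alpha> \<in> D \<Longrightarrow> YL_Q_opposite Y z u n \<alpha> = Lq u 0 n \<alpha>"
  and YR_eq: "\<alpha> \<in> D \<Longrightarrow> YR_Q Y z u n \<alpha> = Rq u 0 n \<alpha>"
  by (simp_all add: Lq_Rq_properties(6,7))

lemmas YLR_simps = YL_opposite_eq YR_eq L_in_D R_in_D LR_add LR_scale LR_add_left LR_scale_left D_add D_scale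

lemma YR_weak_module: "weak_module V D (YR_Q Y z)"
proof (rule weak_moduleI)
  fix \<alpha> assume \<alpha>: "\<alpha> \<in> D"
  fix u v and l m n :: int
  show "\<exists>N. \<forall>n\<ge>N. YR_Q Y z u n \<alpha> = 0"
    using vanishes_R[OF \<alpha>, of u] unfolding vanishes_z_def by (auto simp: YR_eq[OF \<alpha>])
  show "YR_Q Y z (vac V) n \<alpha> = (if n = -1 then \<alpha> else 0)"
    by (simp add: YR_eq \<alpha> Lq_Rq_vacuum)
  show "diff_pow l (\<lambda>m n. YR_Q Y z u m (YR_Q Y z v n \<alpha>)) m n
      - (-1) powi l *\<^sub>C diff_pow l (\<lambda>n m. YR_Q Y z v n (YR_Q Y z u m \<alpha>)) n m
      = shift_pow l (\<lambda>c d. YR_Q Y z (vop V u c v) d \<alpha>) m n"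
    using R_jacobi[OF \<alpha>] by (simp add: YLR_simps \<alpha>)
qed (simp_all add: subspace_D YLR_simps)

sublocale opposite_action V D "YL_Q_opposite Y z"
proof
  fix \<alpha> assume \<alpha>: "\<alpha> \<in> D"
  fix u v and l m n :: int
  show "\<exists>N. \<forall>n\<le>N. YL_Q_opposite Y z u n \<alpha> = 0"
    using vanishes_L[OF \<alpha>, of u] unfolding vanishes_inf_def YL_opposite_eq[OF \<alpha>] by (metis add_0)
  show "YL_Q_opposite Y z (vac V) n \<alpha> = (if n = -1 then \<alpha> else 0)"
    by (simp add: YL_opposite_eq \<alpha> Lq_Rq_vacuum)
  show "diff_pow l (\<lambda>m n. YL_Q_opposite Y z v n (YL_Q_opposite Y z u m \<alpha>)) m n
      - (-1) powi l *\<^sub>C diff_pow l (\<lambda>n m. YL_Q_opposite Y z u m (YL_Q_opposite Y z v n \<alpha>)) n m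
      = shift_pow l (\<lambda>c d. YL_Q_opposite Y z (vop V u c v) d \<alpha>) m n"
    using L_jacobi[OF \<alpha>] by (simp add: YLR_simps \<alpha>)
qed (simp_all add: subspace_D YLR_simps)

lemma YL_Q_eq_H: "YL_Q V Y z = H"
  by (simp add: fun_eq_iff YL_Q_def H_def)

text \<open>\<open>Y\<^sup>L\<close> is a finite sum of the modes of its opposite, and each of these
  commutes with \<open>Y\<^sup>R\<close> by \<open>LR_commute\<close>.\<close>

lemma YL_YR_commute:
  assumes \<alpha>: "\<alpha> \<in> D"
  shows "YL_Q V Y z u m (YR_Q Y z v n \<alpha>) = YR_Q Y z v n (YL_Q V Y z u m \<alpha>)"
proof -
  interpret R: weak_module V D "YR_Q Y z" by (rule YR_weak_module)
  have "YR_Q Y z v n (Sum_any (\<lambda>j. YL_Q_opposite Y z (opposite_arg V u j) (- j - m - 2) \<alpha>)) =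
    Sum_any (\<lambda>j. YR_Q Y z v n (YL_Q_opposite Y z (opposite_arg V u j) (- j - m - 2) \<alpha>))"
    by (rule Sum_any_additive[where W = D and h = "YR_Q Y z v n"])
      (simp_all add: H_support G_closed \<alpha> D_plus R.add_right)
  also have "\<dots> = Sum_any (\<lambda>j. YL_Q_opposite Y z (opposite_arg V u j) (- j - m - 2) (YR_Q Y z v n \<alpha>))"
    by (simp add: YLR_simps \<alpha> LR_commute)
  finally show ?thesis by (simp add: YL_Q_def opposite_def)
qed

lemma Y_Q_weak_module: "weak_module (tensor_voa V V) D (Y_Q V Y z)"
proof -
  interpret commuting_modules V V D "YL_Q V Y z" "YR_Q Y z"
    by (intro commuting_modules.intro commuting_modules_axioms.intro)
      (simp_all add: YL_Q_eq_H H_weak_module YR_weak_module YL_YR_commute[unfolded YL_Q_eq_H] weak_module_axioms)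
  have "Y_Q V Y z = YY" by (simp add: fun_eq_iff Y_Q_def YY_def P_def)
  then show ?thesis using YY_weak_module by simp
qed

end

theorem theorem3p12:
  fixes V :: "'v::complex_vector voa"
    and Y :: "'v \<Rightarrow> int \<Rightarrow> 'w::complex_vector \<Rightarrow> 'w"
    and z :: complex
  assumes "vertex_operator_algebra V"
    and "weak_module V UNIV Y"
    and "z \<noteq> 0"
  shows "weak_module (tensor_voa V V) (Qz_functionals Y z) (Y_Q V Y z)"
proof -
  interpret vertex_operator_algebra V by fact
  interpret Y: weak_module V UNIV Y by fact
  interpret Qz_module V Y z
    by unfold_locales (use truncation assms(3) in auto)
  show ?thesis by (rule Y_Q_weak_module)
qed

end
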